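(* Let $\alpha,\beta,\theta$ be real numbers with $$0<\alpha\le 2,\qquad |\theta|\le\min\{\alpha,2-\alpha\},\qquad\text{and}\qquad 0<\beta\le1\ \text{ or }\ 1<\beta\le\alpha\le2 .$$ Let $K_{\alpha,\beta}^\theta(x;t)$ be the Green function of the space-time fractional diffusion equation of orders $\alpha$ (space, with skewness $\theta$) and $\beta$ (time). Then, for $x>0$ and $t>0$: (i) if $0<\beta\le1$, $$K_{\alpha,\beta}^\theta(x;t)=\int_0^\infty L_\alpha^\theta(x;\tau)\,M_\beta(\tau;t)\,d\tau ;$$ (ii) if $0<\beta/\alpha\le1$, $$K_{\alpha,\beta}^\theta(x;t)=\int_0^\infty N_\alpha^\theta(x;\tau)\,M_{\beta/\alpha}(\tau;t)\,d\tau .$$ Here $L_\alpha^\theta(x;\tau)$ is the strictly stable density (the Green function in the space fractional case $\beta=1$), $N_\alpha^\theta(x;\tau)$ is the Green function in the neutral case $\beta=\alpha$, and $M_\nu(\tau;t)$ is the time-dependent $M$-Wright function of order $\nu$.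
   Context: Symbol: $\psi_\alpha^\theta(\kappa)=|\kappa|^\alpha e^{i(\mathrm{sign}\,\kappa)\theta\pi/2}$, $\kappa\in\mathbb R$. The Fourier transform is $\widehat f(\kappa)=\int_{-\infty}^{+\infty}e^{+i\kappa x}f(x)\,dx$ and the Laplace transform (in $t$) is $\widetilde f(s)=\int_0^\infty e^{-st}f(t)\,dt$. Green function. The space-time fractional diffusion equation is ${}_xD_\theta^\alpha u(x,t)={}_tD_*^\beta u(x,t)$, $x\in\mathbb R$, $t\ge0$, where ${}_xD_\theta^\alpha$ is the Riesz-Feller derivative (Fourier multiplier $-\psi_\alpha^\theta(\kappa)$) and ${}_tD_*^\beta$ is the Caputo derivative of order $\beta$. Its Green function $G_{\alpha,\beta}^\theta(x,t)$ is the solution with $u(x,0^+)=\delta(x)$ (and, if $1<\beta\le2$, also $u_t(x,0^+)=0$), i.e. the (generalized) function whose Fourier transform in $x$ and Laplace transform in $t$ is $$\frac{s^{\beta-1}}{s^\beta+\psi_\alpha^\theta(\kappa)} .$$ It has the self-similar form $G_{\alpha,\beta}^\theta(x,t)=t^{-\beta/\alpha}K_{\alpha,\beta}^\theta(x/t^{\beta/\alpha})$, where $K_{\alpha,\beta}^\theta(x)$ is the reduced Green function, and one writes $$K_{\alpha,\beta}^\theta(x;t):=G_{\alpha,\beta}^\theta(x,t)=t^{-\beta/\alpha}K_{\alpha,\beta}^\theta\left(\frac{x}{t^{\beta/\alpha}}\right).$$ Stable densities. $L_\alpha^\theta=K_{\alpha,1}^\theta$ is the probability density on $\mathbb R$ with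 Fourier transform $\exp[-\psi_\alpha^\theta(\kappa)]$, and $L_\alpha^\theta(x;t)=t^{-1/\alpha}L_\alpha^\theta(x/t^{1/\alpha})$. Neutral case. $N_\alpha^\theta=K_{\alpha,\alpha}^\theta$ and $N_\alpha^\theta(x;t)=t^{-1}N_\alpha^\theta(x/t)$. For $0<\alpha<2$, $\alpha-\theta\ne2$ and $x>0$, $$N_\alpha^\theta(x)=\frac1\pi\,\frac{x^{\alpha-1}\sin[\frac\pi2(\alpha-\theta)]}{1+2x^\alpha\cos[\frac\pi2(\alpha-\theta)]+x^{2\alpha}} .$$ $M$-Wright functions. For $0<\nu<1$, $M_\nu(z)=\sum_{n=0}^\infty\frac{(-z)^n}{n!\,\Gamma[-\nu n+(1-\nu)]}$ (with $1/\Gamma=0$ at the poles of $\Gamma$), and for $\nu=1$, $M_1(r)=\delta(r-1)$ (Dirac mass). For $r>0$, $t>0$: $M_\nu(r;t)=t^{-\nu}M_\nu(r/t^\nu)$. Convention: in the borderline cases where one of the functions involved is (or contains) a Dirac mass (e.g. $M_1$; $L_1^{\mp1}(x)=\delta(x\mp1)$; $N_\alpha^\theta$ with $\alpha-\theta=2$), the identities are understood as identities of measures in $x$ on $(0,\infty)$. *)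

theory Defs
  imports "HOL-Probability.Probability"
begin

definition feller_symbol :: "real \<Rightarrow> real \<Rightarrow> real \<Rightarrow> complex" where
  "feller_symbol \<alpha> \<theta> \<kappa> = of_real (\<bar>\<kappa>\<bar> powr \<alpha>) * exp (\<i> * of_real (sgn \<kappa> * \<theta> * pi / 2))"

text \<open>
  Dilation of a law: if \<open>M\<close> has density \<open>f\<close>, then \<open>dilate c M\<close> has density
  \<open>dilate_fun c f\<close>, that is \<open>x \<mapsto> c\<^sup>-\<^sup>1 f (x / c)\<close>, for \<open>c > 0\<close>.
\<close>

definition dilate :: "real \<Rightarrow> real measure \<Rightarrow> real measure" where
  "dilate c M = distr M borel (\<lambda>x. c * x)"

definition dilate_fun :: "real \<Rightarrow> (real \<Rightarrow> real) \<Rightarrow> real \<Rightarrow> real" where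
  "dilate_fun c f x = f (x / c) / c"

text \<open>
  The reduced Green function is a generalized function of \<open>x\<close>, which may contain Dirac masses;
  it is represented by the finite Borel measure \<open>K(x) dx\<close> on the line.  (The Green
  function is a probability law for \<open>0 < \<beta> \<le> 1\<close> and for \<open>1 < \<beta> \<le> \<alpha> \<le> 2\<close>.)
  The Green function at time \<open>t\<close> is the dilation of \<open>K\<close> by \<open>t powr (\<beta> / \<alpha>)\<close>, and the
  condition says that its Fourier transform in \<open>x\<close> (the library's \<open>char\<close> uses the kernel
  \<open>exp (\<i> \<kappa> x)\<close>) followed by the Laplace transform in \<open>t\<close> is
  \<open>s powr (\<beta> - 1) / (s powr \<beta> + \<psi>(\<kappa>))\<close>.
\<close>

definition reduced_green :: "real \<Rightarrow> real \<Rightarrow> real \<Rightarrow> real measure \<Rightarrow> bool" where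
  "reduced_green \<alpha> \<beta> \<theta> K \<longleftrightarrow>
     finite_borel_measure K \<and>
     (\<forall>\<kappa> s. s > 0 \<longrightarrow>
        has_bochner_integral lborel
          (\<lambda>t. indicator {0<..} t *\<^sub>R (of_real (exp (- s * t)) * char (dilate (t powr (\<beta> / \<alpha>)) K) \<kappa>))
          (of_real (s powr (\<beta> - 1)) / (of_real (s powr \<beta>) + feller_symbol \<alpha> \<theta> \<kappa>)))"

definition stable_law :: "real \<Rightarrow> real \<Rightarrow> real measure \<Rightarrow> bool" where
  "stable_law \<alpha> \<theta> L \<longleftrightarrow>
     real_distribution L \<and> (\<forall>\<kappa>. char L \<kappa> = exp (- feller_symbol \<alpha> \<theta> \<kappa>))"

text \<open>The library's \<open>rGamma\<close> is the entire function \<open>1 / Gamma\<close>, zero at the poles.\<close>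

definition M_Wright :: "real \<Rightarrow> real \<Rightarrow> real" where
  "M_Wright \<nu> z = (\<Sum>n. (- z) ^ n / fact n * rGamma (- \<nu> * real n + (1 - \<nu>)))"

definition M_Wright_time :: "real \<Rightarrow> real \<Rightarrow> real \<Rightarrow> real" where
  "M_Wright_time \<nu> r t = t powr (- \<nu>) * M_Wright \<nu> (r / t powr \<nu>)"

text \<open>
  \<open>has_M_integral \<nu> t f I\<close>: the integral of \<open>f \<tau>\<close> against \<open>M\<^sub>\<nu>(\<tau>; t) d\<tau>\<close> over \<open>\<tau> > 0\<close>
  exists and equals \<open>I\<close>.  For \<open>\<nu> = 1\<close> the kernel \<open>t\<^sup>-\<^sup>1 \<delta>(\<tau> / t - 1)\<close> is the unit mass at \<open>\<tau> = t\<close>.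
\<close>

definition has_M_integral :: "real \<Rightarrow> real \<Rightarrow> (real \<Rightarrow> real) \<Rightarrow> real \<Rightarrow> bool" where
  "has_M_integral \<nu> t f I \<longleftrightarrow>
     (if \<nu> = 1 then f t = I
      else has_bochner_integral lborel (\<lambda>\<tau>. indicator {0<..} \<tau> *\<^sub>R (f \<tau> * M_Wright_time \<nu> \<tau> t)) I)"

text \<open>
  On \<open>(0, \<infinity>)\<close> the law \<open>M\<close> is a function, namely \<open>f\<close>.  Continuity singles out the
  version of the density for which a pointwise identity makes sense.
\<close>

definition pos_density :: "real measure \<Rightarrow> (real \<Rightarrow> real) \<Rightarrow> bool" where
  "pos_density M f \<longleftrightarrow>
     continuous_on {0<..} f \<and>
     (\<forall>A \<in> sets borel. A \<subseteq> {0<..} \<longrightarrow>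
        has_bochner_integral lborel (\<lambda>x. indicator A x *\<^sub>R f x) (measure M A))"

end

theory Submission
  imports Defs "HOL-Complex_Analysis.Complex_Analysis" "HOL-Real_Asymp.Real_Asymp"
begin

text \<open>
  Everything rests on the Laplace transform of \<open>M\<^sub>\<nu>(\<tau>; t)\<close> in \<open>t\<close>, which is
  \<open>s powr (\<nu> - 1) * exp (- \<tau> s powr \<nu>)\<close>.  If the characteristic function of the law
  scaled by \<open>\<tau>\<close> has the Laplace transform \<open>V r\<close> in \<open>\<tau>\<close>, then by Fubini its mixture against
  \<open>M\<^sub>\<nu>(\<tau>; t)\<close> has the transform \<open>s powr (\<nu> - 1) * V (s powr \<nu>)\<close> in \<open>t\<close>.  For
  \<open>V r = 1 / (r + \<psi>)\<close> and \<open>\<nu> = \<beta>\<close>, as for \<open>V r = r powr (\<alpha> - 1) / (r powr \<alpha> + \<psi>)\<close> and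
  \<open>\<nu> = \<beta> / \<alpha>\<close>, this is the transform that defines the Green function, and uniqueness of
  Laplace and Fourier transforms gives the identity of measures.

  The transform itself comes from the integral
  \<open>M\<^sub>\<nu>(z) = Im (\<integral>\<^sub>0\<^sup>\<infinity> w exp (- z x w - x powr (1 / \<nu>) cnj w) dx) / (\<pi> \<nu>)\<close>, where
  \<open>w = cis \<eta>\<close> and \<open>\<eta> = \<pi> \<nu> / (1 + \<nu>)\<close> is the angle for which both exponentials decay at the
  same rate.
\<close>

section \<open>Integration over the positive half-line\<close>

text \<open>The integral for \<open>M_Wright\<close> is the Hankel integral of \<open>exp (\<sigma>
  - z \<sigma> powr \<nu>) \<sigma> powr (\<nu> - 1) / (2 \<pi> \<i>)\<close> in the variable
  \<open>u = \<sigma> powr \<nu>\<close>, its two conjugate rays folded into one imaginary part. The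
  power series leads to the ray of argument \<open>\<pi> \<nu>\<close>, but there
  \<open>exp (- z u)\<close> grows as soon as \<nu> > 1/2, and the exchange with the Laplace
  integral in \<open>t\<close> would not be absolute. This is why the ray is turned to the angle
  \<eta>. Two more obstacles shape the rest. The kernel enters as a signed weight, whereas
  uniqueness of characteristic functions concerns positive measures; \<open>mixture\<close>
  reconciles the two. And an identity of measures gives densities only almost everywhere, while the
  claim is pointwise: the mixed density has to exist and be continuous at every
  \<open>x > 0\<close>, although the given density may be unbounded near 0. A substitution that
  moves \<open>x\<close> into the kernel achieves this. For \<nu> = 1 the kernel is a point mass,
  and the claim becomes the equality of two laws.\<close>

definition lpos :: "real measure" where
  "lpos = density lborel (indicator {0<..})"

lemma sets_lpos [simp, measurable_cong]: "sets lpos = sets borel"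
  by (simp add: lpos_def)

lemma space_lpos [simp]: "space lpos = UNIV"
  by (simp add: lpos_def)

lemma sigma_finite_lpos: "sigma_finite_measure lpos"
  unfolding lpos_def by (subst sigma_finite_measure.sigma_finite_iff_density_finite[OF lborel.sigma_finite_measure_axioms])
    (auto simp: indicator_def)

interpretation lpos: sigma_finite_measure lpos by (rule sigma_finite_lpos)

interpretation lpos_pair: pair_sigma_finite lpos lpos ..

lemma AE_lpos: "(AE x in lpos. P x) \<longleftrightarrow> (AE x in lborel. 0 < x \<longrightarrow> P x)"
  unfolding lpos_def by (subst AE_density) (auto simp: indicator_def)

lemma AE_lpos_pos: "AE x in lpos. 0 < x"
  by (simp add: AE_lpos)

lemma AE_lposI: "(\<And>x. 0 < x \<Longrightarrow> P x) \<Longrightarrow> AE x in lpos. P x"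
  by (simp add: AE_lpos)

lemma has_bochner_integral_lpos_iff:
  fixes f :: "real \<Rightarrow> 'a::{banach, second_countable_topology}"
  assumes "f \<in> borel_measurable borel"
  shows "has_bochner_integral lpos f I \<longleftrightarrow>
    has_bochner_integral lborel (\<lambda>x. indicator {0<..} x *\<^sub>R f x) I"
proof -
  have eq: "lpos = density lborel (\<lambda>x. ennreal (indicator {0<..} x))"
    unfolding lpos_def by (rule arg_cong[where f="density lborel"]) (auto split: split_indicator)
  show ?thesis
    unfolding has_bochner_integral_iff eq using assms
    by (simp add: integrable_density integral_density)
qed

text \<open>Bridge to the gauge integral, in which the change of variables, the Gamma integral and
  contour integrals are formulated.\<close>

lemma has_bochner_integral_lpos_iff_HK:
  fixes f :: "real \<Rightarrow> 'a::euclidean_space"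
  assumes "f \<in> borel_measurable borel"
  shows "has_bochner_integral lpos f I \<longleftrightarrow>
    f absolutely_integrable_on {0<..} \<and> integral {0<..} f = I"
proof -
  have m: "(\<lambda>x. indicator {0<..} x *\<^sub>R f x) \<in> borel_measurable lborel"
    using assms by measurable
  have "has_bochner_integral lpos f I \<longleftrightarrow>
      set_integrable lebesgue {0<..} f \<and> (LINT x:{0<..}|lebesgue. f x) = I"
    unfolding has_bochner_integral_lpos_iff[OF assms]
    unfolding has_bochner_integral_iff set_integrable_def
      set_lebesgue_integral_def integrable_completion[OF m] integral_completion[OF m] ..
  then show ?thesis
    by (auto simp: set_lebesgue_integral_eq_integral(2))
qed

text \<open>Negative exponents are included for the sake of the substitution
  \<open>\<tau> = (x / y) powr (1 / p)\<close> in the mixture of densities, which inverts the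
  variable.\<close>

lemma has_bochner_integral_lpos_powr_subst:
  fixes f :: "real \<Rightarrow> 'a::euclidean_space"
  assumes [measurable]: "f \<in> borel_measurable borel" and c: "0 < c" and e: "e \<noteq> 0"
  shows "has_bochner_integral lpos (\<lambda>x. (c * \<bar>e\<bar> * x powr (e - 1)) *\<^sub>R f (c * x powr e)) I \<longleftrightarrow>
    has_bochner_integral lpos f I"
proof -
  define g where "g = (\<lambda>x::real. c * x powr e)"
  have inv: "g ((y / c) powr (1 / e)) = y" if "0 < y" for y
  proof -
    have "((y / c) powr (1 / e)) powr e = y / c"
      using that c e by (subst powr_powr) simp
    then show ?thesis
      using c by (simp add: g_def)
  qed
  have img: "g ` {0<..} = {0<..}"
  proof (intro equalityI subsetI)
    fix y :: real assume "y \<in> {0<..}"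
    then have "y = g ((y / c) powr (1 / e))" "(y / c) powr (1 / e) \<in> {0<..}"
      using inv c by auto
    then show "y \<in> g ` {0<..}" by (rule image_eqI)
  qed (use c in \<open>auto simp: g_def\<close>)
  have inj: "inj_on g {0<..}"
  proof (rule inj_onI)
    fix x y assume "x \<in> {0<..}" "y \<in> {0<..}" "g x = g y"
    then have "(x powr e) powr (1 / e) = (y powr e) powr (1 / e)" "0 < x" "0 < y"
      using c by (auto simp: g_def)
    then show "x = y"
      unfolding powr_powr using e by simp
  qed
  have der: "(g has_field_derivative (c * e * x powr (e - 1))) (at x within {0<..})"
    if "x \<in> {0<..}" for x
    using that unfolding g_def by (auto intro!: derivative_eq_intros)
  have "(\<lambda>x. \<bar>c * e * x powr (e - 1)\<bar> *\<^sub>R f (g x)) absolutely_integrable_on {0<..} \<and>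
       integral {0<..} (\<lambda>x. \<bar>c * e * x powr (e - 1)\<bar> *\<^sub>R f (g x)) = I \<longleftrightarrow>
      f absolutely_integrable_on g ` {0<..} \<and> integral (g ` {0<..}) f = I"
    by (rule has_absolute_integral_change_of_variables_real) (use der inj in auto)
  then show ?thesis
    using c unfolding img by (simp add: has_bochner_integral_lpos_iff_HK abs_mult g_def)
qed

lemma has_bochner_integral_lpos_scale:
  fixes f :: "real \<Rightarrow> 'a::euclidean_space"
  assumes [measurable]: "f \<in> borel_measurable borel" and c: "0 < c"
  shows "has_bochner_integral lpos (\<lambda>x. c *\<^sub>R f (c * x)) I \<longleftrightarrow> has_bochner_integral lpos f I"
proof -
  have "has_bochner_integral lpos (\<lambda>x. c *\<^sub>R f (c * x)) I \<longleftrightarrow>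
    has_bochner_integral lpos (\<lambda>x. (c * \<bar>1\<bar> * x powr (1 - 1)) *\<^sub>R f (c * x powr 1)) I"
    by (rule has_bochner_integral_cong_AE) (auto simp: AE_lpos)
  then show ?thesis
    using has_bochner_integral_lpos_powr_subst[OF assms, of 1 I] by simp
qed

lemma integral_lpos_scale:
  fixes f :: "real \<Rightarrow> 'a::euclidean_space"
  assumes [measurable]: "f \<in> borel_measurable borel" and c: "0 < c"
  shows "(\<integral>x. c *\<^sub>R f (c * x) \<partial>lpos) = (\<integral>x. f x \<partial>lpos)"
    and "integrable lpos (\<lambda>x. f (c * x)) \<longleftrightarrow> integrable lpos f"
proof -
  have *: "integrable lpos (\<lambda>x. f (c * x)) \<longleftrightarrow> integrable lpos (\<lambda>x. c *\<^sub>R f (c * x))"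
    using c integrable_scaleR_right[of c lpos "\<lambda>x. f (c * x)"]
      integrable_scaleR_right[of "1 / c" lpos "\<lambda>x. c *\<^sub>R f (c * x)"] by auto
  show 2: "integrable lpos (\<lambda>x. f (c * x)) \<longleftrightarrow> integrable lpos f"
    unfolding * using has_bochner_integral_lpos_scale[OF assms]
    by (meson integrable.simps)
  show "(\<integral>x. c *\<^sub>R f (c * x) \<partial>lpos) = (\<integral>x. f x \<partial>lpos)"
    using 2 has_bochner_integral_lpos_scale[OF assms]
    by (metis * has_bochner_integral_iff not_integrable_integral_eq)
qed

lemma integrable_lpos_bound:
  fixes f :: "real \<Rightarrow> 'a::{banach, second_countable_topology}" and g :: "real \<Rightarrow> real"
  assumes "integrable lpos g" "f \<in> borel_measurable borel" "\<And>x. 0 < x \<Longrightarrow> norm (f x) \<le> g x"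
  shows "integrable lpos f"
  by (rule Bochner_Integration.integrable_bound[OF assms(1)])
     (use assms in \<open>force intro: AE_lposI\<close>)+

lemma integral_norm_bound_lpos:
  fixes f :: "real \<Rightarrow> 'a::{banach, second_countable_topology}" and g :: "real \<Rightarrow> real"
  assumes "integrable lpos g" "f \<in> borel_measurable borel" "\<And>x. 0 < x \<Longrightarrow> norm (f x) \<le> g x"
  shows "norm (\<integral>x. f x \<partial>lpos) \<le> (\<integral>x. g x \<partial>lpos)"
proof -
  have "norm (\<integral>x. f x \<partial>lpos) \<le> (\<integral>x. norm (f x) \<partial>lpos)"
    by (rule integral_norm_bound)
  also have "\<dots> \<le> (\<integral>x. g x \<partial>lpos)"
    using integrable_lpos_bound[OF assms] assms
    by (intro integral_mono_AE) (auto intro: AE_lposI)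
  finally show ?thesis .
qed

section \<open>Gamma integrals and integrable majorants\<close>

lemma has_bochner_integral_Gamma:
  assumes "0 < z"
  shows "has_bochner_integral lpos (\<lambda>t. t powr (z - 1) * exp (- t)) (Gamma z)"
proof -
  have "((\<lambda>t. t powr (z - 1) / exp t) has_integral Gamma z) {0..}"
    by (rule Gamma_integral_real[OF assms])
  then have h: "((\<lambda>t. t powr (z - 1) * exp (- t)) has_integral Gamma z) {0<..}"
    by (subst (asm) has_integral_spike_set_eq[where T="{0<..}"])
       (auto simp: exp_minus field_simps intro: negligible_subset[of "{0}"])
  then have "(\<lambda>t. t powr (z - 1) * exp (- t)) absolutely_integrable_on {0<..}"
    by (intro nonnegative_absolutely_integrable_1) (auto simp: integrable_on_def)
  with h show ?thesis
    by (subst has_bochner_integral_lpos_iff_HK) auto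
qed

lemma has_bochner_integral_exp_powr:
  assumes "0 < \<nu>" "0 < b" "0 < q"
  shows "has_bochner_integral lpos (\<lambda>x. x powr (b - 1) * exp (- (q * x powr (1 / \<nu>))))
    (\<nu> * Gamma (\<nu> * b) * q powr (- (\<nu> * b)))"
proof -
  \<comment> \<open>With this scale \<open>q * (c * x powr \<nu>) powr (1 / \<nu>) = x\<close>, so
    that the exponent becomes that of the Gamma integral.\<close>
  define c where "c = q powr (- \<nu>)"
  have c: "0 < c" using assms by (simp add: c_def)
  define f where "f = (\<lambda>x. x powr (b - 1) * exp (- (q * x powr (1 / \<nu>))))"
  have [measurable]: "f \<in> borel_measurable borel" by (simp add: f_def)
  have pw: "(c * x powr \<nu>) powr (1 / \<nu>) = x / q" if "0 < x" for x
  proof -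
    have "c powr (1 / \<nu>) = 1 / q"
      using assms unfolding c_def powr_powr by (simp add: powr_neg_one)
    then show ?thesis
      using that assms c by (simp add: powr_mult powr_powr)
  qed
  have "(c * \<bar>\<nu>\<bar> * x powr (\<nu> - 1)) *\<^sub>R f (c * x powr \<nu>) =
      (\<nu> * q powr (- (\<nu> * b))) * (x powr (\<nu> * b - 1) * exp (- x))" if x: "0 < x" for x
  proof -
    have "c powr 1 * c powr (b - 1) = q powr (- (\<nu> * b))"
      unfolding powr_add[symmetric] by (simp add: c_def powr_powr)
    then have "c * c powr (b - 1) = q powr (- (\<nu> * b))"
      using c by simp
    moreover have "x powr (\<nu> - 1) * (x powr \<nu>) powr (b - 1) = x powr (\<nu> * b - 1)"
      unfolding powr_powr powr_add[symmetric] by (simp add: algebra_simps)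
    moreover have "f (c * x powr \<nu>) = c powr (b - 1) * (x powr \<nu>) powr (b - 1) * exp (- x)"
      unfolding f_def pw[OF x] using assms c by (simp add: powr_mult)
    ultimately show ?thesis
      using assms by (simp add: mult_ac)
  qed
  then have "has_bochner_integral lpos (\<lambda>x. (c * \<bar>\<nu>\<bar> * x powr (\<nu> - 1)) *\<^sub>R f (c * x powr \<nu>)) I \<longleftrightarrow>
     has_bochner_integral lpos (\<lambda>x. (\<nu> * q powr (- (\<nu> * b))) * (x powr (\<nu> * b - 1) * exp (- x))) I" for I
    by (intro has_bochner_integral_cong_AE) (auto intro!: AE_lposI)
  moreover have "has_bochner_integral lpos
     (\<lambda>x. (\<nu> * q powr (- (\<nu> * b))) * (x powr (\<nu> * b - 1) * exp (- x)))
     ((\<nu> * q powr (- (\<nu> * b))) * Gamma (\<nu> * b))"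
    using assms by (intro has_bochner_integral_mult_right has_bochner_integral_Gamma) auto
  ultimately have "has_bochner_integral lpos f ((\<nu> * q powr (- (\<nu> * b))) * Gamma (\<nu> * b))"
    using has_bochner_integral_lpos_powr_subst[of f c \<nu>] c assms by simp
  then show ?thesis
    by (simp add: f_def mult_ac)
qed

lemma has_bochner_integral_exp:
  assumes "0 < (q::real)"
  shows "has_bochner_integral lpos (\<lambda>x. exp (- (q * x))) (1 / q)"
    and "has_bochner_integral lpos (\<lambda>x. x * exp (- (q * x))) (1 / q\<^sup>2)"
proof -
  have "has_bochner_integral lpos (\<lambda>x. x powr (1 - 1) * exp (- (q * x powr (1 / 1)))) (1 / q)"
    using has_bochner_integral_exp_powr[of 1 1 q] assms by (simp add: powr_minus_divide)
  then show "has_bochner_integral lpos (\<lambda>x. exp (- (q * x))) (1 / q)"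
    by (subst has_bochner_integral_cong_AE[rotated 2]) (auto intro!: AE_lposI)
  have "has_bochner_integral lpos (\<lambda>x. x powr (2 - 1) * exp (- (q * x powr (1 / 1)))) (1 / q\<^sup>2)"
    using has_bochner_integral_exp_powr[of 1 2 q] assms Gamma_fact[of 1, where 'a=real]
    by (simp add: powr_minus_divide powr_numeral)
  then show "has_bochner_integral lpos (\<lambda>x. x * exp (- (q * x))) (1 / q\<^sup>2)"
    by (subst has_bochner_integral_cong_AE[rotated 2]) (auto intro!: AE_lposI)
qed

lemma integrable_lpos_1_plus_square:
  assumes "c \<noteq> 0"
  shows "integrable lpos (\<lambda>x. C / (1 + (c * x)\<^sup>2))"
proof -
  have "set_integrable lborel (einterval (-\<infinity>) \<infinity>) (\<lambda>x::real. inverse (1 + x\<^sup>2))"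
    by (rule integrable_inverse_1_plus_square)
  then have "integrable lborel (\<lambda>x::real. inverse (1 + x\<^sup>2))"
    by (simp add: set_integrable_def)
  then have "integrable lborel (\<lambda>x::real. indicator {0<..} x *\<^sub>R inverse (1 + x\<^sup>2))"
    by (rule integrable_mult_indicator[rotated]) auto
  then have "integrable lpos (\<lambda>x::real. inverse (1 + x\<^sup>2))"
    using has_bochner_integral_lpos_iff[of "\<lambda>x::real. inverse (1 + x\<^sup>2)"]
    by (auto simp: has_bochner_integral_iff)
  then have "integrable lpos (\<lambda>x::real. inverse (1 + (\<bar>c\<bar> * x)\<^sup>2))"
    using assms by (subst integral_lpos_scale(2)) auto
  then have "integrable lpos (\<lambda>x::real. C * inverse (1 + (\<bar>c\<bar> * x)\<^sup>2))"
    by (rule integrable_mult_right)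
  then show ?thesis
    by (simp add: field_simps power_mult_distrib)
qed

section \<open>Contour integrals along rays\<close>

lemma contour_integral_segment_lpos:
  fixes f :: "complex \<Rightarrow> complex"
  assumes r: "0 < r" and g: "integrable lpos g" "\<And>x. 0 < x \<Longrightarrow> g x = f (of_real x * u)"
  shows "contour_integral (linepath 0 (of_real r * u)) f = u * (\<integral>x. indicator {..r} x *\<^sub>R g x \<partial>lpos)"
proof -
  have [measurable]: "g \<in> borel_measurable borel"
    using g(1) by (auto dest: borel_measurable_integrable)
  define h where "h = (\<lambda>x. indicator {..r} x *\<^sub>R g x)"
  define I where "I = (\<integral>x. h x \<partial>lpos)"
  have [measurable]: "h \<in> borel_measurable borel" by (simp add: h_def)
  have "has_bochner_integral lpos h I"
    using g(1) by (auto simp: has_bochner_integral_iff I_def h_def intro!: integrable_mult_indicator)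
  then have "has_bochner_integral lpos (\<lambda>x. r *\<^sub>R h (r * x)) I"
    using r by (subst has_bochner_integral_lpos_scale) auto
  then have "((\<lambda>x. r *\<^sub>R h (r * x)) has_integral I) {0<..}"
    by (subst (asm) has_bochner_integral_lpos_iff_HK)
       (auto simp: has_integral_iff set_lebesgue_integral_eq_integral(1))
  then have "((\<lambda>x. if x \<in> {0<..1} then r *\<^sub>R h (r * x) else 0) has_integral I) {0<..}"
    by (rule has_integral_eq[rotated]) (use r in \<open>auto simp: h_def mult_le_cancel_left1\<close>)
  then have "((\<lambda>x. r *\<^sub>R h (r * x)) has_integral I) {0<..1}"
    by (subst (asm) has_integral_restrict) auto
  then have "((\<lambda>x. u * (r *\<^sub>R h (r * x))) has_integral (u * I)) {0<..1}"
    by (rule has_integral_mult_right)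
  then have "((\<lambda>x. f (linepath 0 (of_real r * u) x) * (of_real r * u - 0)) has_integral (u * I)) {0<..1}"
    by (rule has_integral_eq[rotated])
       (use r in \<open>auto simp: h_def g(2) linepath_def scaleR_conv_of_real mult_ac mult_le_cancel_left1\<close>)
  then have "((\<lambda>x. f (linepath 0 (of_real r * u) x) * (of_real r * u - 0)) has_integral (u * I)) {0..1}"
    by (subst has_integral_spike_set_eq[where T="{0<..1}"])
       (auto intro: negligible_subset[of "{0}"])
  then have "(f has_contour_integral (u * I)) (linepath 0 (of_real r * u))"
    by (subst has_contour_integral_linepath)
  then show ?thesis
    by (simp add: contour_integral_unique I_def h_def)
qed

text \<open>
  Rotation of the line of integration from the positive half-line to the ray with argument
  \<open>\<phi>\<close>, by Cauchy's theorem for the triangle with vertices \<open>0\<close>, \<open>R\<close>, \<open>R (1 + \<i> tan \<phi>)\<close>.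
\<close>

lemma integral_rotate_ray:
  fixes f :: "complex \<Rightarrow> complex" and S :: "complex set"
  assumes \<phi>: "\<bar>\<phi>\<bar> < pi / 2"
  defines "S \<equiv> {z. 0 \<le> Re z \<and> \<bar>Im z\<bar> \<le> \<bar>tan \<phi>\<bar> * Re z}"
  assumes cont: "continuous_on S f"
    and F: "finite F" "\<And>z. z \<in> S \<Longrightarrow> 0 < Re z \<Longrightarrow> z \<notin> F \<Longrightarrow> f field_differentiable at z"
    and bound: "\<And>z. z \<in> S \<Longrightarrow> norm (f z) \<le> C / (1 + (Re z)\<^sup>2)"
    and m [measurable]: "g \<in> borel_measurable borel" "h \<in> borel_measurable borel"
    and g: "\<And>x. 0 < x \<Longrightarrow> g x = f (of_real x)"
    and h: "\<And>x. 0 < x \<Longrightarrow> h x = f (of_real x * cis \<phi>)"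
  shows "integrable lpos g" "integrable lpos h" "(\<integral>x. g x \<partial>lpos) = cis \<phi> * (\<integral>x. h x \<partial>lpos)"
proof -
  define c where "c = cos \<phi>"
  have c: "0 < c" using \<phi> by (auto simp: c_def intro!: cos_gt_zero_pi)
  have ray: "of_real x * cis \<phi> \<in> S" "of_real x \<in> S" if "0 \<le> x" for x
    using that c by (auto simp: S_def tan_def c_def[symmetric] abs_mult field_simps)
  show ig: "integrable lpos g"
  proof (rule integrable_lpos_bound)
    show "integrable lpos (\<lambda>x. C / (1 + (1 * x)\<^sup>2))" by (rule integrable_lpos_1_plus_square) simp
  qed (use bound[OF ray(2)] in \<open>auto simp: g\<close>)
  show ih: "integrable lpos h"
  proof (rule integrable_lpos_bound)
    show "integrable lpos (\<lambda>x. C / (1 + (c * x)\<^sup>2))" by (rule integrable_lpos_1_plus_square) (use c in simp)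
  qed (use bound[OF ray(1)] in \<open>auto simp: h c_def mult.commute\<close>)
  have "convex S"
  proof (rule convexI)
    fix x y :: complex and p q :: real
    assume xy: "x \<in> S" "y \<in> S" and pq: "0 \<le> p" "0 \<le> q" "p + q = 1"
    have "\<bar>p * Im x + q * Im y\<bar> \<le> p * \<bar>Im x\<bar> + q * \<bar>Im y\<bar>"
      using pq by (intro order.trans[OF abs_triangle_ineq]) (simp add: abs_mult)
    also have "\<dots> \<le> p * (\<bar>tan \<phi>\<bar> * Re x) + q * (\<bar>tan \<phi>\<bar> * Re y)"
      using xy pq by (intro add_mono mult_left_mono) (auto simp: S_def)
    finally show "p *\<^sub>R x + q *\<^sub>R y \<in> S"
      using xy pq by (auto simp: S_def algebra_simps)
  qed
  define G where "G = (\<lambda>r. \<integral>x. indicator {..r} x *\<^sub>R g x \<partial>lpos)"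
  define H where "H = (\<lambda>r. \<integral>x. indicator {..r} x *\<^sub>R h x \<partial>lpos)"
  \<comment> \<open>The two rays are cut at the same real part \<open>R\<close>, that is at lengths
    \<open>R\<close> and \<open>R / c\<close>. The third side is then vertical, of length
    \<open>R * \<bar>tan \<phi>\<bar>\<close>, and \<open>f\<close> is at most
    \<open>C / (1 + R\<^sup>2)\<close> on it; the error is of order 1 / R.\<close>
  have key: "norm (G R - cis \<phi> * H (R / c)) \<le> C / (1 + R\<^sup>2) * (R * \<bar>tan \<phi>\<bar>)" if R: "0 < R" for R
  proof -
    define b d where "b = complex_of_real R * 1" and "d = complex_of_real (R / c) * cis \<phi>"
    have bd: "b \<in> S" "d \<in> S" "0 \<in> S"
      using ray[of R] ray[of "R / c"] ray[of 0] R c by (auto simp: b_def d_def)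
    have hull: "convex hull {0, b, d} \<subseteq> S"
      using bd \<open>convex S\<close> by (intro hull_minimal) auto
    have seg: "closed_segment x y \<subseteq> S" if "x \<in> S" "y \<in> S" for x y
      using that \<open>convex S\<close> by (simp add: convex_contains_segment)
    have "(f has_contour_integral 0) (linepath 0 b +++ linepath b d +++ linepath d 0)"
    proof (rule Cauchy_theorem_triangle_cofinite)
      show "continuous_on (convex hull {0, b, d}) f"
        using cont hull by (rule continuous_on_subset)
      \<comment> \<open>The origin joins the exceptional set because differentiability is assumed
        for positive real part, and 0 is the only point of \<open>S\<close> outside that
        half-plane.\<close>
      show "finite (insert 0 F)" using F by simp
      fix x assume x: "x \<in> interior (convex hull {0, b, d}) - insert 0 F"
      then have "x \<in> S" using hull interior_subset by blast
      moreover have "0 < Re x"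
      proof (rule ccontr)
        assume "\<not> 0 < Re x"
        then have "Re x = 0" "Im x = 0" using \<open>x \<in> S\<close> by (auto simp: S_def)
        then show False using x by (simp add: complex_eq_iff)
      qed
      ultimately show "f field_differentiable at x" using F x by auto
    qed
    then have "contour_integral (linepath 0 b) f + contour_integral (linepath b d) f
        + contour_integral (linepath d 0) f = 0"
      by (rule has_chain_integral_chain_integral3)
    moreover have "contour_integral (linepath d 0) f = - contour_integral (linepath 0 d) f"
      by (rule contour_integral_reverse_linepath)
         (use cont seg bd in \<open>auto intro: continuous_on_subset\<close>)
    moreover have "contour_integral (linepath 0 b) f = G R"
      unfolding b_def G_def by (subst contour_integral_segment_lpos[OF R ig]) (use g in auto)
    moreover have "contour_integral (linepath 0 d) f = cis \<phi> * H (R / c)"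
      unfolding d_def H_def by (rule contour_integral_segment_lpos) (use ih h R c in auto)
    ultimately have "G R - cis \<phi> * H (R / c) = - contour_integral (linepath b d) f"
      by (simp add: algebra_simps add_eq_0_iff2)
    also have "norm \<dots> = norm (contour_integral (linepath b d) f)" by simp
    also have "\<dots> \<le> C / (1 + R\<^sup>2) * norm (d - b)"
    proof (rule contour_integral_bound_linepath)
      show "f contour_integrable_on linepath b d"
        using cont seg bd by (intro contour_integrable_continuous_linepath) (auto intro: continuous_on_subset)
      show *: "norm (f x) \<le> C / (1 + R\<^sup>2)" if "x \<in> closed_segment b d" for x
      proof -
        have "Re b = R" "Re d = R"
          using c by (simp_all add: b_def d_def c_def)
        moreover obtain u where "x = (1 - u) *\<^sub>R b + u *\<^sub>R d"
          using \<open>x \<in> closed_segment b d\<close> by (auto simp: closed_segment_def)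
        then have "Re x = (1 - u) * Re b + u * Re d"
          by simp
        ultimately have "Re x = R"
          by (simp add: algebra_simps)
        then show ?thesis using bound[of x] seg[of b d] bd that by auto
      qed
      show "0 \<le> C / (1 + R\<^sup>2)"
        using order.trans[OF norm_ge_zero *[of b]] by simp
    qed
    also have "norm (d - b) = R * \<bar>tan \<phi>\<bar>"
    proof -
      have "d - b = \<i> * of_real (R * tan \<phi>)"
        using c by (simp add: complex_eq_iff d_def b_def c_def tan_def)
      then show ?thesis using R by (simp add: norm_mult abs_mult)
    qed
    finally show ?thesis .
  qed
  have lim: "(\<lambda>n. \<integral>x. indicator {..k * real (Suc n)} x *\<^sub>R e x \<partial>lpos) \<longlonglongrightarrow> (\<integral>x. e x \<partial>lpos)"
    if e: "integrable lpos e" and k: "0 < k" for k and e :: "real \<Rightarrow> complex"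
  proof (rule integral_dominated_convergence)
    show "integrable lpos (\<lambda>x. norm (e x))" using e by simp
    have [measurable]: "e \<in> borel_measurable borel"
      using e by (auto dest: borel_measurable_integrable)
    show "e \<in> borel_measurable lpos" "\<And>n. (\<lambda>x. indicator {..k * real (Suc n)} x *\<^sub>R e x) \<in> borel_measurable lpos"
      by auto
    show "AE x in lpos. (\<lambda>n. indicator {..k * real (Suc n)} x *\<^sub>R e x) \<longlonglongrightarrow> e x"
    proof (intro AE_I2 tendsto_eventually)
      fix x
      have "filterlim (\<lambda>n. k * real (Suc n)) at_top sequentially"
        using k by real_asymp
      then have "eventually (\<lambda>n. x \<le> k * real (Suc n)) sequentially"
        by (simp add: filterlim_at_top)
      then show "\<forall>\<^sub>F n in sequentially. indicator {..k * real (Suc n)} x *\<^sub>R e x = e x"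
        by eventually_elim simp
    qed
  qed (auto split: split_indicator)
  have "(\<lambda>n. G (real (Suc n)) - cis \<phi> * H (real (Suc n) / c)) \<longlonglongrightarrow> (\<integral>x. g x \<partial>lpos) - cis \<phi> * (\<integral>x. h x \<partial>lpos)"
    using lim[OF ig, of 1] lim[OF ih, of "1 / c"] c unfolding G_def H_def
    by (intro tendsto_diff tendsto_mult tendsto_const) (simp_all add: mult_ac)
  moreover have "(\<lambda>n. G (real (Suc n)) - cis \<phi> * H (real (Suc n) / c)) \<longlonglongrightarrow> 0"
  proof (rule Lim_null_comparison)
    show "\<forall>\<^sub>F n in sequentially. norm (G (real (Suc n)) - cis \<phi> * H (real (Suc n) / c))
       \<le> C / (1 + (real (Suc n))\<^sup>2) * (real (Suc n) * \<bar>tan \<phi>\<bar>)"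
      by (intro always_eventually allI key) simp
    show "(\<lambda>n. C / (1 + (real (Suc n))\<^sup>2) * (real (Suc n) * \<bar>tan \<phi>\<bar>)) \<longlonglongrightarrow> 0"
      by real_asymp
  qed
  ultimately have "(\<integral>x. g x \<partial>lpos) - cis \<phi> * (\<integral>x. h x \<partial>lpos) = 0"
    by (rule LIMSEQ_unique)
  then show "(\<integral>x. g x \<partial>lpos) = cis \<phi> * (\<integral>x. h x \<partial>lpos)" by simp
qed

section \<open>Integral representation of the Wright function\<close>

lemma powr_of_real_cis:
  assumes "0 < r" "- pi < t" "t \<le> pi"
  shows "(of_real r * cis t) powr (of_real a) = of_real (r powr a) * cis (a * t)"
proof -
  have "Ln (of_real r * cis t) = of_real (ln r) + \<i> * of_real t"
    using assms by (subst Ln_times_of_real) (auto simp: Ln_cis Ln_of_real)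
  then show ?thesis
    using assms by (simp add: powr_def cis_conv_exp exp_of_real exp_add[symmetric] flip: exp_of_real)
      (simp add: algebra_simps)
qed

lemma sector_polar:
  assumes "\<bar>\<phi>\<bar> < pi / 2" "0 < Re z" "\<bar>Im z\<bar> \<le> \<bar>tan \<phi>\<bar> * Re z"
  obtains r t where "Re z \<le> r" "\<bar>t\<bar> \<le> \<bar>\<phi>\<bar>" "z = of_real r * cis t" "r = norm z"
proof
  have "\<bar>tan \<phi>\<bar> = tan \<bar>\<phi>\<bar>"
    using assms tan_gt_zero[of "\<bar>\<phi>\<bar>"] by (cases "\<phi> = 0") (auto simp: abs_if)
  then have "\<bar>Im z / Re z\<bar> \<le> tan \<bar>\<phi>\<bar>"
    using assms by (simp add: abs_divide divide_le_eq)
  then have "\<bar>arctan (Im z / Re z)\<bar> \<le> arctan (tan \<bar>\<phi>\<bar>)"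
    unfolding abs_le_iff arctan_minus[symmetric] arctan_le_iff .
  also have "\<dots> = \<bar>\<phi>\<bar>"
    using assms by (intro arctan_tan) auto
  finally show "\<bar>Arg z\<bar> \<le> \<bar>\<phi>\<bar>"
    using arg_conv_arctan[OF assms(2)] by (simp only:)
  show "z = of_real (norm z) * cis (Arg z)"
    using rcis_cmod_Arg[of z] by (simp only: rcis_def)
qed (rule complex_Re_le_cmod, rule refl)

lemma linear_minus_powr_bounded:
  assumes "1 < a" "0 < c"
  obtains B :: real where "\<And>x. 0 \<le> x \<Longrightarrow> k * x - c * x powr a \<le> B"
proof
  fix x :: real assume x: "0 \<le> x"
  \<comment> \<open>The point where \<open>c * X powr (a - 1) = \<bar>k\<bar>\<close>: beyond it the
    power outweighs the linear term, before it the linear term is at most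
    \<open>\<bar>k\<bar> * X\<close>.\<close>
  define X where "X = (\<bar>k\<bar> / c) powr (1 / (a - 1))"
  show "k * x - c * x powr a \<le> \<bar>k\<bar> * X"
  proof (cases "x \<le> X")
    case True
    have "k * x \<le> \<bar>k\<bar> * X"
      by (rule order.trans[OF _ mult_left_mono[OF True]]) (use x in \<open>auto intro: mult_right_mono\<close>)
    then show ?thesis using assms by (smt (verit) powr_ge_zero mult_nonneg_nonneg)
  next
    case False
    have "\<bar>k\<bar> / c = X powr (a - 1)"
      using assms unfolding X_def powr_powr by simp
    also have "\<dots> \<le> x powr (a - 1)"
      using False assms by (intro powr_mono2) (auto simp: X_def)
    finally have "\<bar>k\<bar> \<le> c * x powr (a - 1)"
      using assms by (simp add: field_simps)
    then have "\<bar>k\<bar> * x \<le> c * x powr (a - 1) * x powr 1"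
      using x by (simp add: mult_right_mono)
    also have "\<dots> = c * x powr a"
      unfolding mult.assoc powr_add[symmetric] by simp
    finally have "k * x - c * x powr a \<le> 0"
      using mult_right_mono[OF abs_ge_self[of k] x] by linarith
    also have "0 \<le> \<bar>k\<bar> * X" by (simp add: X_def)
    finally show ?thesis .
  qed
qed

lemma integrable_exp_linear_minus_powr:
  assumes "1 < a" "0 < c"
  shows "integrable lpos (\<lambda>x. exp (k * x - c * x powr a))"
proof -
  \<comment> \<open>The extra 1 in the slope leaves a factor \<open>exp (- x)\<close> for the
    integrable majorant.\<close>
  obtain B where B: "\<And>x. 0 \<le> x \<Longrightarrow> (k + 1) * x - c * x powr a \<le> B"
    using linear_minus_powr_bounded[OF assms] by blast
  show ?thesis
  proof (rule integrable_lpos_bound)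
    show "integrable lpos (\<lambda>x. exp B * exp (- (1 * x)))"
      by (intro integrable_mult_right integrable.intros[OF has_bochner_integral_exp(1)]) simp
    fix x :: real assume "0 < x"
    then show "norm (exp (k * x - c * x powr a)) \<le> exp B * exp (- (1 * x))"
      using B[of x] by (simp add: exp_add[symmetric] algebra_simps)
  qed auto
qed

lemma rGamma_sin:
  "rGamma (1 - x) = Gamma x * sin (pi * x) / pi" if "0 < x" for x :: real
proof -
  have "complex_of_real (rGamma x * rGamma (1 - x)) = complex_of_real (sin (pi * x) / pi)"
    using rGamma_reflection_complex[of "of_real x"]
    by (simp add: rGamma_complex_of_real[symmetric] sin_of_real[symmetric])
  then have "rGamma x * rGamma (1 - x) = sin (pi * x) / pi"
    by (simp only: of_real_eq_iff)
  moreover have "Gamma x * rGamma x = 1"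
    using less_imp_neq[OF Gamma_real_pos[OF that]] unfolding rGamma_inverse_Gamma
    by (intro right_inverse) (rule not_sym)
  ultimately show ?thesis
    by (metis mult.assoc mult.left_neutral times_divide_eq_right)
qed

locale wright_order =
  fixes \<nu> :: real
  assumes nu: "0 < \<nu>" "\<nu> < 1"
begin

definition \<eta> :: real where "\<eta> = pi * \<nu> / (1 + \<nu>)"

abbreviation w :: complex where "w \<equiv> cis \<eta>"

definition c :: real where "c = cos \<eta>"

text \<open>\<open>\<eta>\<close> solves \<open>\<eta> / \<nu> = pi - \<eta>\<close>: for
  \<open>u\<close> of argument \<open>\<eta>\<close> the power \<open>u powr (1 / \<nu>)\<close>
  points along \<open>- cnj w\<close>. The last identity says that turning the ray of argument
  \<open>pi * \<nu>\<close> by \<open>- (\<nu> * \<eta>)\<close> leads to the ray of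
  \<open>w\<close>.\<close>

lemma eta_bounds: "0 < \<eta>" "\<eta> < pi / 2" "\<eta> / \<nu> = pi - \<eta>" "pi * \<nu> - \<nu> * \<eta> = \<eta>"
proof -
  have "0 < 1 + \<nu>" "pi * \<nu> < pi" using nu by auto
  then show "0 < \<eta>" "\<eta> < pi / 2" "\<eta> / \<nu> = pi - \<eta>" "pi * \<nu> - \<nu> * \<eta> = \<eta>"
    using nu by (simp_all add: \<eta>_def divide_simps) (simp_all add: algebra_simps)
qed

lemma c_pos: "0 < c"
  using eta_bounds unfolding c_def by (intro cos_gt_zero_pi) auto

text \<open>The factor \<open>exp (- z x \<zeta>)\<close> is expanded and integrated termwise. The
  moments of \<open>exp (- (x powr (1 / \<nu>)))\<close> give the Gamma values, and the imaginary
  part of \<open>\<zeta> ^ Suc n\<close> gives the sine. All partial sums are dominated by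
  \<open>exp (\<bar>z\<bar> * x - x powr (1 / \<nu>))\<close>, integrable because
  \<open>1 / \<nu> > 1\<close>.\<close>

lemma M_Wright_sums:
  "(\<lambda>n. (- z) ^ n / fact n * (Gamma (\<nu> * (real n + 1)) * sin (pi * \<nu> * (real n + 1)) / pi)) sums
     (Im (\<integral>x. cis (pi * \<nu>) * exp (- (of_real (z * x) * cis (pi * \<nu>)) - of_real (x powr (1 / \<nu>))) \<partial>lpos) / (pi * \<nu>))"
proof -
  define \<zeta> where "\<zeta> = cis (pi * \<nu>)"
  define T where "T = (\<lambda>n x. of_real (x ^ n * exp (- (x powr (1 / \<nu>)))) * (\<zeta> ^ Suc n * of_real ((- z) ^ n / fact n)))"
  define f where "f = (\<lambda>x. \<zeta> * exp (- (of_real (z * x) * \<zeta>) - of_real (x powr (1 / \<nu>))))"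
  have T: "has_bochner_integral lpos (T n)
      (of_real (\<nu> * Gamma (\<nu> * (real n + 1))) * (\<zeta> ^ Suc n * of_real ((- z) ^ n / fact n)))" for n
  proof -
    have "has_bochner_integral lpos (\<lambda>x. x powr (real n + 1 - 1) * exp (- (1 * x powr (1 / \<nu>))))
      (\<nu> * Gamma (\<nu> * (real n + 1)) * 1 powr (- (\<nu> * (real n + 1))))"
      by (rule has_bochner_integral_exp_powr) (use nu in auto)
    then have "has_bochner_integral lpos (\<lambda>x. x ^ n * exp (- (x powr (1 / \<nu>)))) (\<nu> * Gamma (\<nu> * (real n + 1)))"
      by (subst has_bochner_integral_cong_AE[rotated 2]) (auto intro!: AE_lposI simp: powr_realpow)
    then show ?thesis
      unfolding T_def by (intro has_bochner_integral_mult_left has_bochner_integral_of_real)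
  qed
  have eq: "T n x = f' n" if "f' = (\<lambda>n. (- (of_real (z * x) * \<zeta>)) ^ n /\<^sub>R fact n * (\<zeta> * of_real (exp (- (x powr (1 / \<nu>))))))" for n x f'
    unfolding that T_def by (simp add: power_mult_distrib scaleR_conv_of_real field_simps power_minus')
  have ptw: "(\<lambda>n. T n x) sums f x" for x
    unfolding eq[OF refl] f_def
    using sums_mult2[OF exp_converges[of "- (of_real (z * x) * \<zeta>)"], of "\<zeta> * of_real (exp (- (x powr (1 / \<nu>))))"]
    by (simp add: exp_diff exp_minus exp_of_real field_simps)
  have bnd: "norm (\<Sum>i<n. T i x) \<le> exp (\<bar>z\<bar> * x - 1 * x powr (1 / \<nu>))" if "0 < x" for n x
  proof -
    have "norm (\<Sum>i<n. T i x) \<le> (\<Sum>i<n. norm (T i x))"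
      by (rule norm_sum)
    also have "\<dots> = (\<Sum>i<n. (\<bar>z\<bar> * x) ^ i /\<^sub>R fact i) * exp (- (x powr (1 / \<nu>)))"
      using that unfolding sum_distrib_right T_def
      by (intro sum.cong) (auto simp: norm_mult norm_divide norm_power \<zeta>_def power_mult_distrib field_simps)
    also have "\<dots> \<le> exp (\<bar>z\<bar> * x) * exp (- (x powr (1 / \<nu>)))"
      using that exp_converges[of "\<bar>z\<bar> * x"]
      by (intro mult_right_mono sum_le_suminf[THEN order.trans]) (auto simp: sums_iff)
    finally show ?thesis by (simp add: exp_diff exp_minus field_simps)
  qed
  have "(\<lambda>n. \<integral>x. (\<Sum>i<n. T i x) \<partial>lpos) \<longlonglongrightarrow> (\<integral>x. f x \<partial>lpos)"
  proof (rule integral_dominated_convergence)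
    show "integrable lpos (\<lambda>x. exp (\<bar>z\<bar> * x - 1 * x powr (1 / \<nu>)))"
      using nu by (intro integrable_exp_linear_minus_powr) auto
    show "AE x in lpos. (\<lambda>n. \<Sum>i<n. T i x) \<longlonglongrightarrow> f x"
      using ptw by (auto simp: sums_def)
  qed (use bnd in \<open>auto intro!: AE_lposI simp: T_def f_def\<close>)
  also have "(\<lambda>n. \<integral>x. (\<Sum>i<n. T i x) \<partial>lpos) =
     (\<lambda>n. \<Sum>i<n. of_real (\<nu> * Gamma (\<nu> * (real i + 1))) * (\<zeta> ^ Suc i * of_real ((- z) ^ i / fact i)))"
    using T by (auto simp: has_bochner_integral_iff)
  finally have "(\<lambda>i. of_real (\<nu> * Gamma (\<nu> * (real i + 1))) * (\<zeta> ^ Suc i * of_real ((- z) ^ i / fact i))) sums (\<integral>x. f x \<partial>lpos)"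
    by (simp add: sums_def)
  then have "(\<lambda>i. Im (of_real (\<nu> * Gamma (\<nu> * (real i + 1))) * (\<zeta> ^ Suc i * of_real ((- z) ^ i / fact i))) / (pi * \<nu>)) sums (Im (\<integral>x. f x \<partial>lpos) / (pi * \<nu>))"
    by (intro sums_divide sums_Im)
  moreover have "Im (of_real (\<nu> * Gamma (\<nu> * (real i + 1))) * (\<zeta> ^ Suc i * of_real ((- z) ^ i / fact i))) / (pi * \<nu>)
     = (- z) ^ i / fact i * (Gamma (\<nu> * (real i + 1)) * sin (pi * \<nu> * (real i + 1)) / pi)" for i
  proof -
    have "\<zeta> ^ Suc i = cis (pi * \<nu> * (real i + 1))"
      unfolding \<zeta>_def Complex.DeMoivre by (simp add: mult_ac add_ac)
    then have z1: "of_real (\<nu> * Gamma (\<nu> * (real i + 1))) * (\<zeta> ^ Suc i * of_real ((- z) ^ i / fact i)) =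
      of_real (\<nu> * Gamma (\<nu> * (real i + 1)) * ((- z) ^ i / fact i)) * cis (pi * \<nu> * (real i + 1))"
      by (simp only: of_real_mult mult_ac)
    have z2: "Im (of_real r * cis t) = r * sin t" for r t
      by simp
    show ?thesis unfolding z1 z2 using nu by simp
  qed
  ultimately show ?thesis by (simp only: f_def \<zeta>_def)
qed

text \<open>By reflection each coefficient \<open>rGamma (1 - \<nu> * (n + 1))\<close> becomes a
  Gamma value at a positive argument times a sine, whose zeros account for the poles of
  Gamma.\<close>

lemma M_Wright_integral:
  "M_Wright \<nu> z =
     Im (\<integral>x. cis (pi * \<nu>) * exp (- (of_real (z * x) * cis (pi * \<nu>)) - of_real (x powr (1 / \<nu>))) \<partial>lpos) / (pi * \<nu>)"
proof -
  have "rGamma (- \<nu> * real n + (1 - \<nu>)) = Gamma (\<nu> * (real n + 1)) * sin (pi * \<nu> * (real n + 1)) / pi" for n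
  proof -
    have "- \<nu> * real n + (1 - \<nu>) = 1 - \<nu> * (real n + 1)" by (simp add: algebra_simps)
    then show ?thesis using rGamma_sin[of "\<nu> * (real n + 1)"] nu by (simp only: mult.assoc) simp
  qed
  then show ?thesis
    unfolding M_Wright_def using M_Wright_sums[of z] by (simp add: sums_iff)
qed

lemma integrand_rotated_bound:
  assumes "0 \<le> x"
  shows "norm (w * exp (- (of_real (z * x) * w) - of_real (x powr (1 / \<nu>)) * cnj w))
    = exp (- (z * c) * x - c * x powr (1 / \<nu>))"
  by (simp add: norm_mult norm_exp_eq_Re c_def mult_ac)

text \<open>The ray is turned by \<open>\<phi> = - (\<nu> * \<eta>)\<close>. At modulus
  \<open>r\<close> in the sector swept out, \<open>u powr (1 / \<nu>)\<close> has argument at most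
  \<open>\<eta>\<close> in absolute value, hence real part at least \<open>c * r powr a\<close>, and
  this outweighs the crude bound \<open>z * r\<close> for the linear term.\<close>

lemma M_Wright_rotated:
  assumes z: "0 \<le> z"
  shows "integrable lpos (\<lambda>x. w * exp (- (of_real (z * x) * w) - of_real (x powr (1 / \<nu>)) * cnj w))"
    and "M_Wright \<nu> z =
      Im (\<integral>x. w * exp (- (of_real (z * x) * w) - of_real (x powr (1 / \<nu>)) * cnj w) \<partial>lpos) / (pi * \<nu>)"
proof -
  define \<zeta> where "\<zeta> = cis (pi * \<nu>)"
  define a where "a = 1 / \<nu>"
  define \<phi> where "\<phi> = - (\<nu> * \<eta>)"
  define h where "h = (\<lambda>x. w * exp (- (of_real (z * x) * w) - of_real (x powr a) * cnj w))"
  have a: "1 < a" "a * \<phi> = - \<eta>" using nu by (auto simp: a_def \<phi>_def)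
  show ih: "integrable lpos (\<lambda>x. w * exp (- (of_real (z * x) * w) - of_real (x powr (1 / \<nu>)) * cnj w))"
  proof (rule integrable_lpos_bound)
    show "integrable lpos (\<lambda>x. exp (- (z * c) * x - c * x powr a))"
      using a c_pos by (intro integrable_exp_linear_minus_powr) auto
  qed (use integrand_rotated_bound in \<open>auto simp: a_def\<close>)
  have phi: "\<bar>\<phi>\<bar> < pi / 2"
  proof -
    have "\<nu> * \<eta> < 1 * (pi / 2)"
      using nu eta_bounds by (intro mult_strict_mono) auto
    then show ?thesis using nu eta_bounds by (simp add: \<phi>_def abs_mult)
  qed
  have rot: "\<zeta> * cis \<phi> = w"
    using eta_bounds(4) by (simp add: \<zeta>_def \<phi>_def cis_mult)
  define f where "f = (\<lambda>u. \<zeta> * exp (- (of_real z * u * \<zeta>) - u powr (of_real a)))"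
  \<comment> \<open>The slope \<open>z + 1\<close> instead of \<open>z\<close> saves a factor
    \<open>exp (- r)\<close>, which \<open>1 + r\<^sup>2 \<le> 2 * exp r\<close> converts into the
    quadratic decay demanded by the rotation, with constant \<open>2 * exp B\<close>.\<close>
  obtain B where B: "\<And>x. 0 \<le> x \<Longrightarrow> (z + 1) * x - c * x powr a \<le> B"
    using linear_minus_powr_bounded[OF a(1) c_pos] by blast
  \<comment> \<open>On the new ray \<open>f\<close> keeps its prefactor
    \<open>\<zeta> = cis (- \<phi>) * w\<close>. The \<open>cis (- \<phi>)\<close> in front of
    \<open>h\<close> will cancel against the direction \<open>cis \<phi>\<close> of the ray.\<close>
  have "(\<integral>x. \<zeta> * exp (- (of_real (z * x) * \<zeta>) - of_real (x powr a)) \<partial>lpos) =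
     cis \<phi> * (\<integral>x. cis (- \<phi>) * h x \<partial>lpos)"
  proof (rule integral_rotate_ray(3)[OF phi, where f = f and F = "{}"])
    show "continuous_on {z. 0 \<le> Re z \<and> \<bar>Im z\<bar> \<le> \<bar>tan \<phi>\<bar> * Re z} f"
      unfolding f_def using a(1) by (intro continuous_intros) auto
  next
    fix u assume "0 < Re u"
    then show "f field_differentiable at u"
      unfolding f_def field_differentiable_def
      by (intro exI) (rule derivative_eq_intros refl | auto simp: complex_nonpos_Reals_iff)+
  next
    fix u assume u: "u \<in> {z. 0 \<le> Re z \<and> \<bar>Im z\<bar> \<le> \<bar>tan \<phi>\<bar> * Re z}"
    show "norm (f u) \<le> 2 * exp B / (1 + (Re u)\<^sup>2)"
    proof (cases "Re u = 0")
      case True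
      then have "u = 0" using u by (simp add: complex_eq_iff)
      moreover have "0 \<le> B" using B[of 0] by simp
      then have "1 \<le> 2 * exp B" using one_le_exp_iff[of B] by linarith
      ultimately show ?thesis by (simp add: f_def \<zeta>_def)
    next
      case False
      then have "0 < Re u" "\<bar>Im u\<bar> \<le> \<bar>tan \<phi>\<bar> * Re u" using u by auto
      then obtain r t where rt': "Re u \<le> r" "\<bar>t\<bar> \<le> \<bar>\<phi>\<bar>" "u = of_real r * cis t" "r = norm u"
        by (rule sector_polar[OF phi])
      note rt = this \<open>0 < Re u\<close>[THEN less_le_trans, OF rt'(1)]
      have "u powr of_real a = of_real (r powr a) * cis (a * t)"
        unfolding rt(3) by (rule powr_of_real_cis) (use rt(2,5) phi in \<open>auto simp: abs_le_iff\<close>)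
      moreover have "c \<le> cos (a * t)"
      proof -
        have "\<bar>a * t\<bar> \<le> \<bar>a * \<phi>\<bar>"
          using rt(2) a(1) unfolding abs_mult by (intro mult_left_mono) auto
        then have "\<bar>a * t\<bar> \<le> \<eta>" using a(2) eta_bounds by simp
        then have "cos \<eta> \<le> cos \<bar>a * t\<bar>"
          using eta_bounds by (intro cos_monotone_0_pi_le) auto
        then show ?thesis by (simp add: c_def)
      qed
      ultimately have 1: "c * r powr a \<le> Re (u powr of_real a)"
        using mult_right_mono[of c "cos (a * t)" "r powr a"] by (simp add: mult.commute)
      have "\<bar>Re (of_real z * u * \<zeta>)\<bar> \<le> norm (of_real z * u * \<zeta>)" by (rule abs_Re_le_cmod)
      also have "\<dots> = z * r" using z rt(4) by (simp add: norm_mult \<zeta>_def)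
      finally have "- Re (of_real z * u * \<zeta>) \<le> z * r" by linarith
      with 1 B[of r] rt(5) have "- Re (of_real z * u * \<zeta>) - Re (u powr of_real a) \<le> B - r"
        by (simp add: algebra_simps)
      then have "norm (f u) \<le> exp (B - r)"
        by (simp add: f_def norm_mult norm_exp_eq_Re \<zeta>_def)
      also have "\<dots> = 2 * exp B / (2 * exp r)"
        by (simp add: exp_diff)
      also have "\<dots> \<le> 2 * exp B / (1 + (Re u)\<^sup>2)"
      proof (intro divide_left_mono)
        have "(Re u)\<^sup>2 \<le> r\<^sup>2" using rt(1) u by (intro power_mono) auto
        moreover have "1 + r + r\<^sup>2 / 2 \<le> exp r"
          using exp_lower_Taylor_quadratic[of r] rt(5) by simp
        ultimately show "1 + (Re u)\<^sup>2 \<le> 2 * exp r" using rt(5) by linarith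
      qed (auto intro!: mult_pos_pos add_pos_nonneg)
      finally show ?thesis .
    qed
  next
    fix x :: real assume x: "0 < x"
    show "\<zeta> * exp (- (of_real (z * x) * \<zeta>) - of_real (x powr a)) = f (of_real x)"
      using x by (simp add: f_def powr_of_real mult_ac)
    have "(of_real x * cis \<phi>) powr of_real a = of_real (x powr a) * cis (a * \<phi>)"
      by (rule powr_of_real_cis) (use x phi in \<open>auto simp: abs_if split: if_splits\<close>)
    then have "f (of_real x * cis \<phi>) = \<zeta> * exp (- (of_real (z * x) * (\<zeta> * cis \<phi>)) - of_real (x powr a) * cnj w)"
      unfolding f_def a(2) cis_cnj by (simp add: mult_ac)
    also have "\<zeta> = cis (- \<phi>) * (\<zeta> * cis \<phi>)"
      by (subst mult.left_commute) (simp add: cis_mult)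
    then have "\<zeta> * exp (- (of_real (z * x) * (\<zeta> * cis \<phi>)) - of_real (x powr a) * cnj w) = cis (- \<phi>) * h x"
      unfolding h_def rot by simp
    finally show "cis (- \<phi>) * h x = f (of_real x * cis \<phi>)" by simp
  qed (auto simp: h_def)
  also have "\<dots> = (cis \<phi> * cis (- \<phi>)) * (\<integral>x. h x \<partial>lpos)"
    by simp
  also have "cis \<phi> * cis (- \<phi>) = 1"
    by (simp add: cis_mult)
  finally show "M_Wright \<nu> z =
      Im (\<integral>x. w * exp (- (of_real (z * x) * w) - of_real (x powr (1 / \<nu>)) * cnj w) \<partial>lpos) / (pi * \<nu>)"
    unfolding M_Wright_integral by (simp add: \<zeta>_def a_def h_def del: of_real_mult)
qed

end

section \<open>Primitives and parameter integrals on the half-line\<close>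

lemma integral_lpos_FTC:
  fixes f F :: "real \<Rightarrow> 'a::euclidean_space"
  assumes "\<And>x. 0 < x \<Longrightarrow> (F has_vector_derivative f x) (at x)"
    and "\<And>x. 0 < x \<Longrightarrow> isCont f x"
    and int: "integrable lpos f"
    and "(F \<longlongrightarrow> A) (at_right 0)" "(F \<longlongrightarrow> B) at_top"
  shows "(\<integral>x. f x \<partial>lpos) = B - A"
proof -
  have m: "f \<in> borel_measurable borel"
    using int by (auto dest: borel_measurable_integrable)
  have ein: "einterval 0 \<infinity> = {0<..}"
    by (auto simp: einterval_def)
  have *: "has_bochner_integral lborel (\<lambda>x. indicator {0<..} x *\<^sub>R f x) (\<integral>x. f x \<partial>lpos)"
    by (rule has_bochner_integral_lpos_iff[OF m, THEN iffD1, OF has_bochner_integral_integrable[OF int]])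
  have "interval_lebesgue_integral lborel 0 \<infinity> f = B - A"
  proof (rule interval_integral_FTC_integrable[where F = F])
    show "set_integrable lborel (einterval 0 \<infinity>) f"
      using * by (simp add: ein set_integrable_def has_bochner_integral_iff)
    show "((F \<circ> real_of_ereal) \<longlongrightarrow> A) (at_right 0)" "((F \<circ> real_of_ereal) \<longlongrightarrow> B) (at_left \<infinity>)"
      using assms by (simp_all add: zero_ereal_def ereal_tendsto_simps)
  qed (use assms in auto)
  then show ?thesis
    using * by (simp add: interval_lebesgue_integral_def ein set_lebesgue_integral_def has_bochner_integral_iff)
qed

lemma has_bochner_integral_exp_complex:
  assumes "0 < Re q"
  shows "has_bochner_integral lpos (\<lambda>x. exp (- (q * of_real x))) (1 / q)"
proof -
  have i: "integrable lpos (\<lambda>x. exp (- (q * of_real x)))"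
  proof (rule integrable_lpos_bound)
    show "integrable lpos (\<lambda>x. exp (- (Re q * x)))"
      using has_bochner_integral_exp(1)[OF assms] by (rule integrable.intros)
  qed (auto simp: norm_exp_eq_Re)
  have "(\<integral>x. exp (- (q * of_real x)) \<partial>lpos) = 0 - (- exp (- (q * of_real 0)) / q)"
  proof (rule integral_lpos_FTC[where F = "\<lambda>x. - exp (- (q * of_real x)) / q"])
    show "((\<lambda>x. - exp (- (q * of_real x)) / q) has_vector_derivative exp (- (q * of_real x))) (at x)" for x
      using assms by (auto intro!: derivative_eq_intros has_vector_derivative_real_field simp: complex_eq_iff)
    show "((\<lambda>x. - exp (- (q * of_real x)) / q) \<longlongrightarrow> - exp (- (q * of_real 0)) / q) (at_right 0)"
      by (intro tendsto_intros) (use assms in auto)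
    show "((\<lambda>x. - exp (- (q * of_real x)) / q) \<longlongrightarrow> 0) at_top"
    proof (rule Lim_null_comparison)
      show "\<forall>\<^sub>F x in at_top. norm (- exp (- (q * of_real x)) / q) \<le> exp (- (Re q * x)) / norm q"
        by (auto simp: norm_divide norm_exp_eq_Re)
      show "((\<lambda>x. exp (- (Re q * x)) / norm q) \<longlongrightarrow> 0) at_top"
      proof -
        have "0 < norm q" using assms by auto
        with assms show ?thesis by real_asymp
      qed
    qed
  qed (use i in auto)
  then show ?thesis using i by (simp add: has_bochner_integral_iff)
qed

lemma continuous_on_lpos_integral:
  fixes f :: "'b::metric_space \<Rightarrow> real \<Rightarrow> 'a::{banach, second_countable_topology}"
  assumes "\<And>t. t \<in> S \<Longrightarrow> f t \<in> borel_measurable borel"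
    and "\<And>x. 0 < x \<Longrightarrow> continuous_on S (\<lambda>t. f t x)"
    and "\<And>t x. t \<in> S \<Longrightarrow> 0 < x \<Longrightarrow> norm (f t x) \<le> g x"
    and "integrable lpos g"
  shows "continuous_on S (\<lambda>t. \<integral>x. f t x \<partial>lpos)"
  unfolding continuous_on_sequentially
proof (intro allI ballI impI, elim conjE)
  fix s a assume s: "\<forall>n. s n \<in> S" "s \<longlonglongrightarrow> a" and a: "a \<in> S"
  have "(\<lambda>n. \<integral>x. f (s n) x \<partial>lpos) \<longlonglongrightarrow> (\<integral>x. f a x \<partial>lpos)"
  proof (rule integral_dominated_convergence[OF _ _ assms(4)])
    show "AE x in lpos. (\<lambda>i. f (s i) x) \<longlonglongrightarrow> f a x"
      using assms(2) s a by (auto intro!: AE_lposI simp: continuous_on_sequentially o_def)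
  qed (use assms s a in \<open>auto intro!: AE_lposI\<close>)
  then show "((\<lambda>t. \<integral>x. f t x \<partial>lpos) \<circ> s) \<longlonglongrightarrow> (\<integral>x. f a x \<partial>lpos)"
    by (simp add: o_def)
qed

lemma norm_exp_minus_one_le:
  fixes z :: complex
  assumes "0 \<le> Re z"
  shows "norm (exp (- z) - 1) \<le> norm z" "norm (exp (- z) - 1) \<le> 2"
proof -
  have "norm (exp (- z) - exp 0) \<le> 1 * norm (- z - 0)"
  proof (rule field_differentiable_bound[where S = "{z. Re z \<le> 0}" and f = exp and f' = exp])
    show "convex {z. Re z \<le> 0}" by (rule convex_halfspace_Re_le)
  qed (use assms in \<open>auto intro: DERIV_exp has_field_derivative_at_within simp: norm_exp_eq_Re\<close>)
  then show "norm (exp (- z) - 1) \<le> norm z" by simp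
  have "norm (exp (- z) - 1) \<le> norm (exp (- z)) + norm (1 :: complex)"
    by (rule norm_triangle_ineq4)
  also have "\<dots> \<le> 2" using assms by (simp add: norm_exp_eq_Re)
  finally show "norm (exp (- z) - 1) \<le> 2" .
qed

section \<open>Continuity, decay and integrability of the Wright function\<close>

context wright_order
begin

text \<open>The unrotated integral is the one to use here, as it represents
  \<open>M_Wright \<nu>\<close> on the whole line, negative arguments included.\<close>

lemma borel_measurable_M_Wright [measurable]: "M_Wright \<nu> \<in> borel_measurable borel"
proof -
  have "(\<lambda>z. Im (\<integral>x. cis (pi * \<nu>) * exp (- (of_real (z * x) * cis (pi * \<nu>)) - of_real (x powr (1 / \<nu>))) \<partial>lpos) / (pi * \<nu>))
    \<in> borel_measurable borel"
    by measurable
  then show ?thesis by (simp add: M_Wright_integral[abs_def])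
qed

lemma continuous_on_M_Wright: "continuous_on {0..} (M_Wright \<nu>)"
proof -
  have "continuous_on {0..} (\<lambda>z. \<integral>x. w * exp (- (of_real (z * x) * w) - of_real (x powr (1 / \<nu>)) * cnj w) \<partial>lpos)"
  proof (rule continuous_on_lpos_integral)
    show "integrable lpos (\<lambda>x. exp (0 * x - c * x powr (1 / \<nu>)))"
      using nu c_pos by (intro integrable_exp_linear_minus_powr) auto
    fix z x :: real assume "z \<in> {0..}" "0 < x"
    then show "norm (w * exp (- (of_real (z * x) * w) - of_real (x powr (1 / \<nu>)) * cnj w)) \<le> exp (0 * x - c * x powr (1 / \<nu>))"
      using c_pos by (subst integrand_rotated_bound) auto
  qed (auto intro!: continuous_intros)
  then have "continuous_on {0..} (\<lambda>z. Im (\<integral>x. w * exp (- (of_real (z * x) * w) - of_real (x powr (1 / \<nu>)) * cnj w) \<partial>lpos) / (pi * \<nu>))"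
    using nu by (intro continuous_intros) auto
  then show ?thesis
    by (rule continuous_on_eq) (simp add: M_Wright_rotated(2))
qed

text \<open>Boundedness follows by dropping the decay in \<open>z\<close> from the rotated
  integrand. For the quadratic decay, replace the factor
  \<open>exp (- (x powr (1 / \<nu>)) * cnj w)\<close> by 1: the integral becomes
  \<open>1 / z\<close>, which is real, so subtracting it leaves the imaginary part alone. The
  difference of the integrands carries an additional factor \<open>2 * x\<close>, whose integral
  against \<open>exp (- (z * c) * x)\<close> is of order \<open>1 / z\<^sup>2\<close>.\<close>

lemma M_Wright_bound:
  obtains C where "\<And>z. 0 \<le> z \<Longrightarrow> \<bar>M_Wright \<nu> z\<bar> \<le> C / (1 + z\<^sup>2)"
proof
  define A where "A = (\<integral>x. exp (0 * x - c * x powr (1 / \<nu>)) \<partial>lpos)"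
  define f where "f = (\<lambda>z x. w * exp (- (of_real (z * x) * w) - of_real (x powr (1 / \<nu>)) * cnj w))"
  fix z :: real assume z: "0 \<le> z"
  have M: "\<bar>M_Wright \<nu> z\<bar> = \<bar>Im (\<integral>x. f z x \<partial>lpos)\<bar> / (pi * \<nu>)"
    unfolding M_Wright_rotated(2)[OF z] f_def using nu by (simp add: abs_mult)
  have "norm (\<integral>x. f z x \<partial>lpos) \<le> A"
    unfolding A_def
  proof (rule integral_norm_bound_lpos)
    show "integrable lpos (\<lambda>x. exp (0 * x - c * x powr (1 / \<nu>)))"
      using nu c_pos by (intro integrable_exp_linear_minus_powr) auto
    fix x :: real assume "0 < x"
    then show "norm (f z x) \<le> exp (0 * x - c * x powr (1 / \<nu>))"
      using c_pos z unfolding f_def by (subst integrand_rotated_bound) auto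
  qed (simp add: f_def)
  then have 1: "\<bar>Im (\<integral>x. f z x \<partial>lpos)\<bar> \<le> A"
    using abs_Im_le_cmod order.trans by blast
  have 2: "\<bar>Im (\<integral>x. f z x \<partial>lpos)\<bar> * z\<^sup>2 \<le> 2 / c\<^sup>2"
  proof (cases "z = 0")
    case False
    define e where "e = (\<lambda>x. w * exp (- (of_real z * w * of_real x)))"
    have zc: "0 < z * c" using False z c_pos by simp
    have e: "has_bochner_integral lpos e (of_real (1 / z))"
    proof -
      have "has_bochner_integral lpos e (w * (1 / (of_real z * w)))"
        unfolding e_def using zc
        by (intro has_bochner_integral_mult_right has_bochner_integral_exp_complex) (auto simp: c_def)
      then show ?thesis using False by simp
    qed
    have "Im (\<integral>x. f z x \<partial>lpos) = Im (\<integral>x. f z x \<partial>lpos) - Im (\<integral>x. e x \<partial>lpos)"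
      using e by (simp add: has_bochner_integral_iff)
    also have "\<dots> = Im (\<integral>x. f z x - e x \<partial>lpos)"
      using e M_Wright_rotated(1)[OF z] by (simp add: has_bochner_integral_iff f_def)
    finally have "\<bar>Im (\<integral>x. f z x \<partial>lpos)\<bar> \<le> norm (\<integral>x. f z x - e x \<partial>lpos)"
      using abs_Im_le_cmod by metis
    also have "\<dots> \<le> (\<integral>x. 2 * (x * exp (- ((z * c) * x))) \<partial>lpos)"
    proof (rule integral_norm_bound_lpos)
      show "integrable lpos (\<lambda>x. 2 * (x * exp (- ((z * c) * x))))"
        using has_bochner_integral_exp(2)[OF zc] by (intro integrable_mult_right) (rule integrable.intros)
      fix x :: real assume x: "0 < x"
      define q where "q = of_real (x powr (1 / \<nu>)) * cnj w"
      have q: "0 \<le> Re q" "norm q = x powr (1 / \<nu>)"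
        using c_pos by (simp_all add: q_def c_def norm_mult)
      \<comment> \<open>For \<open>x \<le> 1\<close> the exponent \<open>1 / \<nu> > 1\<close> gives
        \<open>x powr (1 / \<nu>) \<le> x\<close>; for larger \<open>x\<close> the trivial bound 2
        suffices.\<close>
      have "norm (exp (- q) - 1) \<le> 2 * x"
      proof (cases "x \<le> 1")
        case True
        have "norm (exp (- q) - 1) \<le> x powr (1 / \<nu>)"
          using norm_exp_minus_one_le(1)[OF q(1)] q(2) by simp
        also have "\<dots> \<le> x powr 1"
          using True x nu by (intro powr_mono') auto
        finally show ?thesis using x by simp
      next
        case False
        then show ?thesis using norm_exp_minus_one_le(2)[OF q(1)] by simp
      qed
      then have "exp (- ((z * c) * x)) * norm (exp (- q) - 1) \<le> exp (- ((z * c) * x)) * (2 * x)"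
        by (intro mult_left_mono) auto
      moreover have "f z x - e x = w * exp (- (of_real z * w * of_real x)) * (exp (- q) - 1)"
        unfolding f_def e_def q_def by (simp add: exp_diff exp_minus field_simps)
      moreover have "norm (w * exp (- (of_real z * w * of_real x))) = exp (- ((z * c) * x))"
        by (simp add: norm_mult norm_exp_eq_Re c_def)
      ultimately show "norm (f z x - e x) \<le> 2 * (x * exp (- ((z * c) * x)))"
        by (simp only: norm_mult) (simp only: mult_ac)
    qed (simp add: f_def e_def)
    also have "\<dots> = 2 * (1 / (z * c)\<^sup>2)"
      using has_bochner_integral_exp(2)[OF zc] by (simp add: has_bochner_integral_iff)
    finally have "\<bar>Im (\<integral>x. f z x \<partial>lpos)\<bar> * z\<^sup>2 \<le> 2 * (1 / (z * c)\<^sup>2) * z\<^sup>2"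
      by (intro mult_right_mono) auto
    also have "\<dots> = 2 / c\<^sup>2"
      using False by (simp add: power_mult_distrib)
    finally show ?thesis .
  qed (use c_pos in simp)
  have "\<bar>Im (\<integral>x. f z x \<partial>lpos)\<bar> * (1 + z\<^sup>2) \<le> A + 2 / c\<^sup>2"
    using 1 2 by (simp add: distrib_left)
  moreover have "0 < 1 + z\<^sup>2"
    by (simp add: add_pos_nonneg)
  ultimately have "\<bar>Im (\<integral>x. f z x \<partial>lpos)\<bar> \<le> (A + 2 / c\<^sup>2) / (1 + z\<^sup>2)"
    by (simp only: pos_le_divide_eq)
  then have "\<bar>Im (\<integral>x. f z x \<partial>lpos)\<bar> / (pi * \<nu>) \<le> (A + 2 / c\<^sup>2) / (1 + z\<^sup>2) / (pi * \<nu>)"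
    using nu by (intro divide_right_mono) auto
  then show "\<bar>M_Wright \<nu> z\<bar> \<le> ((A + 2 / c\<^sup>2) / (pi * \<nu>)) / (1 + z\<^sup>2)"
    unfolding M by (simp only: divide_divide_eq_left mult.commute)
qed

lemma integrable_M_Wright: "integrable lpos (M_Wright \<nu>)"
proof -
  obtain C where C: "\<And>z. 0 \<le> z \<Longrightarrow> \<bar>M_Wright \<nu> z\<bar> \<le> C / (1 + z\<^sup>2)"
    using M_Wright_bound by blast
  show ?thesis
  proof (rule integrable_lpos_bound)
    show "integrable lpos (\<lambda>x. C / (1 + (1 * x)\<^sup>2))"
      by (rule integrable_lpos_1_plus_square) simp
    show "norm (M_Wright \<nu> x) \<le> C / (1 + (1 * x)\<^sup>2)" if "0 < x" for x
      using C[of x] that by simp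
  qed simp
qed

end

section \<open>The Laplace transform in time\<close>

lemma one_plus_square_exp_bound:
  assumes "0 < \<tau>" "0 \<le> (x::real)"
  shows "exp (- (\<tau> * x)) \<le> (1 + 2 / \<tau>\<^sup>2) / (1 + x\<^sup>2)"
proof -
  have "1 + \<tau> * x + (\<tau> * x)\<^sup>2 / 2 \<le> exp (\<tau> * x)"
    using assms by (intro exp_lower_Taylor_quadratic) simp
  moreover have "0 \<le> \<tau> * x" using assms by simp
  ultimately have 1: "(\<tau> * x)\<^sup>2 / 2 \<le> exp (\<tau> * x)" "1 \<le> exp (\<tau> * x)" by auto
  have "x\<^sup>2 = 2 / \<tau>\<^sup>2 * ((\<tau> * x)\<^sup>2 / 2)"
    using assms by (simp add: power_mult_distrib)
  also have "\<dots> \<le> 2 / \<tau>\<^sup>2 * exp (\<tau> * x)"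
    using 1 by (intro mult_left_mono) auto
  finally have "1 + x\<^sup>2 \<le> exp (\<tau> * x) + 2 / \<tau>\<^sup>2 * exp (\<tau> * x)"
    by (rule add_mono[OF 1(2)])
  also have "\<dots> = (1 + 2 / \<tau>\<^sup>2) * exp (\<tau> * x)"
    by (simp only: distrib_right mult_1)
  finally have "1 + x\<^sup>2 \<le> (1 + 2 / \<tau>\<^sup>2) * exp (\<tau> * x)" .
  moreover have "0 < 1 + x\<^sup>2" by (simp add: add_pos_nonneg)
  ultimately show ?thesis
    by (simp add: exp_minus field_simps)
qed

text \<open>A primitive is half the logarithm of the quotient of \<open>x u - 1\<close> and
  \<open>x u + 1\<close>. The factor \<open>- \<i>\<close> carries the upper half-plane to the right
  one, so both \<open>Ln\<close> stay off the branch cut down to \<open>x = 0\<close>, where they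
  differ by \<open>\<i> * pi\<close>; their difference vanishes at infinity.\<close>

lemma Im_integral_partial_fractions:
  assumes "0 < Im u"
    and int: "integrable lpos (\<lambda>x. u / ((of_real x * u)\<^sup>2 - 1))"
  shows "Im (\<integral>x. u / ((of_real x * u)\<^sup>2 - 1) \<partial>lpos) = - (pi / 2)"
proof -
  define F where "F = (\<lambda>x. (Ln (- \<i> * (of_real x * u - 1)) - Ln (- \<i> * (of_real x * u + 1))) / 2)"
  define G where "G = (\<lambda>y. (Ln (- \<i> * (u - of_real y)) - Ln (- \<i> * (u + of_real y))) / 2)"
  have dom: "- \<i> * (of_real x * u - 1) \<notin> \<real>\<^sub>\<le>\<^sub>0" "- \<i> * (of_real x * u + 1) \<notin> \<real>\<^sub>\<le>\<^sub>0" if "0 \<le> x" for x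
    using that assms(1) by (auto simp: complex_nonpos_Reals_iff mult_le_0_iff)
  have nz: "of_real x * u - 1 \<noteq> 0" "of_real x * u + 1 \<noteq> 0" if "0 < x" for x
    using that assms(1) by (auto simp: complex_eq_iff)
  have "(\<integral>x. u / ((of_real x * u)\<^sup>2 - 1) \<partial>lpos) = 0 - F 0"
  proof (rule integral_lpos_FTC[where F = F, OF _ _ int])
    fix x :: real assume x: "0 < x"
    have d: "((\<lambda>z. (Ln (- \<i> * (z * u - 1)) - Ln (- \<i> * (z * u + 1))) / 2) has_field_derivative
        ((- \<i> * u) / (- \<i> * (of_real x * u - 1)) - (- \<i> * u) / (- \<i> * (of_real x * u + 1))) / 2) (at (of_real x))"
      using dom[of x] x
      by (auto intro!: derivative_eq_intros) (simp add: divide_inverse algebra_simps)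
    have e: "((- \<i> * u) / (- \<i> * (of_real x * u - 1)) - (- \<i> * u) / (- \<i> * (of_real x * u + 1))) / 2
       = u / ((of_real x * u)\<^sup>2 - 1)"
    proof -
      have "(of_real x * u)\<^sup>2 - 1 = (of_real x * u - 1) * (of_real x * u + 1)"
        by (simp add: power2_eq_square algebra_simps)
      then show ?thesis using nz[OF x] by (simp add: divide_simps) (simp add: algebra_simps)
    qed
    show "(F has_vector_derivative u / ((of_real x * u)\<^sup>2 - 1)) (at x)"
      using has_vector_derivative_real_field[OF d[unfolded e]] unfolding F_def .
    show "isCont (\<lambda>x. u / ((of_real x * u)\<^sup>2 - 1)) x"
    proof -
      have "(of_real x * u)\<^sup>2 - 1 \<noteq> 0"
        using nz[OF x] by (simp add: power2_eq_1_iff eq_neg_iff_add_eq_0)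
      then show ?thesis by (intro continuous_intros) auto
    qed
  next
    show "(F \<longlongrightarrow> F 0) (at_right 0)"
      unfolding F_def using dom[of 0] by (intro tendsto_intros) auto
    \<comment> \<open>\<open>G (inverse x)\<close> is \<open>F x\<close> with the positive factor
      \<open>x\<close> taken out of both logarithms, where \<open>ln x\<close> cancels. The limit at
      infinity thus becomes the value \<open>G 0 = 0\<close>.\<close>
    have "(G \<longlongrightarrow> G 0) (at_right 0)"
      unfolding G_def using assms(1)
      by (intro tendsto_intros) (auto simp: complex_nonpos_Reals_iff)
    then have "((\<lambda>x. G (inverse x)) \<longlongrightarrow> G 0) at_top"
      by (simp add: filterlim_at_right_to_top)
    moreover have "G (inverse x) = F x" if x: "0 < x" for x
    proof -
      have eq: "- \<i> * (of_real x * u - 1) = of_real x * (- \<i> * (u - of_real (inverse x)))"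
        "- \<i> * (of_real x * u + 1) = of_real x * (- \<i> * (u + of_real (inverse x)))"
        using x by (simp_all add: algebra_simps)
      have "u - of_real (inverse x) \<noteq> 0" "u + of_real (inverse x) \<noteq> 0"
        using assms(1) by (auto simp: complex_eq_iff)
      then have "- \<i> * (u - of_real (inverse x)) \<noteq> 0" "- \<i> * (u + of_real (inverse x)) \<noteq> 0"
        by simp_all
      note Ln = this[THEN Ln_times_of_real[OF x]]
      show ?thesis
        unfolding F_def G_def eq Ln by simp
    qed
    then have "\<forall>\<^sub>F x in at_top. G (inverse x) = F x"
      unfolding eventually_at_top_dense by blast
    ultimately have "(F \<longlongrightarrow> G 0) at_top"
      by (rule Lim_transform_eventually)
    then show "(F \<longlongrightarrow> 0) at_top"
      by (simp add: G_def)
  qed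
  then show ?thesis
    by (simp add: F_def)
qed

context wright_order
begin

lemma integrable_resolvent:
  assumes "0 < \<tau>"
  shows "integrable lpos (\<lambda>x. w * exp (- (of_real (\<tau> * x) * w)) / (1 + of_real (x powr (1 / \<nu>)) * cnj w))"
proof (rule integrable_lpos_bound)
  show "integrable lpos (\<lambda>x. exp (- ((\<tau> * c) * x)))"
    using has_bochner_integral_exp(1)[of "\<tau> * c"] assms c_pos by (auto intro: integrable.intros)
  fix x :: real assume "0 < x"
  have "1 \<le> Re (1 + of_real (x powr (1 / \<nu>)) * cnj w)"
    using c_pos by (simp add: c_def)
  also have "\<dots> \<le> norm (1 + of_real (x powr (1 / \<nu>)) * cnj w)"
    by (rule complex_Re_le_cmod)
  finally show "norm (w * exp (- (of_real (\<tau> * x) * w)) / (1 + of_real (x powr (1 / \<nu>)) * cnj w)) \<le> exp (- ((\<tau> * c) * x))"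
    by (simp add: norm_divide norm_mult norm_exp_eq_Re c_def mult_ac divide_le_eq)
qed simp

text \<open>
  In the variable \<open>u\<close> on the ray of argument \<open>\<eta>\<close> the integrand is \<open>exp (-\<tau> u) / (1 - u powr (1 / \<nu>))\<close>.
  Adding \<open>2 \<nu> exp (-\<tau>) / (u\<^sup>2 - 1)\<close> removes its pole at \<open>1\<close>; the sum is real on the
  real axis, so after rotating to the real axis its integral has no imaginary part.
\<close>

lemma Im_integral_resolvent:
  assumes \<tau>: "0 < \<tau>"
  shows "Im (\<integral>x. w * exp (- (of_real (\<tau> * x) * w)) / (1 + of_real (x powr (1 / \<nu>)) * cnj w) \<partial>lpos) = pi * \<nu> * exp (- \<tau>)"
proof -
  define a where "a = 1 / \<nu>"
  have a: "1 < a" using nu by (simp add: a_def)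
  define S where "S = {z. 0 \<le> Re z \<and> \<bar>Im z\<bar> \<le> \<bar>tan \<eta>\<bar> * Re z}"
  \<comment> \<open>\<open>S\<close> contains 0, where the power is continuous but not known to be
    holomorphic. Holomorphy is therefore stated on \<open>P\<close>, which contains every other
    point of \<open>S\<close>.\<close>
  define P where "P = {z. 0 < Re z}"
  have eta: "\<bar>\<eta>\<bar> < pi / 2" using eta_bounds by simp
  have openP: "open P" unfolding P_def by (rule open_halfspace_Re_gt)
  have SP: "u \<in> P" if "u \<in> S" "u \<noteq> 0" for u
    using that by (auto simp: S_def P_def complex_eq_iff less_le)
  have "1 \<in> P" "1 \<in> S" by (auto simp: P_def S_def)
  have polar: "\<exists>r t. 0 < r \<and> \<bar>t\<bar> \<le> \<eta> \<and> u = of_real r * cis t" if u: "u \<in> S" "u \<noteq> 0" for u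
  proof -
    have "0 < Re u" using SP[OF u] by (simp add: P_def)
    moreover have "\<bar>Im u\<bar> \<le> \<bar>tan \<eta>\<bar> * Re u" using u by (simp add: S_def)
    ultimately obtain r t where "Re u \<le> r" "\<bar>t\<bar> \<le> \<bar>\<eta>\<bar>" "u = of_real r * cis t"
      using sector_polar[OF eta, of u] by metis
    then show ?thesis using \<open>0 < Re u\<close> eta_bounds by (intro exI[of _ r] exI[of _ t]) auto
  qed
  have at: "\<bar>a * t\<bar> < pi" if "\<bar>t\<bar> \<le> \<eta>" for t
  proof -
    have "a * \<bar>t\<bar> \<le> a * \<eta>" using that a by (intro mult_left_mono) auto
    also have "\<dots> < pi" using eta_bounds by (simp add: a_def)
    finally show ?thesis using a by (simp add: abs_mult)
  qed
  \<comment> \<open>Arguments in the sector are multiplied by \<open>a\<close> and stay within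
    \<open>a * \<eta> = pi - \<eta>\<close>, so the power cannot wind around to 1 a second
    time.\<close>
  have powr1: "u powr of_real a \<noteq> 1" if u: "u \<in> S" "u \<noteq> 1" for u
  proof (cases "u = 0")
    case False
    obtain r t where rt: "0 < r" "\<bar>t\<bar> \<le> \<eta>" "u = of_real r * cis t"
      using polar[OF u(1) False] by blast
    have eq: "u powr of_real a = of_real (r powr a) * cis (a * t)"
      unfolding rt(3) by (rule powr_of_real_cis) (use rt(1,2) eta in auto)
    show ?thesis
    proof
      assume 1: "u powr of_real a = 1"
      then have "norm (u powr of_real a) = 1" by simp
      then have "r powr a = 1" unfolding eq by (simp add: norm_mult)
      then have "(r powr a) powr (1 / a) = 1" by simp
      then have "r = 1" unfolding powr_powr using rt(1) a by simp
      moreover have "cis (a * t) = 1" using 1 \<open>r powr a = 1\<close> unfolding eq by simp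
      then have "cos (a * t) = 1" by (simp add: complex_eq_iff)
      then have "a * t = 0" using at[OF rt(2)] cos_one_2pi by (smt (verit) cos_arccos cos_monotone_minus_pi_0' cos_monotone_0_pi cos_zero)
      then have "t = 0" using a by simp
      ultimately show False using u(2) rt(3) by simp
    qed
  qed simp
  have sq1: "u\<^sup>2 - 1 \<noteq> 0" if "u \<in> S" "u \<noteq> 1" for u
  proof
    assume "u\<^sup>2 - 1 = 0"
    then have "u = 1 \<or> u = -1" by (simp add: power2_eq_1_iff)
    then show False using that by (auto simp: S_def)
  qed
  define p where "p = (\<lambda>u::complex. u powr of_real a - 1)"
  have p: "p holomorphic_on P"
    unfolding p_def P_def by (intro holomorphic_intros) (auto simp: complex_nonpos_Reals_iff)
  have p1: "p 1 = 0" by (simp add: p_def)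
  have dp: "deriv p 1 = of_real a"
    unfolding p_def by (rule DERIV_imp_deriv) (auto intro!: derivative_eq_intros)
  \<comment> \<open>The removable singularity is resolved by two difference quotients. With
    \<open>p u = (u - 1) * q u\<close>, the function \<open>k\<close> below is
    \<open>n u / ((u - 1) * (u + 1) * q u)\<close>; since \<open>q 1 = a\<close>, the two terms of
    \<open>n\<close> cancel at 1, so that \<open>n u = (u - 1) * N u\<close>.\<close>
  define q where "q = (\<lambda>u. if u = 1 then deriv p 1 else (p u - p 1) / (u - 1))"
  have q: "q holomorphic_on P"
    unfolding q_def by (rule pole_lemma_open[OF p openP])
  have q0: "q u \<noteq> 0" if "u \<in> S" for u
    using powr1[OF that] a by (auto simp: q_def dp p1) (simp add: p_def)
  define n where "n = (\<lambda>u. 2 * of_real (exp (- \<tau>)) * q u - of_real a * exp (- (of_real \<tau> * u)) * (u + 1))"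
  have n: "n holomorphic_on P"
    unfolding n_def by (intro holomorphic_intros q)
  have n1: "n 1 = 0"
    by (simp add: n_def q_def dp exp_of_real[symmetric])
  define N where "N = (\<lambda>u. if u = 1 then deriv n 1 else (n u - n 1) / (u - 1))"
  have N: "N holomorphic_on P"
    unfolding N_def by (rule pole_lemma_open[OF n openP])
  \<comment> \<open>This is \<open>a = 1 / \<nu>\<close> times the sum described above. The pole is
    cancelled by a multiple of \<open>1 / (u\<^sup>2 - 1)\<close> and not of
    \<open>1 / (u - 1)\<close>, because the rotation demands quadratic decay.\<close>
  define k where "k = (\<lambda>u::complex. of_real a * exp (- (of_real \<tau> * u)) / (1 - u powr of_real a) + 2 * of_real (exp (- \<tau>)) / (u\<^sup>2 - 1))"
  define f where "f = (\<lambda>u. if u = 1 then N u / ((u + 1) * q u) else k u)"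
  have f_eq: "f u = N u / ((u + 1) * q u)" if u: "u \<in> S" "u \<in> P" for u
  proof (cases "u = 1")
    case False
    have nz: "u - 1 \<noteq> 0" "u + 1 \<noteq> 0" "p u \<noteq> 0"
      using False powr1[OF u(1) False] u(2) by (auto simp: P_def complex_eq_iff p_def)
    have sq: "u\<^sup>2 - 1 = (u - 1) * (u + 1)" by (simp add: power2_eq_square algebra_simps)
    have "N u / ((u + 1) * q u) = (2 * of_real (exp (- \<tau>)) * (p u / (u - 1)) - of_real a * exp (- (of_real \<tau> * u)) * (u + 1)) / (u - 1) / ((u + 1) * (p u / (u - 1)))"
    proof -
      have "N u = n u / (u - 1)" "q u = p u / (u - 1)"
        using False by (simp_all add: N_def n1 q_def p1)
      then show ?thesis by (simp only: n_def)
    qed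
    also have "\<dots> = 2 * of_real (exp (- \<tau>)) / (u\<^sup>2 - 1) - of_real a * exp (- (of_real \<tau> * u)) / p u"
      unfolding sq using nz by (simp add: divide_simps)
    also have "\<dots> = k u"
      unfolding k_def p_def using powr1[OF u(1) False] minus_divide_right[of "of_real a * exp (- (of_real \<tau> * u))" "u powr of_real a - 1"]
      by simp
    finally show ?thesis using False by (simp add: f_def)
  qed (simp add: f_def)
  have cont_k: "continuous_on (S - {1}) k"
    unfolding k_def using powr1 sq1 a
    by (intro continuous_intros) (auto simp: S_def)
  have contf: "continuous_on S f"
  proof -
    \<comment> \<open>Neither formula for \<open>f\<close> covers \<open>S\<close>: the one for
      \<open>k\<close> fails at 1, the one with \<open>N\<close> and \<open>q\<close> is continuous
      on \<open>P\<close> and misses 0.\<close>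
    have "S = (S - {1}) \<union> (S \<inter> P)" using \<open>1 \<in> P\<close> by auto
    moreover have "continuous_on ((S - {1}) \<union> (S \<inter> P)) f"
    proof (rule continuous_on_Un_local_open)
      show "openin (top_of_set ((S - {1}) \<union> (S \<inter> P))) (S - {1})"
        unfolding calculation[symmetric] by (rule openin_delete) simp
      show "openin (top_of_set ((S - {1}) \<union> (S \<inter> P))) (S \<inter> P)"
        unfolding calculation[symmetric] using openP by auto
      show "continuous_on (S - {1}) f"
        using cont_k by (rule continuous_on_eq) (auto simp: f_def)
      have "continuous_on (S \<inter> P) (\<lambda>u. N u / ((u + 1) * q u))"
      proof (intro continuous_intros)
        show "continuous_on (S \<inter> P) N" "continuous_on (S \<inter> P) q"
          using N q by (auto intro: continuous_on_subset holomorphic_on_imp_continuous_on)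
        show "\<forall>u\<in>S \<inter> P. (u + 1) * q u \<noteq> 0"
        proof
          fix u assume u: "u \<in> S \<inter> P"
          then have "0 < Re (u + 1)" by (simp add: P_def)
          then have "u + 1 \<noteq> 0" by (metis less_irrefl zero_complex.sel(1))
          then show "(u + 1) * q u \<noteq> 0" using q0 u by simp
        qed
      qed
      then show "continuous_on (S \<inter> P) f"
        by (rule continuous_on_eq) (auto simp: f_eq)
    qed
    ultimately show ?thesis by metis
  qed
  obtain C where C: "\<And>u. u \<in> S \<Longrightarrow> norm (f u) \<le> C / (1 + (Re u)\<^sup>2)"
  proof -
    \<comment> \<open>Compactness handles the neighbourhood of the former pole. For real part above
      2 the power has modulus at least 2 and \<open>(Re u)\<^sup>2 \<ge> 4\<close>, which bounds
      both denominators of \<open>k\<close> from below. The term \<open>5 * D\<close> comes from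
      \<open>1 + 2\<^sup>2\<close> on the compact part.\<close>
    define K where "K = S \<inter> {u. Re u \<le> 2}"
    have "closed K"
      unfolding K_def S_def by (intro closed_Int closed_Collect_conj closed_Collect_le continuous_intros)
    moreover have "bounded K"
    proof (rule boundedI)
      fix u assume u: "u \<in> K"
      have "norm u \<le> \<bar>Re u\<bar> + \<bar>Im u\<bar>" by (rule cmod_le)
      also have "\<bar>Im u\<bar> \<le> \<bar>tan \<eta>\<bar> * Re u" using u by (simp add: K_def S_def)
      also have "\<dots> \<le> \<bar>tan \<eta>\<bar> * 2" using u by (intro mult_left_mono) (auto simp: K_def)
      finally show "norm u \<le> 2 + \<bar>tan \<eta>\<bar> * 2" using u by (simp add: K_def S_def)
    qed
    ultimately have "compact K" by (simp add: compact_eq_bounded_closed)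
    then have "compact (f ` K)"
      by (rule compact_continuous_image[rotated]) (rule continuous_on_subset[OF contf], simp add: K_def)
    then have "bounded (f ` K)" by (rule compact_imp_bounded)
    then obtain D where "\<forall>x\<in>f ` K. norm x \<le> D"
      unfolding bounded_iff by blast
    then have D: "norm (f u) \<le> D" if "u \<in> K" for u
      using that by blast
    have "0 \<le> D" using order.trans[OF norm_ge_zero D[of 0]] by (simp add: K_def S_def)
    show ?thesis
    proof (rule that)
      fix u assume u: "u \<in> S"
      have pos: "0 < 1 + (Re u)\<^sup>2" by (simp add: add_pos_nonneg)
      show "norm (f u) \<le> (a * (1 + 2 / \<tau>\<^sup>2) + 4 + 5 * D) / (1 + (Re u)\<^sup>2)"
      proof (cases "Re u \<le> 2")
        case True
        have "(Re u)\<^sup>2 \<le> 2\<^sup>2" using True u by (intro power_mono) (auto simp: S_def)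
        then have "norm (f u) * (1 + (Re u)\<^sup>2) \<le> D * 5"
          using D[of u] True u \<open>0 \<le> D\<close> pos by (intro mult_mono) (auto simp: K_def)
        also have "\<dots> \<le> a * (1 + 2 / \<tau>\<^sup>2) + 4 + 5 * D" using a by simp
        finally show ?thesis unfolding pos_le_divide_eq[OF pos] .
      next
        case False
        have nu2: "Re u \<le> norm u" "2 \<le> norm u"
          using False complex_Re_le_cmod[of u] by auto
        have "norm u powr 1 \<le> norm u powr a" using nu2 a by (intro powr_mono) auto
        then have "2 \<le> norm (u powr of_real a)"
          using nu2 by (simp add: norm_powr_real_powr')
        then have d1: "1 \<le> norm (1 - u powr of_real a)"
          using norm_triangle_ineq2[of "u powr of_real a" 1] by (simp add: norm_minus_commute)
        have "(Re u)\<^sup>2 \<le> (norm u)\<^sup>2" using nu2 False by (intro power_mono) auto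
        then have "(Re u)\<^sup>2 - 1 \<le> norm (u\<^sup>2 - 1)"
          using norm_triangle_ineq2[of "u\<^sup>2" 1] by (simp add: norm_power)
        moreover have "2\<^sup>2 \<le> (Re u)\<^sup>2" using False by (intro power_mono) auto
        ultimately have d2: "(1 + (Re u)\<^sup>2) / 2 \<le> norm (u\<^sup>2 - 1)" by simp
        have "u \<noteq> 1" using False by auto
        have "norm (f u) \<le> norm (of_real a * exp (- (of_real \<tau> * u)) / (1 - u powr of_real a))
            + norm (2 * of_real (exp (- \<tau>)) / (u\<^sup>2 - 1))"
          using \<open>u \<noteq> 1\<close> unfolding f_def k_def by (simp add: norm_triangle_ineq)
        also have "norm (of_real a * exp (- (of_real \<tau> * u)) / (1 - u powr of_real a)) \<le> a * exp (- (\<tau> * Re u))"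
        proof -
          have "norm (of_real a * exp (- (of_real \<tau> * u)) / (1 - u powr of_real a)) =
            a * exp (- (\<tau> * Re u)) / norm (1 - u powr of_real a)"
            using a by (simp add: norm_divide norm_mult norm_exp_eq_Re)
          also have "\<dots> \<le> a * exp (- (\<tau> * Re u)) / 1"
            using d1 a by (intro divide_left_mono) auto
          finally show ?thesis by simp
        qed
        also have "\<dots> \<le> a * ((1 + 2 / \<tau>\<^sup>2) / (1 + (Re u)\<^sup>2))"
          using one_plus_square_exp_bound[OF \<tau>, of "Re u"] False a by (intro mult_left_mono) auto
        also have "norm (2 * of_real (exp (- \<tau>)) / (u\<^sup>2 - 1)) \<le> 2 / ((1 + (Re u)\<^sup>2) / 2)"
        proof -
          have "norm (2 * of_real (exp (- \<tau>)) / (u\<^sup>2 - 1)) = 2 * exp (- \<tau>) / norm (u\<^sup>2 - 1)"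
            by (simp add: norm_divide norm_mult)
          also have "\<dots> \<le> 2 / ((1 + (Re u)\<^sup>2) / 2)"
            using d2 pos \<tau> by (intro frac_le) auto
          finally show ?thesis .
        qed
        also have "a * ((1 + 2 / \<tau>\<^sup>2) / (1 + (Re u)\<^sup>2)) + 2 / ((1 + (Re u)\<^sup>2) / 2) =
            (a * (1 + 2 / \<tau>\<^sup>2) + 4) / (1 + (Re u)\<^sup>2)"
        proof -
          have "a * (A / d) + 2 / (d / 2) = (a * A + 4) / d" for A d :: real
            by (simp add: add_divide_distrib)
          then show ?thesis .
        qed
        also have "\<dots> \<le> (a * (1 + 2 / \<tau>\<^sup>2) + 4 + 5 * D) / (1 + (Re u)\<^sup>2)"
          using pos \<open>0 \<le> D\<close> by (intro divide_right_mono) auto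
        finally show ?thesis by simp
      qed
    qed
  qed
  define g where "g = (\<lambda>x. if x = 1 then f 1 else
    of_real (a * exp (- (\<tau> * x)) / (1 - x powr a) + 2 * exp (- \<tau>) / (x\<^sup>2 - 1)))"
  define h where "h = (\<lambda>x. of_real a * (exp (- (of_real (\<tau> * x) * w)) / (1 + of_real (x powr a) * cnj w))
    + 2 * of_real (exp (- \<tau>)) / ((of_real x * w)\<^sup>2 - 1))"
  have gm: "g \<in> borel_measurable borel" "h \<in> borel_measurable borel"
    by (simp_all add: g_def h_def)
  have gf: "g x = f (of_real x)" if x: "0 < x" for x
  proof -
    have "complex_of_real x powr of_real a = of_real (x powr a)"
      using x by (simp add: powr_of_real)
    then show ?thesis
      by (simp add: g_def f_def k_def exp_of_real[symmetric])
  qed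
  have hf: "h x = f (of_real x * w)" if x: "0 < x" for x
  proof -
    have "sin \<eta> > 0" using eta_bounds by (intro sin_gt_zero) auto
    then have "of_real x * w \<noteq> 1" using x by (auto simp: complex_eq_iff)
    moreover have "(of_real x * w) powr of_real a = of_real (x powr a) * cis (a * \<eta>)"
      by (rule powr_of_real_cis) (use x eta_bounds in auto)
    moreover have "a * \<eta> = pi - \<eta>" using eta_bounds(3) by (simp add: a_def)
    then have "cis (a * \<eta>) = - cnj w" by (simp add: complex_eq_iff)
    ultimately show ?thesis
      by (simp add: h_def f_def k_def mult.assoc)
  qed
  note rot = integral_rotate_ray[OF eta, where f = f and F = "{1}" and C = C and g = g and h = h,
    folded S_def, OF contf _ _ C gm gf hf]
  have diff: "f field_differentiable at u" if u: "u \<in> S" "0 < Re u" "u \<notin> {1}" for u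
  proof -
    have "k field_differentiable at u"
      unfolding k_def field_differentiable_def using u powr1[of u] sq1[of u]
      by (intro exI) (rule derivative_eq_intros refl | auto simp: complex_nonpos_Reals_iff)+
    then obtain k' where "(k has_field_derivative k') (at u)"
      by (auto simp: field_differentiable_def)
    then have "(f has_field_derivative k') (at u)"
      by (rule has_field_derivative_transform_within_open[where S = "- {1}"])
         (use u in \<open>auto simp: f_def\<close>)
    then show ?thesis by (auto simp: field_differentiable_def)
  qed
  have ih: "integrable lpos h" and gh: "(\<integral>x. g x \<partial>lpos) = w * (\<integral>x. h x \<partial>lpos)"
    using rot(2,3) diff by simp_all
  define J where "J = (\<lambda>x. w * exp (- (of_real (\<tau> * x) * w)) / (1 + of_real (x powr a) * cnj w))"
  define U where "U = (\<lambda>x. w / ((of_real x * w)\<^sup>2 - 1))"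
  have iJ: "integrable lpos J"
    using integrable_resolvent[OF \<tau>] by (simp add: J_def a_def)
  have wh: "w * h x = of_real a * J x + 2 * of_real (exp (- \<tau>)) * U x" for x
    by (simp add: h_def J_def U_def algebra_simps)
  \<comment> \<open>Integrability of \<open>U\<close> is inherited from \<open>J\<close> and from
    \<open>h\<close>, for which the rotation supplies it.\<close>
  have "U = (\<lambda>x. (w * h x - of_real a * J x) / (2 * of_real (exp (- \<tau>))))"
    unfolding wh by simp
  then have iU: "integrable lpos U"
    using ih iJ by simp
  have "Im (\<integral>x. g x \<partial>lpos) = 0"
  proof -
    have "integrable lpos g" using rot(1) diff by simp
    then have "Im (\<integral>x. g x \<partial>lpos) = (\<integral>x. Im (g x) \<partial>lpos)" by simp
    \<comment> \<open>At \<open>x = 1\<close> the function \<open>g\<close> takes the filled-in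
      value \<open>f 1\<close>, which has not been shown to be real; hence the comparison almost
      everywhere.\<close>
    also have "\<dots> = (\<integral>x. 0 \<partial>lpos)"
    proof (rule integral_cong_AE)
      have "AE x in lborel. x \<noteq> (1::real)" by (rule AE_lborel_singleton)
      then show "AE x in lpos. Im (g x) = 0"
        unfolding AE_lpos by eventually_elim (auto simp: g_def simp del: of_real_add of_real_divide)
    qed (use gm in auto)
    finally show ?thesis by simp
  qed
  moreover have "(\<integral>x. g x \<partial>lpos) = of_real a * (\<integral>x. J x \<partial>lpos) + 2 * of_real (exp (- \<tau>)) * (\<integral>x. U x \<partial>lpos)"
  proof -
    have "(\<integral>x. g x \<partial>lpos) = (\<integral>x. w * h x \<partial>lpos)" using gh by simp
    then show ?thesis unfolding wh using iJ iU by simp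
  qed
  moreover have "Im (\<integral>x. U x \<partial>lpos) = - (pi / 2)"
    using eta_bounds iU unfolding U_def
    by (intro Im_integral_partial_fractions) (auto intro: sin_gt_zero)
  ultimately have "a * Im (\<integral>x. J x \<partial>lpos) = pi * exp (- \<tau>)"
    by simp
  then show ?thesis
    using nu by (simp add: J_def a_def field_simps)
qed

end

section \<open>Uniqueness of Laplace transforms\<close>

lemma continuous_AE_lpos_zero:
  fixes f :: "real \<Rightarrow> 'a::real_normed_vector"
  assumes f: "continuous_on {0<..} f" and AE: "AE x in lpos. f x = 0" and x: "0 < x"
  shows "f x = 0"
proof (rule ccontr)
  assume nz: "f x \<noteq> 0"
  define U where "U = {0<..} \<inter> f -` (- {0})"
  have "open U"
    unfolding U_def by (rule continuous_open_preimage[OF f]) auto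
  moreover have "x \<in> U" using x nz by (simp add: U_def)
  ultimately have "\<not> negligible U"
    by (intro open_not_negligible) auto
  moreover have "AE x in lborel. x \<notin> U"
    using AE unfolding AE_lpos U_def by eventually_elim auto
  then have "U \<in> null_sets lborel"
    using \<open>open U\<close> by (subst AE_iff_null_sets) auto
  then have "negligible U"
    by (simp add: negligible_iff_null_sets null_sets_completionI)
  ultimately show False by simp
qed

text \<open>Lerch's argument. In the variable \<open>x = exp (- t)\<close> the transforms at the
  positive integers say that \<open>H\<close> is orthogonal to all polynomials on the unit interval.
  By Weierstrass it is orthogonal to a continuous multiple of itself by a positive weight, so it
  vanishes almost everywhere, and then everywhere by continuity.\<close>

lemma laplace_unique_real:
  fixes H :: "real \<Rightarrow> real"
  assumes cont: "continuous_on {0<..} H" and m [measurable]: "H \<in> borel_measurable borel"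
    and bound: "\<And>t. 0 < t \<Longrightarrow> \<bar>H t\<bar> \<le> B"
    and zero: "\<And>s. 0 < s \<Longrightarrow> (\<integral>t. exp (- (s * t)) * H t \<partial>lpos) = 0"
    and t: "0 < t"
  shows "H t = 0"
proof -
  have B0: "0 \<le> B" using bound[of 1] by simp
  have int: "integrable lpos (\<lambda>t. exp (- (s * t)) * H t)" if s: "0 < s" for s
  proof (rule integrable_lpos_bound)
    show "integrable lpos (\<lambda>t. B * exp (- (s * t)))"
      using has_bochner_integral_exp(1)[OF s] by (intro integrable_mult_right) (rule integrable.intros)
    show "norm (exp (- (s * t)) * H t) \<le> B * exp (- (s * t))" if "0 < t" for t
      using mult_right_mono[OF bound[OF that], of "exp (- (s * t))"] by (simp add: abs_mult mult.commute)
  qed simp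
  \<comment> \<open>\<open>H (- ln x)\<close> itself may have no limit at 0 or 1. The weight
    \<open>x * (1 - x)\<close> makes it continuous up to the ends, where it becomes 0, and keeps its
    sign in between.\<close>
  define \<phi> where "\<phi> = (\<lambda>x. x * (1 - x) * H (- ln x))"
  have \<phi>_bound: "\<bar>\<phi> x\<bar> \<le> B * (x * (1 - x))" if "0 \<le> x" "x \<le> 1" for x
  proof (cases "x = 0 \<or> x = 1")
    case False
    then have "\<bar>\<phi> x\<bar> = x * (1 - x) * \<bar>H (- ln x)\<bar>"
      using that by (simp add: \<phi>_def abs_mult)
    also have "\<dots> \<le> x * (1 - x) * B"
      using that False by (intro mult_left_mono bound) auto
    finally show ?thesis by (simp add: mult.commute)
  qed (auto simp: \<phi>_def)
  have cont\<phi>: "continuous_on {0..1} \<phi>"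
    unfolding continuous_on_def
  proof
    fix x :: real assume x: "x \<in> {0..1}"
    show "(\<phi> \<longlongrightarrow> \<phi> x) (at x within {0..1})"
    proof (cases "x = 0 \<or> x = 1")
      case True
      then have "\<phi> x = 0" by (auto simp: \<phi>_def)
      moreover have "(\<phi> \<longlongrightarrow> 0) (at x within {0..1})"
      proof (rule Lim_null_comparison)
        show "\<forall>\<^sub>F y in at x within {0..1}. norm (\<phi> y) \<le> B * (y * (1 - y))"
          using \<phi>_bound by (auto simp: eventually_at_filter)
        have "((\<lambda>y. B * (y * (1 - y))) \<longlongrightarrow> B * (x * (1 - x))) (at x within {0..1})"
          by (intro tendsto_intros)
        then show "((\<lambda>y. B * (y * (1 - y))) \<longlongrightarrow> 0) (at x within {0..1})"
          using True by auto
      qed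
      ultimately show ?thesis by simp
    next
      case False
      then have x01: "0 < x" "x < 1" using x by auto
      have "isCont H (- ln x)"
        using cont x01 by (simp add: continuous_on_eq_continuous_at)
      then have "isCont \<phi> x"
        unfolding \<phi>_def using x01
        by (intro continuous_intros isCont_o2[where g = H and f = "\<lambda>x. - ln x"]) auto
      then show ?thesis
        using continuous_at_imp_continuous_at_within continuous_within by blast
    qed
  qed
  define I where "I = (\<integral>t. exp (- (1 * t)) * (\<phi> (exp (- t)) * H t) \<partial>lpos)"
  have iI: "integrable lpos (\<lambda>t. \<phi> (exp (- t)) * (exp (- (1 * t)) * H t))"
  proof (rule integrable_lpos_bound)
    show "integrable lpos (\<lambda>t. B * \<bar>exp (- (1 * t)) * H t\<bar>)"
      using int[of 1] by simp
    fix t :: real assume t: "0 < t"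
    have "\<bar>\<phi> (exp (- t))\<bar> \<le> B * (exp (- t) * (1 - exp (- t)))" using t by (intro \<phi>_bound) auto
    also have "\<dots> \<le> B * (1 * 1)" using t B0 by (intro mult_left_mono mult_mono) auto
    finally show "norm (\<phi> (exp (- t)) * (exp (- (1 * t)) * H t)) \<le> B * \<bar>exp (- (1 * t)) * H t\<bar>"
      unfolding real_norm_def abs_mult[of "\<phi> (exp (- t))"] by (intro mult_right_mono) auto
  qed (simp add: \<phi>_def)
  have small: "\<bar>I\<bar> \<le> e * B" if e: "0 < e" for e
  proof -
    obtain g where g: "real_polynomial_function g" "\<And>x. x \<in> {0..1} \<Longrightarrow> \<bar>\<phi> x - g x\<bar> < e"
      using Stone_Weierstrass_real_polynomial_function[OF _ cont\<phi> e] by auto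
    from g(1) obtain a n where g_eq: "g = (\<lambda>x. \<Sum>i\<le>n. a i * x ^ i)"
      by (auto simp: real_polynomial_function_iff_sum)
    have ge: "g (exp (- t)) * (exp (- (1 * t)) * H t) = (\<Sum>i\<le>n. a i * (exp (- ((real i + 1) * t)) * H t))" for t
    proof -
      have "exp (- t) ^ i * exp (- (1 * t)) = exp (- ((real i + 1) * t))" for i
        unfolding exp_of_nat_mult[symmetric] exp_add[symmetric] by (simp add: algebra_simps)
      then have "a i * exp (- t) ^ i * (exp (- (1 * t)) * H t) = a i * (exp (- ((real i + 1) * t)) * H t)" for i
        by (metis mult.assoc)
      then show ?thesis
        unfolding g_eq sum_distrib_right by (simp only:)
    qed
    have ig: "has_bochner_integral lpos (\<lambda>t. g (exp (- t)) * (exp (- (1 * t)) * H t)) 0"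
    proof -
      have "has_bochner_integral lpos (\<lambda>t. \<Sum>i\<le>n. a i * (exp (- ((real i + 1) * t)) * H t)) (\<Sum>i\<le>n. a i * 0)"
        using int zero
        by (intro has_bochner_integral_sum has_bochner_integral_mult_right) (auto simp: has_bochner_integral_iff)
      then show ?thesis unfolding ge by simp
    qed
    have "I = (\<integral>t. \<phi> (exp (- t)) * (exp (- (1 * t)) * H t) \<partial>lpos) - 0"
      unfolding I_def by (simp add: mult_ac)
    also have "\<dots> = (\<integral>t. \<phi> (exp (- t)) * (exp (- (1 * t)) * H t) - g (exp (- t)) * (exp (- (1 * t)) * H t) \<partial>lpos)"
      using ig iI by (simp add: has_bochner_integral_iff)
    also have "\<dots> = (\<integral>t. (\<phi> (exp (- t)) - g (exp (- t))) * (exp (- (1 * t)) * H t) \<partial>lpos)"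
      by (simp only: left_diff_distrib)
    also have "norm \<dots> \<le> (\<integral>t. e * B * exp (- (1 * t)) \<partial>lpos)"
    proof (rule integral_norm_bound_lpos)
      show "integrable lpos (\<lambda>t. e * B * exp (- (1 * t)))"
        using has_bochner_integral_exp(1)[of 1] by (intro integrable_mult_right) (auto intro: integrable.intros)
      have [measurable]: "g \<in> borel_measurable borel" unfolding g_eq by measurable
      show "(\<lambda>t. (\<phi> (exp (- t)) - g (exp (- t))) * (exp (- (1 * t)) * H t)) \<in> borel_measurable borel"
        unfolding \<phi>_def by measurable
      fix t :: real assume t: "0 < t"
      have "\<bar>\<phi> (exp (- t)) - g (exp (- t))\<bar> * (exp (- (1 * t)) * \<bar>H t\<bar>) \<le> e * (exp (- (1 * t)) * B)"
        using g(2)[of "exp (- t)"] t bound[OF t] e by (intro mult_mono mult_left_mono) auto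
      then show "norm ((\<phi> (exp (- t)) - g (exp (- t))) * (exp (- (1 * t)) * H t)) \<le> e * B * exp (- (1 * t))"
        by (simp add: abs_mult mult_ac)
    qed
    also have "\<dots> = e * B"
      using has_bochner_integral_exp(1)[of 1] by (simp add: has_bochner_integral_iff)
    finally show ?thesis by simp
  qed
  have "I = 0"
  proof (rule ccontr)
    assume "I \<noteq> 0"
    \<comment> \<open>\<open>B + 1\<close> in the denominator allows for
      \<open>B = 0\<close>.\<close>
    then have "\<bar>I\<bar> \<le> (\<bar>I\<bar> / (2 * (B + 1))) * B"
      using B0 by (intro small) auto
    also have "\<dots> < \<bar>I\<bar>"
      using B0 \<open>I \<noteq> 0\<close> by (simp add: field_simps) (intro add_nonneg_pos, simp_all)
    finally show False by simp
  qed
  have nonneg: "0 \<le> exp (- (1 * t)) * (\<phi> (exp (- t)) * H t)" if "0 < t" for t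
    using that by (simp add: \<phi>_def mult.assoc)
  have "AE t in lpos. exp (- (1 * t)) * (\<phi> (exp (- t)) * H t) = 0"
    using \<open>I = 0\<close> nonneg iI unfolding I_def
    by (subst (asm) integral_nonneg_eq_0_iff_AE) (auto intro: AE_lposI simp: mult_ac)
  then have "AE t in lpos. H t = 0"
    using AE_lpos_pos by eventually_elim (auto simp: \<phi>_def)
  then show ?thesis
    using cont t by (intro continuous_AE_lpos_zero)
qed

lemma laplace_unique:
  fixes G H :: "real \<Rightarrow> complex"
  assumes G: "continuous_on {0<..} G" "G \<in> borel_measurable borel" "\<And>t. 0 < t \<Longrightarrow> norm (G t) \<le> A"
    and H: "continuous_on {0<..} H" "H \<in> borel_measurable borel" "\<And>t. 0 < t \<Longrightarrow> norm (H t) \<le> B"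
    and eq: "\<And>s. 0 < s \<Longrightarrow> has_bochner_integral lpos (\<lambda>t. exp (- (s * t)) * G t) (V s)"
      "\<And>s. 0 < s \<Longrightarrow> has_bochner_integral lpos (\<lambda>t. exp (- (s * t)) * H t) (V s)"
    and t: "0 < t"
  shows "G t = H t"
proof -
  note [measurable] = G(2) H(2)
  have bound: "norm (G t - H t) \<le> A + B" if "0 < t" for t
    using norm_triangle_ineq4[of "G t" "H t"] G(3)[OF that] H(3)[OF that] by linarith
  have diff: "has_bochner_integral lpos (\<lambda>t. exp (- (s * t)) * (G t - H t)) 0" if "0 < s" for s
    using has_bochner_integral_diff[OF eq[OF that]] by (simp add: right_diff_distrib)
  have "Re (G t - H t) = 0"
  proof (rule laplace_unique_real[where H = "\<lambda>t. Re (G t - H t)" and B = "A + B", OF _ _ _ _ t])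
    show "continuous_on {0<..} (\<lambda>t. Re (G t - H t))" using G H by (intro continuous_intros)
    show "\<bar>Re (G t - H t)\<bar> \<le> A + B" if "0 < t" for t
      using abs_Re_le_cmod bound[OF that] by (rule order.trans)
    show "(\<integral>t. exp (- (s * t)) * Re (G t - H t) \<partial>lpos) = 0" if "0 < s" for s
      using has_bochner_integral_Re[OF diff[OF that]] by (simp add: has_bochner_integral_iff)
  qed measurable
  moreover have "Im (G t - H t) = 0"
  proof (rule laplace_unique_real[where H = "\<lambda>t. Im (G t - H t)" and B = "A + B", OF _ _ _ _ t])
    show "continuous_on {0<..} (\<lambda>t. Im (G t - H t))" using G H by (intro continuous_intros)
    show "\<bar>Im (G t - H t)\<bar> \<le> A + B" if "0 < t" for t
      using abs_Im_le_cmod bound[OF that] by (rule order.trans)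
    show "(\<integral>t. exp (- (s * t)) * Im (G t - H t) \<partial>lpos) = 0" if "0 < s" for s
      using has_bochner_integral_Im[OF diff[OF that]] by (simp add: has_bochner_integral_iff)
  qed measurable
  ultimately show ?thesis by (simp add: complex_eq_iff)
qed

section \<open>Mixtures of functions against the Wright kernel\<close>

text \<open>The majorant \<open>h\<close> may depend on \<open>x\<close> as long as its mass in
  \<open>y\<close> stays bounded. This fits rescaled functions of constant mass: the kernel
  \<open>M_Wright_time\<close> at varying times, and dilated densities.\<close>

lemma lpos_pair_integrable:
  fixes f :: "real \<times> real \<Rightarrow> 'a::{banach, second_countable_topology}"
  assumes m: "f \<in> borel_measurable (lpos \<Otimes>\<^sub>M lpos)"
    and b: "\<And>x y. 0 < x \<Longrightarrow> 0 < y \<Longrightarrow> norm (f (x, y)) \<le> g x * h x y"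
    and h: "\<And>x. 0 < x \<Longrightarrow> integrable lpos (h x)" "\<And>x. 0 < x \<Longrightarrow> (\<integral>y. h x y \<partial>lpos) \<le> D"
    and g: "integrable lpos g" "\<And>x. 0 < x \<Longrightarrow> 0 \<le> g x"
  shows "integrable (lpos \<Otimes>\<^sub>M lpos) f"
proof (rule lpos_pair.Fubini_integrable[OF m])
  have m1: "(\<lambda>y. f (x, y)) \<in> borel_measurable borel" for x
    using measurable_compose[OF measurable_Pair1' m, of x] by simp
  have int: "integrable lpos (\<lambda>y. f (x, y))" if "0 < x" for x
    by (rule integrable_lpos_bound[where g = "\<lambda>y. g x * h x y", OF _ m1])
       (use b h that in auto)
  then show "AE x in lpos. integrable lpos (\<lambda>y. f (x, y))" by (rule AE_lposI)
  show "integrable lpos (\<lambda>x. \<integral>y. norm (f (x, y)) \<partial>lpos)"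
  proof (rule integrable_lpos_bound)
    show "integrable lpos (\<lambda>x. g x * D)" using g by simp
    have "(\<lambda>x. \<integral>y. norm (f (x, y)) \<partial>lpos) \<in> borel_measurable lpos"
      by (rule lpos.borel_measurable_lebesgue_integral) (use m in simp)
    then show "(\<lambda>x. \<integral>y. norm (f (x, y)) \<partial>lpos) \<in> borel_measurable borel" by simp
    fix x :: real assume x: "0 < x"
    have "(\<integral>y. norm (f (x, y)) \<partial>lpos) \<le> (\<integral>y. g x * h x y \<partial>lpos)"
      using int[OF x] b x h by (intro integral_mono_AE) (auto intro: AE_lposI)
    also have "\<dots> \<le> g x * D"
      using h x g by (simp add: mult_left_mono)
    finally show "norm (\<integral>y. norm (f (x, y)) \<partial>lpos) \<le> g x * D"
      by simp
  qed
qed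

context wright_order
begin

lemma borel_measurable_M_Wright_time [measurable]:
  assumes [measurable]: "f \<in> borel_measurable N" "g \<in> borel_measurable N"
  shows "(\<lambda>x. M_Wright_time \<nu> (f x) (g x)) \<in> borel_measurable N"
  unfolding M_Wright_time_def by measurable

text \<open>The substitution \<open>x = t powr \<nu> * y\<close> makes the exponent linear in
  \<open>t\<close>, so that the Laplace transform in \<open>t\<close> reduces to an exponential
  integral.\<close>

lemma M_Wright_time_rotated:
  assumes "0 < t" "0 < \<tau>"
  shows "M_Wright_time \<nu> \<tau> t =
    Im (\<integral>y. w * exp (- (of_real (\<tau> * y) * w) - of_real (t * y powr (1 / \<nu>)) * cnj w) \<partial>lpos) / (pi * \<nu>)"
proof -
  define f where "f = (\<lambda>x. w * exp (- (of_real (\<tau> / t powr \<nu> * x) * w) - of_real (x powr (1 / \<nu>)) * cnj w))"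
  have tn: "0 < t powr \<nu>" using assms by simp
  have "(\<integral>x. f x \<partial>lpos) = (\<integral>y. t powr \<nu> *\<^sub>R f (t powr \<nu> * y) \<partial>lpos)"
    by (rule integral_lpos_scale(1)[symmetric, OF _ tn]) (simp add: f_def)
  also have "\<dots> = (\<integral>y. t powr \<nu> *\<^sub>R (w * exp (- (of_real (\<tau> * y) * w) - of_real (t * y powr (1 / \<nu>)) * cnj w)) \<partial>lpos)"
  proof (rule integral_cong_AE)
    show "AE y in lpos. t powr \<nu> *\<^sub>R f (t powr \<nu> * y) =
       t powr \<nu> *\<^sub>R (w * exp (- (of_real (\<tau> * y) * w) - of_real (t * y powr (1 / \<nu>)) * cnj w))"
    proof (rule AE_lposI)
      fix y :: real assume y: "0 < y"
      have "(t powr \<nu> * y) powr (1 / \<nu>) = t * y powr (1 / \<nu>)"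
        using assms y nu by (simp add: powr_mult powr_powr)
      moreover have "\<tau> / t powr \<nu> * (t powr \<nu> * y) = \<tau> * y" using tn by simp
      ultimately show "t powr \<nu> *\<^sub>R f (t powr \<nu> * y) =
         t powr \<nu> *\<^sub>R (w * exp (- (of_real (\<tau> * y) * w) - of_real (t * y powr (1 / \<nu>)) * cnj w))"
        unfolding f_def by (simp only:)
    qed
  qed (simp_all add: f_def)
  also have "\<dots> = t powr \<nu> *\<^sub>R (\<integral>y. w * exp (- (of_real (\<tau> * y) * w) - of_real (t * y powr (1 / \<nu>)) * cnj w) \<partial>lpos)"
    (is "_ = _ *\<^sub>R ?E")
    by (rule integral_scaleR_right)
  finally have "Im (\<integral>x. f x \<partial>lpos) = t powr \<nu> * Im ?E"
    by (simp only: scaleR_complex.sel)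
  moreover have "M_Wright \<nu> (\<tau> / t powr \<nu>) = Im (\<integral>x. f x \<partial>lpos) / (pi * \<nu>)"
    using M_Wright_rotated(2)[of "\<tau> / t powr \<nu>"] assms by (simp add: f_def)
  ultimately show ?thesis
    using tn unfolding M_Wright_time_def powr_minus by (simp only:) simp
qed

text \<open>After the exchange of integrals, the one over \<open>t\<close> produces the denominator
  \<open>1 + y powr (1 / \<nu>) * cnj w\<close>, which leads to
  \<open>Im_integral_resolvent\<close>. The exchange is absolute: on the rotated ray the integrand
  is at most \<open>exp (- t) * exp (- ((\<tau> * c) * y))\<close>.\<close>

lemma laplace_M_Wright_time_1:
  assumes \<tau>: "0 < \<tau>"
  shows "has_bochner_integral lpos (\<lambda>t. exp (- t) * M_Wright_time \<nu> \<tau> t) (exp (- \<tau>))"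
proof -
  define f where "f = (\<lambda>(t, y). of_real (exp (- t)) *
    (w * exp (- (of_real (\<tau> * y) * w) - of_real (t * y powr (1 / \<nu>)) * cnj w)))"
  have fm: "f \<in> borel_measurable (lpos \<Otimes>\<^sub>M lpos)"
    unfolding f_def by measurable
  have fi: "integrable (lpos \<Otimes>\<^sub>M lpos) f"
  proof (rule lpos_pair_integrable[OF fm, where g = "\<lambda>t. exp (- (1 * t))" and h = "\<lambda>t y. exp (- ((\<tau> * c) * y))"])
    show "norm (f (t, y)) \<le> exp (- (1 * t)) * exp (- ((\<tau> * c) * y))" if "0 < t" "0 < y" for t y
      using that c_pos by (simp add: f_def norm_mult norm_exp_eq_Re c_def mult_ac)
    show "(\<integral>y. exp (- ((\<tau> * c) * y)) \<partial>lpos) \<le> 1 / (\<tau> * c)"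
      using has_bochner_integral_exp(1)[of "\<tau> * c"] \<tau> c_pos by (simp add: has_bochner_integral_iff)
    show "integrable lpos (\<lambda>y. exp (- ((\<tau> * c) * y)))"
      using has_bochner_integral_exp(1)[of "\<tau> * c"] \<tau> c_pos by (simp add: has_bochner_integral_iff)
    show "integrable lpos (\<lambda>t. exp (- (1 * t)) :: real)"
      by (rule integrable.intros[OF has_bochner_integral_exp(1)]) simp
  qed simp_all
  have 1: "(\<integral>t. (\<integral>y. f (t, y) \<partial>lpos) \<partial>lpos) = (\<integral>y. (\<integral>t. f (t, y) \<partial>lpos) \<partial>lpos)"
    by (rule lpos_pair.Fubini_integral[symmetric]) (use fi in simp)
  have "(\<integral>t. f (t, y) \<partial>lpos) = w * exp (- (of_real (\<tau> * y) * w)) / (1 + of_real (y powr (1 / \<nu>)) * cnj w)" if "0 < y" for y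
  proof -
    have "has_bochner_integral lpos (\<lambda>t. exp (- ((1 + of_real (y powr (1 / \<nu>)) * cnj w) * of_real t))) (1 / (1 + of_real (y powr (1 / \<nu>)) * cnj w))"
      using c_pos by (intro has_bochner_integral_exp_complex) (auto simp: c_def intro: add_pos_nonneg)
    then have "has_bochner_integral lpos (\<lambda>t. (w * exp (- (of_real (\<tau> * y) * w))) * exp (- ((1 + of_real (y powr (1 / \<nu>)) * cnj w) * of_real t)))
       (w * exp (- (of_real (\<tau> * y) * w)) * (1 / (1 + of_real (y powr (1 / \<nu>)) * cnj w)))"
      by (rule has_bochner_integral_mult_right)
    moreover have "(w * exp (- (of_real (\<tau> * y) * w))) * exp (- ((1 + of_real (y powr (1 / \<nu>)) * cnj w) * of_real t)) = f (t, y)" for t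
    proof -
      have "exp (- (of_real (\<tau> * y) * w)) * exp (- ((1 + of_real (y powr (1 / \<nu>)) * cnj w) * of_real t)) =
        exp (of_real (- t)) * exp (- (of_real (\<tau> * y) * w) - of_real (t * y powr (1 / \<nu>)) * cnj w)"
        unfolding exp_add[symmetric] by (simp add: algebra_simps)
      then show ?thesis
        unfolding f_def exp_of_real by (simp add: mult.assoc mult.left_commute)
    qed
    ultimately have "has_bochner_integral lpos (\<lambda>t. f (t, y))
       (w * exp (- (of_real (\<tau> * y) * w)) * (1 / (1 + of_real (y powr (1 / \<nu>)) * cnj w)))"
      by (simp only:)
    then show ?thesis
      by (simp only: has_bochner_integral_iff times_divide_eq_right mult_1_right)
  qed
  then have "(\<integral>y. (\<integral>t. f (t, y) \<partial>lpos) \<partial>lpos) =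
     (\<integral>y. w * exp (- (of_real (\<tau> * y) * w)) / (1 + of_real (y powr (1 / \<nu>)) * cnj w) \<partial>lpos)"
    using fm by (intro integral_cong_AE) (auto intro!: AE_lposI simp: f_def)
  then have 2: "Im (\<integral>t. (\<integral>y. f (t, y) \<partial>lpos) \<partial>lpos) = pi * \<nu> * exp (- \<tau>)"
    unfolding 1 using Im_integral_resolvent[OF \<tau>] by simp
  have 3: "integrable lpos (\<lambda>t. \<integral>y. f (t, y) \<partial>lpos)"
    using lpos_pair.integrable_fst'[OF fi] .
  have 4: "exp (- t) * M_Wright_time \<nu> \<tau> t = Im (\<integral>y. f (t, y) \<partial>lpos) / (pi * \<nu>)" if "0 < t" for t
    unfolding M_Wright_time_rotated[OF that \<tau>] f_def by simp
  have "has_bochner_integral lpos (\<lambda>t. Im (\<integral>y. f (t, y) \<partial>lpos) / (pi * \<nu>)) ((pi * \<nu> * exp (- \<tau>)) / (pi * \<nu>))"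
    unfolding 2[symmetric] using 3 by (intro has_bochner_integral_divide has_bochner_integral_Im) (auto simp: has_bochner_integral_iff)
  then have "has_bochner_integral lpos (\<lambda>t. exp (- t) * M_Wright_time \<nu> \<tau> t) ((pi * \<nu> * exp (- \<tau>)) / (pi * \<nu>))"
    using 3 4 by (subst has_bochner_integral_cong_AE[where g = "\<lambda>t. Im (\<integral>y. f (t, y) \<partial>lpos) / (pi * \<nu>)"])
       (auto intro!: AE_lposI dest: borel_measurable_integrable)
  then show ?thesis using nu by simp
qed

text \<open>Self-similarity reduces this to \<open>s = 1\<close>: rescaling \<open>t\<close> by
  \<open>s\<close> amounts to rescaling \<open>\<tau>\<close> by
  \<open>s powr \<nu>\<close>.\<close>

lemma laplace_M_Wright_time:
  assumes \<tau>: "0 < \<tau>" and s: "0 < s"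
  shows "has_bochner_integral lpos (\<lambda>t. exp (- (s * t)) * M_Wright_time \<nu> \<tau> t)
    (s powr (\<nu> - 1) * exp (- (s powr \<nu> * \<tau>)))"
proof -
  define f where "f = (\<lambda>t. exp (- t) * M_Wright_time \<nu> (\<tau> * s powr \<nu>) t)"
  have [measurable]: "f \<in> borel_measurable borel" by (simp add: f_def)
  have "has_bochner_integral lpos f (exp (- (\<tau> * s powr \<nu>)))"
    unfolding f_def by (rule laplace_M_Wright_time_1) (use \<tau> s in simp)
  then have "has_bochner_integral lpos (\<lambda>t. s *\<^sub>R f (s * t)) (exp (- (\<tau> * s powr \<nu>)))"
    using s by (subst has_bochner_integral_lpos_scale) auto
  then have "has_bochner_integral lpos (\<lambda>t. s powr (\<nu> - 1) * (s *\<^sub>R f (s * t))) (s powr (\<nu> - 1) * exp (- (\<tau> * s powr \<nu>)))"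
    by (rule has_bochner_integral_mult_right)
  moreover have "s powr (\<nu> - 1) * (s *\<^sub>R f (s * t)) = exp (- (s * t)) * M_Wright_time \<nu> \<tau> t" if t: "0 < t" for t
  proof -
    have "s powr (\<nu> - 1) * s powr 1 * (s * t) powr (- \<nu>) = t powr (- \<nu>)"
      unfolding powr_add[symmetric] using s t by (simp add: powr_mult powr_minus)
    moreover have "\<tau> * s powr \<nu> / (s * t) powr \<nu> = \<tau> / t powr \<nu>"
      using s t by (simp add: powr_mult)
    ultimately show ?thesis
      using s by (simp add: f_def M_Wright_time_def)
  qed
  ultimately show ?thesis
    by (subst has_bochner_integral_cong_AE[where g = "\<lambda>t. s powr (\<nu> - 1) * (s *\<^sub>R f (s * t))"])
       (auto intro!: AE_lposI simp: mult.commute)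
qed

lemma has_bochner_integral_M_Wright_time_scale:
  fixes f :: "real \<Rightarrow> 'a::euclidean_space"
  assumes t: "0 < t" and [measurable]: "f \<in> borel_measurable borel"
  shows "has_bochner_integral lpos (\<lambda>x. M_Wright \<nu> x *\<^sub>R f (t powr \<nu> * x)) I \<longleftrightarrow>
    has_bochner_integral lpos (\<lambda>\<tau>. M_Wright_time \<nu> \<tau> t *\<^sub>R f \<tau>) I"
proof -
  have tn: "0 < t powr \<nu>" using t by simp
  have eq: "t powr \<nu> *\<^sub>R (M_Wright_time \<nu> (t powr \<nu> * x) t *\<^sub>R f (t powr \<nu> * x)) = M_Wright \<nu> x *\<^sub>R f (t powr \<nu> * x)" for x
    using t by (simp add: M_Wright_time_def powr_minus)
  have m: "(\<lambda>\<tau>. M_Wright_time \<nu> \<tau> t *\<^sub>R f \<tau>) \<in> borel_measurable borel"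
    by measurable
  show ?thesis
    using has_bochner_integral_lpos_scale[OF m tn, of I, unfolded eq] .
qed

lemma integrable_M_Wright_time:
  assumes t: "0 < t"
  shows "integrable lpos (\<lambda>\<tau>. M_Wright_time \<nu> \<tau> t)"
    and "(\<integral>\<tau>. \<bar>M_Wright_time \<nu> \<tau> t\<bar> \<partial>lpos) = (\<integral>x. \<bar>M_Wright \<nu> x\<bar> \<partial>lpos)"
proof -
  have tn: "0 < t powr \<nu>" using t by simp
  have eq: "M_Wright_time \<nu> \<tau> t = t powr (- \<nu>) * M_Wright \<nu> (t powr (- \<nu>) * \<tau>)" for \<tau>
    by (simp add: M_Wright_time_def powr_minus divide_inverse mult.commute)
  show 1: "integrable lpos (\<lambda>\<tau>. M_Wright_time \<nu> \<tau> t)"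
    unfolding eq using t integrable_M_Wright
    by (intro integrable_mult_right) (subst integral_lpos_scale(2), auto)
  show "(\<integral>\<tau>. \<bar>M_Wright_time \<nu> \<tau> t\<bar> \<partial>lpos) = (\<integral>x. \<bar>M_Wright \<nu> x\<bar> \<partial>lpos)"
    using integral_lpos_scale(1)[of "\<lambda>x. \<bar>M_Wright \<nu> x\<bar>" "t powr (- \<nu>)"] t
    unfolding eq by (simp add: abs_mult)
qed

lemma laplace_M_Wright_transform:
  fixes G :: "real \<Rightarrow> complex"
  assumes [measurable]: "G \<in> borel_measurable borel" and bound: "\<And>\<tau>. 0 < \<tau> \<Longrightarrow> norm (G \<tau>) \<le> B"
    and V: "\<And>r. 0 < r \<Longrightarrow> has_bochner_integral lpos (\<lambda>\<tau>. exp (- (r * \<tau>)) * G \<tau>) (V r)"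
    and s: "0 < s"
  shows "has_bochner_integral lpos (\<lambda>t. exp (- (s * t)) * (\<integral>\<tau>. M_Wright_time \<nu> \<tau> t *\<^sub>R G \<tau> \<partial>lpos))
    (of_real (s powr (\<nu> - 1)) * V (s powr \<nu>))"
proof -
  define f where "f = (\<lambda>(t, \<tau>). exp (- (s * t)) *\<^sub>R (M_Wright_time \<nu> \<tau> t *\<^sub>R G \<tau>))"
  have fm: "f \<in> borel_measurable (lpos \<Otimes>\<^sub>M lpos)"
    unfolding f_def by measurable
  have fi: "integrable (lpos \<Otimes>\<^sub>M lpos) f"
  proof (rule lpos_pair_integrable[OF fm, where g = "\<lambda>t. exp (- (s * t))" and h = "\<lambda>t \<tau>. B * \<bar>M_Wright_time \<nu> \<tau> t\<bar>"])
    show "norm (f (t, \<tau>)) \<le> exp (- (s * t)) * (B * \<bar>M_Wright_time \<nu> \<tau> t\<bar>)" if "0 < t" "0 < \<tau>" for t \<tau>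
      using mult_left_mono[OF mult_right_mono[OF bound[OF that(2)], of "\<bar>M_Wright_time \<nu> \<tau> t\<bar>"], of "exp (- (s * t))"]
      by (simp add: f_def abs_mult mult_ac)
    show "(\<integral>\<tau>. B * \<bar>M_Wright_time \<nu> \<tau> t\<bar> \<partial>lpos) \<le> B * (\<integral>x. \<bar>M_Wright \<nu> x\<bar> \<partial>lpos)" if "0 < t" for t
      using integrable_M_Wright_time[OF that] by simp
    show "integrable lpos (\<lambda>\<tau>. B * \<bar>M_Wright_time \<nu> \<tau> t\<bar>)" if "0 < t" for t
      using integrable_M_Wright_time(1)[OF that] by simp
    show "integrable lpos (\<lambda>t. exp (- (s * t)))"
      by (rule integrable.intros[OF has_bochner_integral_exp(1)[OF s]])
  qed simp_all
  have "(\<integral>t. f (t, \<tau>) \<partial>lpos) = s powr (\<nu> - 1) *\<^sub>R (exp (- (s powr \<nu> * \<tau>)) * G \<tau>)" if "0 < \<tau>" for \<tau>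
  proof -
    have "has_bochner_integral lpos (\<lambda>t. (exp (- (s * t)) * M_Wright_time \<nu> \<tau> t) *\<^sub>R G \<tau>)
      ((s powr (\<nu> - 1) * exp (- (s powr \<nu> * \<tau>))) *\<^sub>R G \<tau>)"
      by (rule has_bochner_integral_scaleR_left) (rule laplace_M_Wright_time[OF that s])
    then have "has_bochner_integral lpos (\<lambda>t. f (t, \<tau>)) (s powr (\<nu> - 1) *\<^sub>R (exp (- (s powr \<nu> * \<tau>)) * G \<tau>))"
      by (simp add: f_def scaleR_conv_of_real mult.assoc)
    then show ?thesis by (rule has_bochner_integral_integral_eq)
  qed
  then have "(\<integral>\<tau>. (\<integral>t. f (t, \<tau>) \<partial>lpos) \<partial>lpos) = (\<integral>\<tau>. s powr (\<nu> - 1) *\<^sub>R (exp (- (s powr \<nu> * \<tau>)) * G \<tau>) \<partial>lpos)"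
    using fm by (intro integral_cong_AE) (auto intro!: AE_lposI simp: f_def)
  also have "\<dots> = of_real (s powr (\<nu> - 1)) * V (s powr \<nu>)"
    using V[of "s powr \<nu>"] s by (simp add: has_bochner_integral_iff scaleR_conv_of_real)
  finally have "(\<integral>t. (\<integral>\<tau>. f (t, \<tau>) \<partial>lpos) \<partial>lpos) = of_real (s powr (\<nu> - 1)) * V (s powr \<nu>)"
    using lpos_pair.Fubini_integral[of "\<lambda>t \<tau>. f (t, \<tau>)"] fi by simp
  moreover have "integrable lpos (\<lambda>t. \<integral>\<tau>. f (t, \<tau>) \<partial>lpos)"
    using lpos_pair.integrable_fst'[OF fi] .
  ultimately show ?thesis
    by (simp add: has_bochner_integral_iff f_def scaleR_conv_of_real)
qed

end

section \<open>Mixtures of measures with signed weights\<close>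

lemma char_zero_finite:
  assumes "finite_borel_measure M"
  shows "char M 0 = of_real (measure M UNIV)"
proof -
  interpret finite_borel_measure M by fact
  have "space M = UNIV" using sets_eq_imp_space_eq[OF M_is_borel] by simp
  then show ?thesis by (simp add: char_def scaleR_conv_of_real)
qed

text \<open>The value of \<open>char\<close> at 0 is the total mass, so equal characteristic
  functions imply equal masses. Dividing by a positive mass reduces to Levy's theorem for
  probability laws; mass 0 is treated apart.\<close>

lemma finite_measure_char_unique:
  assumes M: "finite_borel_measure M" and N: "finite_borel_measure N" and eq: "char M = char N"
  shows "M = N"
proof -
  interpret M: finite_borel_measure M by fact
  interpret N: finite_borel_measure N by fact
  define m where "m = measure M UNIV"
  have m_eq: "measure N UNIV = m"
    using char_zero_finite[OF M] char_zero_finite[OF N] eq by (simp add: m_def)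
  have eM: "emeasure M UNIV = ennreal m" and eN: "emeasure N UNIV = ennreal m"
    using m_eq by (simp_all add: m_def M.emeasure_eq_measure N.emeasure_eq_measure)
  show ?thesis
  proof (cases "m = 0")
    case True
    show ?thesis
    proof (rule measure_eqI)
      fix A assume "A \<in> sets M"
      have "emeasure M A \<le> emeasure M UNIV" by (rule emeasure_mono) auto
      moreover have "emeasure N A \<le> emeasure N UNIV" by (rule emeasure_mono) auto
      ultimately show "emeasure M A = emeasure N A"
        using True eM eN by simp
    qed (simp add: M.M_is_borel N.M_is_borel)
  next
    case False
    then have m: "0 < m" unfolding m_def by (simp add: less_le)
    define S where "S = (\<lambda>Q :: real measure. density Q (\<lambda>_. ennreal (1 / m)))"
    have real_S: "real_distribution (S Q)" and char_S: "char (S Q) \<kappa> = char Q \<kappa> / of_real m"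
      if Q: "finite_borel_measure Q" "emeasure Q UNIV = ennreal m" for Q \<kappa>
    proof -
      interpret Q: finite_borel_measure Q by fact
      have [measurable_cong]: "sets Q = sets borel" by (rule Q.M_is_borel)
      have "emeasure (S Q) (space (S Q)) = 1"
        using Q(2) m sets_eq_imp_space_eq[OF Q.M_is_borel] Q.M_is_borel
        by (simp add: S_def emeasure_density nn_integral_cmult ennreal_mult[symmetric])
      then show "real_distribution (S Q)"
        by (intro real_distribution.intro prob_spaceI real_distribution_axioms.intro) (simp_all add: S_def Q.M_is_borel)
      have "char (S Q) \<kappa> = (\<integral>x. (1 / m) *\<^sub>R iexp (\<kappa> * x) \<partial>Q)"
        unfolding char_def S_def using m by (subst integral_density) auto
      then show "char (S Q) \<kappa> = char Q \<kappa> / of_real m"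
        by (simp add: char_def scaleR_conv_of_real)
    qed
    have "S M = S N"
      using real_S[OF M eM] real_S[OF N eN] char_S[OF M eM] char_S[OF N eN] eq
      by (intro Levy_uniqueness) auto
    have scaled: "emeasure Q A = ennreal m * emeasure (S Q) A"
      if "A \<in> sets Q" for Q :: "real measure" and A
    proof -
      have "ennreal m * ennreal (1 / m) = 1"
        using m by (simp add: ennreal_mult[symmetric])
      then show ?thesis
        using that by (simp add: S_def emeasure_density nn_integral_cmult mult.assoc[symmetric])
    qed
    show ?thesis
    proof (rule measure_eqI)
      fix A assume "A \<in> sets M"
      then have "A \<in> sets N" by (simp add: M.M_is_borel N.M_is_borel)
      then show "emeasure M A = emeasure N A"
        using scaled[of A M] scaled[of A N] \<open>A \<in> sets M\<close> \<open>S M = S N\<close> by (simp only:)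
    qed (simp add: M.M_is_borel N.M_is_borel)
  qed
qed

text \<open>A probability density on the half-line that the kernel does not occupy. In a mixture it
  will carry exactly one copy of \<open>K\<close>.\<close>

lemma has_bochner_integral_exp_nonpos:
  "has_bochner_integral lborel (\<lambda>x::real. indicator {..0} x * exp x) 1"
proof -
  have "has_bochner_integral lpos (\<lambda>x. exp (- (1 * x))) (1 / 1 :: real)"
    by (rule has_bochner_integral_exp) simp
  then have "has_bochner_integral lborel (\<lambda>x. indicator {0<..} x *\<^sub>R exp (- (1 * x))) (1 :: real)"
    by (subst (asm) has_bochner_integral_lpos_iff) auto
  then have "has_bochner_integral lborel (\<lambda>x. indicator {..0} (- x) *\<^sub>R exp (- x)) (1 :: real)"
    by (subst has_bochner_integral_cong_AE[where g = "\<lambda>x. indicator {0<..} x *\<^sub>R exp (- (1 * x))"])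
       (use AE_lborel_singleton[of "0::real"] in \<open>auto simp: indicator_def elim!: eventually_mono\<close>)
  then show ?thesis
    using lborel_has_bochner_integral_real_affine_iff[of "-1" "\<lambda>x::real. indicator {..0} x * exp x" 1 0] by simp
qed

text \<open>
  A mixture of the laws \<open>c \<tau> Y\<close>, \<open>Y \<sim> L\<close>, over \<open>\<tau> > 0\<close>, to which the weight of the nonpositive
  half-line adds a multiple of \<open>K\<close>.  Moving the negative part of a signed weight to the
  other side of an equation thus needs no sums of measures.
\<close>

definition mixture :: "(real \<Rightarrow> real) \<Rightarrow> (real \<Rightarrow> real) \<Rightarrow> real measure \<Rightarrow> real measure \<Rightarrow> real measure" where
  "mixture d c L K = distr (density lborel (\<lambda>\<tau>. ennreal (d \<tau>)) \<Otimes>\<^sub>M (L \<Otimes>\<^sub>M K)) borel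
    (\<lambda>(\<tau>, y, z). if 0 < \<tau> then c \<tau> * y else z)"

text \<open>A mixture is the image of the product of \<open>d \<tau> d\<tau>\<close>,
  \<open>L\<close> and \<open>K\<close> under a map that reads either \<open>y\<close> or
  \<open>z\<close>, according to the sign of \<open>\<tau>\<close>. By Fubini the coordinate that is
  not read contributes its total mass 1.\<close>

lemma mixture_integral:
  fixes f :: "real \<Rightarrow> 'a::{banach, second_countable_topology}"
  assumes L: "real_distribution L" and K: "real_distribution K"
    and c [measurable]: "c \<in> borel_measurable borel"
    and d: "integrable lborel d" "\<And>\<tau>. 0 \<le> d \<tau>"
    and f [measurable]: "f \<in> borel_measurable borel" and B: "\<And>x. norm (f x) \<le> B"
  shows "finite_borel_measure (mixture d c L K)"
    and "has_bochner_integral lborel (\<lambda>\<tau>. d \<tau> *\<^sub>R (if 0 < \<tau> then \<integral>y. f (c \<tau> * y) \<partial>L else \<integral>z. f z \<partial>K))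
      (\<integral>x. f x \<partial>mixture d c L K)"
proof -
  interpret L: real_distribution L by fact
  interpret K: real_distribution K by fact
  interpret LK: pair_prob_space L K ..
  define \<Omega> where "\<Omega> = L \<Otimes>\<^sub>M K"
  define S where "S = density lborel (\<lambda>\<tau>. ennreal (d \<tau>))"
  define X where "X = (\<lambda>(\<tau>::real, y, z). if 0 < \<tau> then c \<tau> * y else z)"
  have [measurable]: "d \<in> borel_measurable borel"
    using d(1) by (auto dest: borel_measurable_integrable)
  have S_sets [measurable_cong]: "sets S = sets borel" by (simp add: S_def)
  have O_sets [measurable_cong]: "sets \<Omega> = sets (borel \<Otimes>\<^sub>M borel)"
    unfolding \<Omega>_def by (intro sets_pair_measure_cong) auto
  have fS: "finite_measure S"
  proof (rule finite_measureI)
    have "emeasure S (space S) = (\<integral>\<^sup>+\<tau>. ennreal (d \<tau>) \<partial>lborel)"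
      by (simp add: S_def emeasure_density)
    also have "\<dots> = ennreal (\<integral>\<tau>. d \<tau> \<partial>lborel)"
      using d by (intro nn_integral_eq_integral) auto
    finally show "emeasure S (space S) \<noteq> \<infinity>" by simp
  qed
  interpret S: finite_measure S by (rule fS)
  interpret O: prob_space \<Omega> unfolding \<Omega>_def by (rule LK.prob_space_axioms)
  interpret SO: pair_sigma_finite S \<Omega> ..
  interpret F: finite_measure "S \<Otimes>\<^sub>M \<Omega>"
    by (rule finite_measure_pair_measure) unfold_locales
  have X [measurable]: "X \<in> borel_measurable (S \<Otimes>\<^sub>M \<Omega>)"
    unfolding X_def by measurable
  have mix: "mixture d c L K = distr (S \<Otimes>\<^sub>M \<Omega>) borel X"
    by (simp add: mixture_def S_def \<Omega>_def X_def)
  show "finite_borel_measure (mixture d c L K)"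
    unfolding mix
    by (intro finite_borel_measure.intro F.finite_measure_distr finite_borel_measure_axioms.intro) auto
  have int: "integrable (S \<Otimes>\<^sub>M \<Omega>) (\<lambda>x. f (X x))"
    using B by (intro F.integrable_const_bound[where B = B]) auto
  have inner: "(\<integral>\<omega>. f (X (\<tau>, \<omega>)) \<partial>\<Omega>) = (if 0 < \<tau> then \<integral>y. f (c \<tau> * y) \<partial>L else \<integral>z. f z \<partial>K)" for \<tau>
  proof -
    have "integrable \<Omega> (\<lambda>(y, z). f (X (\<tau>, y, z)))"
      using B by (intro O.integrable_const_bound[where B = B]) (auto simp: X_def)
    then have "(\<integral>\<omega>. f (X (\<tau>, \<omega>)) \<partial>\<Omega>) = (\<integral>y. (\<integral>z. f (X (\<tau>, y, z)) \<partial>K) \<partial>L)"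
      unfolding \<Omega>_def using LK.integral_fst'[of "\<lambda>\<omega>. f (X (\<tau>, \<omega>))"] by (simp add: case_prod_beta')
    then show ?thesis
      using L.prob_space K.prob_space by (simp add: X_def)
  qed
  have "(\<integral>x. f x \<partial>mixture d c L K) = (\<integral>x. f (X x) \<partial>(S \<Otimes>\<^sub>M \<Omega>))"
    unfolding mix by (rule integral_distr) auto
  also have "\<dots> = (\<integral>\<tau>. (\<integral>\<omega>. f (X (\<tau>, \<omega>)) \<partial>\<Omega>) \<partial>S)"
    by (rule SO.integral_fst'[OF int, symmetric])
  finally have "has_bochner_integral S (\<lambda>\<tau>. \<integral>\<omega>. f (X (\<tau>, \<omega>)) \<partial>\<Omega>) (\<integral>x. f x \<partial>mixture d c L K)"
    using SO.integrable_fst'[OF int] by (simp add: has_bochner_integral_iff)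
  moreover have "(\<lambda>\<tau>. if 0 < \<tau> then \<integral>y. f (c \<tau> * y) \<partial>L else \<integral>z. f z \<partial>K) \<in> borel_measurable lborel"
    by measurable
  ultimately show "has_bochner_integral lborel (\<lambda>\<tau>. d \<tau> *\<^sub>R (if 0 < \<tau> then \<integral>y. f (c \<tau> * y) \<partial>L else \<integral>z. f z \<partial>K))
      (\<integral>x. f x \<partial>mixture d c L K)"
    unfolding inner S_def using d
    by (simp add: has_bochner_integral_iff integrable_density integral_density)
qed

text \<open>Write \<open>m\<close> as \<open>\<bar>m\<bar>\<close> minus the nonnegative
  \<open>\<bar>m\<bar> - m\<close>, and let \<open>R1\<close> and \<open>R2\<close> be the mixtures
  with these two weights, one copy of \<open>K\<close> being added to \<open>R2\<close>. The
  hypothesis says that the positive measures \<open>R1\<close> and \<open>R2\<close> have the same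
  characteristic function. They are therefore equal, and undoing the splitting at \<open>A\<close>
  gives the claim.\<close>

lemma mixture_char_unique:
  fixes m c :: "real \<Rightarrow> real"
  assumes L: "real_distribution L" and K: "real_distribution K"
    and c [measurable]: "c \<in> borel_measurable borel"
    and m: "integrable lpos m"
    and eq: "\<And>\<kappa>. has_bochner_integral lpos (\<lambda>\<tau>. m \<tau> *\<^sub>R char (dilate (c \<tau>) L) \<kappa>) (char K \<kappa>)"
    and A [measurable]: "A \<in> sets borel"
  shows "has_bochner_integral lpos (\<lambda>\<tau>. m \<tau> * measure (dilate (c \<tau>) L) A) (measure K A)"
proof -
  interpret L: real_distribution L by fact
  interpret K: real_distribution K by fact
  have mm [measurable]: "m \<in> borel_measurable borel"
    using m by (auto dest: borel_measurable_integrable)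
  have mi: "integrable lborel (\<lambda>\<tau>. indicator {0<..} \<tau> *\<^sub>R m \<tau>)"
    using has_bochner_integral_lpos_iff[OF mm, THEN iffD1, OF has_bochner_integral_integrable[OF m]]
    by (simp add: has_bochner_integral_iff)
  define d1 where "d1 = (\<lambda>\<tau>. \<bar>indicator {0<..} \<tau> *\<^sub>R m \<tau>\<bar>)"
  define d2 where "d2 = (\<lambda>\<tau>. \<bar>indicator {0<..} \<tau> *\<^sub>R m \<tau>\<bar> - indicator {0<..} \<tau> *\<^sub>R m \<tau> + indicator {..0} \<tau> * exp \<tau>)"
  have d1: "integrable lborel d1" "0 \<le> d1 \<tau>" for \<tau>
    unfolding d1_def using mi by auto
  have d2: "integrable lborel d2" "0 \<le> d2 \<tau>" for \<tau>
    unfolding d2_def using mi has_bochner_integral_exp_nonpos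
    by (auto simp: has_bochner_integral_iff simp del: real_scaleR_def)
  define R1 where "R1 = mixture d1 c L K"
  define R2 where "R2 = mixture d2 c L K"
  \<comment> \<open>The value space is left general because this is applied twice: to the complex
    \<open>iexp\<close>, in order to compare characteristic functions, and to the real indicator of
    \<open>A\<close>.\<close>
  have key: "has_bochner_integral lpos (\<lambda>\<tau>. m \<tau> *\<^sub>R (\<integral>y. f (c \<tau> * y) \<partial>L))
      ((\<integral>x. f x \<partial>R1) - (\<integral>x. f x \<partial>R2) + (\<integral>x. f x \<partial>K))"
    if f [measurable]: "f \<in> borel_measurable borel" and B: "\<And>x. norm (f x) \<le> B"
    for f :: "real \<Rightarrow> 'b::{banach, second_countable_topology}" and B
  proof -
    define G where "G = (\<lambda>\<tau>. if 0 < \<tau> then \<integral>y. f (c \<tau> * y) \<partial>L else \<integral>z. f z \<partial>K)"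
    have "has_bochner_integral lborel (\<lambda>\<tau>. d1 \<tau> *\<^sub>R G \<tau> - d2 \<tau> *\<^sub>R G \<tau> + (indicator {..0} \<tau> * exp \<tau>) *\<^sub>R (\<integral>x. f x \<partial>K))
       ((\<integral>x. f x \<partial>R1) - (\<integral>x. f x \<partial>R2) + 1 *\<^sub>R (\<integral>x. f x \<partial>K))"
      unfolding R1_def R2_def G_def
      by (intro has_bochner_integral_add has_bochner_integral_diff has_bochner_integral_scaleR_left
          mixture_integral(2)[OF L K c d1 f B] mixture_integral(2)[OF L K c d2 f B] has_bochner_integral_exp_nonpos)
    also have "(\<lambda>\<tau>. d1 \<tau> *\<^sub>R G \<tau> - d2 \<tau> *\<^sub>R G \<tau> + (indicator {..0} \<tau> * exp \<tau>) *\<^sub>R (\<integral>x. f x \<partial>K)) =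
        (\<lambda>\<tau>. indicator {0<..} \<tau> *\<^sub>R (m \<tau> *\<^sub>R (\<integral>y. f (c \<tau> * y) \<partial>L)))"
    proof
      fix \<tau>
      show "d1 \<tau> *\<^sub>R G \<tau> - d2 \<tau> *\<^sub>R G \<tau> + (indicator {..0} \<tau> * exp \<tau>) *\<^sub>R (\<integral>x. f x \<partial>K) =
        indicator {0<..} \<tau> *\<^sub>R (m \<tau> *\<^sub>R (\<integral>y. f (c \<tau> * y) \<partial>L))"
        by (cases "0 < \<tau>") (simp_all add: d1_def d2_def G_def scaleR_left_diff_distrib[symmetric])
    qed
    finally show ?thesis
      by (subst has_bochner_integral_lpos_iff) simp_all
  qed
  have fin: "finite_borel_measure R1" "finite_borel_measure R2"
    unfolding R1_def R2_def
    using mixture_integral(1)[where f = "\<lambda>_. 0 :: real" and B = 0, OF L K c d1]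
      mixture_integral(1)[where f = "\<lambda>_. 0 :: real" and B = 0, OF L K c d2] by simp_all
  have dil: "(\<integral>x. f x \<partial>dilate r L) = (\<integral>y. f (r * y) \<partial>L)" if "f \<in> borel_measurable borel"
    for r and f :: "real \<Rightarrow> 'b::{banach, second_countable_topology}"
    unfolding dilate_def using that by (intro integral_distr) auto
  have "char R1 = char R2"
  proof
    fix \<kappa>
    have "has_bochner_integral lpos (\<lambda>\<tau>. m \<tau> *\<^sub>R (\<integral>y. iexp (\<kappa> * (c \<tau> * y)) \<partial>L))
      ((\<integral>x. iexp (\<kappa> * x) \<partial>R1) - (\<integral>x. iexp (\<kappa> * x) \<partial>R2) + (\<integral>x. iexp (\<kappa> * x) \<partial>K))"
      by (rule key[of "\<lambda>x. iexp (\<kappa> * x)" 1]) auto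
    moreover have "char (dilate r L) \<kappa> = (\<integral>y. iexp (\<kappa> * (r * y)) \<partial>L)" for r
      unfolding char_def by (rule dil) simp
    then have "has_bochner_integral lpos (\<lambda>\<tau>. m \<tau> *\<^sub>R (\<integral>y. iexp (\<kappa> * (c \<tau> * y)) \<partial>L)) (\<integral>x. iexp (\<kappa> * x) \<partial>K)"
      using eq[of \<kappa>] by (simp only: char_def)
    ultimately have "(\<integral>x. iexp (\<kappa> * x) \<partial>R1) - (\<integral>x. iexp (\<kappa> * x) \<partial>R2) + (\<integral>x. iexp (\<kappa> * x) \<partial>K) = (\<integral>x. iexp (\<kappa> * x) \<partial>K)"
      by (rule has_bochner_integral_eq)
    then show "char R1 \<kappa> = char R2 \<kappa>" by (simp add: char_def)
  qed
  then have R: "R1 = R2"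
    using fin by (intro finite_measure_char_unique)
  have "has_bochner_integral lpos (\<lambda>\<tau>. m \<tau> *\<^sub>R (\<integral>y. indicator A (c \<tau> * y) \<partial>L)) (\<integral>x. indicator A x \<partial>K :: real)"
    using key[of "indicator A :: real \<Rightarrow> real" 1] unfolding R by (simp add: indicator_def)
  moreover have "(\<integral>y. indicator A (r * y) \<partial>L) = measure (dilate r L) A" for r
  proof -
    have "A \<in> sets (dilate r L)" "space (dilate r L) = UNIV" by (simp_all add: dilate_def)
    then show ?thesis using dil[of "indicator A :: real \<Rightarrow> real" r] by simp
  qed
  ultimately show ?thesis by simp
qed

section \<open>Subordination of laws and densities\<close>

lemma sets_dilate [simp, measurable_cong]: "sets (dilate c M) = sets borel"
  by (simp add: dilate_def)

lemma space_dilate [simp]: "space (dilate c M) = UNIV"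
  by (simp add: dilate_def)

lemma real_distribution_dilate: "real_distribution M \<Longrightarrow> real_distribution (dilate c M)"
proof -
  assume "real_distribution M"
  then interpret real_distribution M .
  show ?thesis
    unfolding dilate_def
    by (intro real_distribution_distr) auto
qed

lemma char_dilate:
  assumes "finite_borel_measure M"
  shows "char (dilate c M) \<kappa> = char M (c * \<kappa>)"
proof -
  interpret finite_borel_measure M by fact
  have [measurable_cong]: "sets M = sets borel" by (rule M_is_borel)
  have "char (dilate c M) \<kappa> = (\<integral>x. iexp (\<kappa> * (c * x)) \<partial>M)"
    unfolding dilate_def char_def by (rule integral_distr) auto
  then show ?thesis
    by (simp add: char_def mult_ac)
qed

lemma measure_dilate:
  assumes "finite_borel_measure M" "A \<in> sets borel"
  shows "measure (dilate c M) A = measure M ((\<lambda>x. c * x) -` A)"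
proof -
  interpret finite_borel_measure M by fact
  have [measurable_cong]: "sets M = sets borel" by (rule M_is_borel)
  have "space M = UNIV" using sets_eq_imp_space_eq[OF M_is_borel] by simp
  then show ?thesis
    unfolding dilate_def using assms(2) by (subst measure_distr) auto
qed

lemma borel_measurable_char:
  assumes "real_distribution M"
  shows "char M \<in> borel_measurable borel"
proof -
  interpret real_distribution M by fact
  have "continuous_on UNIV (char M)"
    by (intro continuous_at_imp_continuous_on ballI isCont_char)
  then show ?thesis by (rule borel_measurable_continuous_onI)
qed

lemma feller_symbol_zero [simp]: "feller_symbol \<alpha> \<theta> 0 = 0"
  by (simp add: feller_symbol_def)

lemma Re_feller_symbol_nonneg:
  assumes "\<bar>\<theta>\<bar> \<le> 1"
  shows "0 \<le> Re (feller_symbol \<alpha> \<theta> \<kappa>)"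
proof -
  have "\<bar>sgn \<kappa> * \<theta> * pi / 2\<bar> = \<bar>sgn \<kappa>\<bar> * \<bar>\<theta>\<bar> * (pi / 2)"
    by (simp add: abs_mult)
  also have "\<dots> \<le> 1 * 1 * (pi / 2)"
    using assms by (intro mult_right_mono mult_mono) (auto simp: sgn_real_def)
  finally have "\<bar>sgn \<kappa> * \<theta> * pi / 2\<bar> \<le> pi / 2" by simp
  then have "0 \<le> cos (sgn \<kappa> * \<theta> * pi / 2)"
    unfolding abs_le_iff by (intro cos_ge_zero) linarith+
  then show ?thesis
    by (simp add: feller_symbol_def Re_exp)
qed

lemma feller_symbol_scale:
  assumes "0 < \<alpha>" "0 < \<tau>"
  shows "feller_symbol \<alpha> \<theta> (\<tau> powr (1 / \<alpha>) * \<kappa>) = of_real \<tau> * feller_symbol \<alpha> \<theta> \<kappa>"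
  using assms by (simp add: feller_symbol_def abs_mult powr_mult powr_powr sgn_mult)

lemma reduced_green_laplace:
  assumes "reduced_green \<alpha> \<beta> \<theta> K" and K: "real_distribution K" and "0 < s"
  shows "has_bochner_integral lpos (\<lambda>t. exp (- (s * t)) * char K (t powr (\<beta> / \<alpha>) * \<kappa>))
    (of_real (s powr (\<beta> - 1)) / (of_real (s powr \<beta>) + feller_symbol \<alpha> \<theta> \<kappa>))"
proof -
  have m [measurable]: "char K \<in> borel_measurable borel"
    using K by (rule borel_measurable_char)
  show ?thesis
    using assms char_dilate[of K] unfolding reduced_green_def
    by (subst has_bochner_integral_lpos_iff) (auto simp: mult.assoc)
qed

text \<open>At \<open>\<kappa> = 0\<close> and \<open>s = 1\<close> the symbol vanishes and the
  prescribed transform is 1, while the integral is the total mass of \<open>K\<close>.\<close>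

lemma reduced_green_real_distribution:
  assumes "reduced_green \<alpha> \<beta> \<theta> K"
  shows "real_distribution K"
proof -
  have K: "finite_borel_measure K" using assms by (simp add: reduced_green_def)
  interpret finite_borel_measure K by fact
  have sp: "space K = UNIV" using sets_eq_imp_space_eq[OF M_is_borel] by simp
  have "has_bochner_integral lborel
    (\<lambda>t. indicator {0<..} t *\<^sub>R (of_real (exp (- 1 * t)) * char (dilate (t powr (\<beta> / \<alpha>)) K) 0)) (1 / (1 + 0))"
    using assms[unfolded reduced_green_def, THEN conjunct2, rule_format, of 1 0] by simp
  then have "has_bochner_integral lborel (\<lambda>t. indicator {0<..} t *\<^sub>R (complex_of_real (exp (- (1 * t))) * of_real (measure K UNIV))) 1"
    by (simp add: char_dilate[OF K] char_zero_finite[OF K])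
  then have "has_bochner_integral lpos (\<lambda>t. complex_of_real (exp (- (1 * t))) * of_real (measure K UNIV)) 1"
    by (subst has_bochner_integral_lpos_iff) auto
  moreover have "has_bochner_integral lpos (\<lambda>t. complex_of_real (exp (- (1 * t))) * of_real (measure K UNIV)) (of_real (1 / 1) * of_real (measure K UNIV))"
    by (intro has_bochner_integral_mult_left has_bochner_integral_of_real has_bochner_integral_exp) simp
  ultimately have "1 = complex_of_real (1 / 1) * of_real (measure K UNIV)"
    by (rule has_bochner_integral_eq)
  then have "complex_of_real (measure K UNIV) = 1"
    by simp
  then have "measure K UNIV = 1"
    unfolding of_real_eq_1_iff .
  then show ?thesis
    using sp by (intro real_distribution.intro prob_spaceI real_distribution_axioms.intro)
      (simp_all add: emeasure_eq_measure M_is_borel)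
qed

text \<open>Homogeneity of the symbol turns the characteristic function at
  \<open>\<tau> powr (1 / \<alpha>) * \<kappa>\<close> into an exponential in \<open>\<tau>\<close>.
  The bound on \<theta> keeps the real part of the symbol nonnegative, so its transform exists for
  every \<open>r > 0\<close>.\<close>

lemma stable_law_laplace:
  assumes "stable_law \<alpha> \<theta> L" "0 < \<alpha>" "\<bar>\<theta>\<bar> \<le> 1" "0 < r"
  shows "has_bochner_integral lpos (\<lambda>\<tau>. exp (- (r * \<tau>)) * char L (\<tau> powr (1 / \<alpha>) * \<kappa>))
    (1 / (of_real r + feller_symbol \<alpha> \<theta> \<kappa>))"
proof -
  have m [measurable]: "char L \<in> borel_measurable borel"
    using assms by (auto simp: stable_law_def intro: borel_measurable_char)
  have "has_bochner_integral lpos (\<lambda>\<tau>. exp (- ((of_real r + feller_symbol \<alpha> \<theta> \<kappa>) * of_real \<tau>)))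
    (1 / (of_real r + feller_symbol \<alpha> \<theta> \<kappa>))"
    using Re_feller_symbol_nonneg[OF assms(3)] assms(4)
    by (intro has_bochner_integral_exp_complex) (simp add: add_pos_nonneg)
  moreover have "exp (- (r * \<tau>)) * char L (\<tau> powr (1 / \<alpha>) * \<kappa>) = exp (- ((of_real r + feller_symbol \<alpha> \<theta> \<kappa>) * of_real \<tau>))"
    if "0 < \<tau>" for \<tau>
  proof -
    have "char L (\<tau> powr (1 / \<alpha>) * \<kappa>) = exp (- (of_real \<tau> * feller_symbol \<alpha> \<theta> \<kappa>))"
      using assms that by (simp add: stable_law_def feller_symbol_scale)
    then show ?thesis
      by (simp add: exp_of_real[symmetric] exp_add[symmetric] algebra_simps)
  qed
  ultimately show ?thesis
    by (subst has_bochner_integral_cong_AE[where g = "\<lambda>\<tau>. exp (- ((of_real r + feller_symbol \<alpha> \<theta> \<kappa>) * of_real \<tau>))"])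
       (auto intro!: AE_lposI)
qed

lemma continuous_char_powr:
  assumes "real_distribution M"
  shows "continuous_on {0<..} (\<lambda>t. char M (t powr p * \<kappa>))"
proof -
  interpret real_distribution M by fact
  have "continuous_on UNIV (char M)"
    by (intro continuous_at_imp_continuous_on ballI isCont_char)
  then show ?thesis
    by (rule continuous_on_compose2) (auto intro!: continuous_intros)
qed

text \<open>This settles the order \<nu> = 1. Uniqueness in \<open>t\<close> is applied for each
  \<kappa> and then evaluated at \<open>t = 1\<close>.\<close>

lemma char_eq_of_laplace:
  assumes M: "real_distribution M" and N: "real_distribution N"
    and eq: "\<And>\<kappa> s. 0 < s \<Longrightarrow> has_bochner_integral lpos (\<lambda>t. exp (- (s * t)) * char M (t powr p * \<kappa>)) (V \<kappa> s)"
      "\<And>\<kappa> s. 0 < s \<Longrightarrow> has_bochner_integral lpos (\<lambda>t. exp (- (s * t)) * char N (t powr p * \<kappa>)) (V \<kappa> s)"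
  shows "M = N"
proof (rule Levy_uniqueness[OF M N], rule ext)
  fix \<kappa>
  note [measurable] = borel_measurable_char[OF M] borel_measurable_char[OF N]
  interpret M: real_distribution M by fact
  interpret N: real_distribution N by fact
  have "char M (1 powr p * \<kappa>) = char N (1 powr p * \<kappa>)"
    by (rule laplace_unique[where A = 1 and B = 1 and V = "V \<kappa>", OF continuous_char_powr[OF M] _ _ continuous_char_powr[OF N]])
      (use eq M.cmod_char_le_1 N.cmod_char_le_1 in auto)
  then show "char M \<kappa> = char N \<kappa>" by simp
qed

section \<open>Subordination of characteristic functions and of laws\<close>

context wright_order
begin

text \<open>For fixed \<kappa>, the characteristic function of the dilated \<open>K\<close> and the
  mixture \<open>H\<close> are bounded continuous functions of \<open>t\<close> with the same
  Laplace transform.\<close>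

lemma char_M_Wright_mixture:
  assumes L: "real_distribution L" and K: "real_distribution K"
    and VL: "\<And>r. 0 < r \<Longrightarrow> has_bochner_integral lpos (\<lambda>\<tau>. exp (- (r * \<tau>)) * char L (\<tau> powr p * \<kappa>)) (V r)"
    and VK: "\<And>s. 0 < s \<Longrightarrow> has_bochner_integral lpos (\<lambda>t. exp (- (s * t)) * char K (t powr q * \<kappa>)) (of_real (s powr (\<nu> - 1)) * V (s powr \<nu>))"
    and t: "0 < t"
  shows "has_bochner_integral lpos (\<lambda>\<tau>. M_Wright_time \<nu> \<tau> t *\<^sub>R char (dilate (\<tau> powr p) L) \<kappa>) (char (dilate (t powr q) K) \<kappa>)"
proof -
  interpret L: real_distribution L by fact
  interpret K: real_distribution K by fact
  note [measurable] = borel_measurable_char[OF L] borel_measurable_char[OF K]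
  define G where "G = (\<lambda>\<tau>. char L (\<tau> powr p * \<kappa>))"
  have [measurable]: "G \<in> borel_measurable borel" by (simp add: G_def)
  have G1: "norm (G \<tau>) \<le> 1" for \<tau> by (simp add: G_def L.cmod_char_le_1)
  define H where "H = (\<lambda>t. \<integral>\<tau>. M_Wright_time \<nu> \<tau> t *\<^sub>R G \<tau> \<partial>lpos)"
  have Hm: "H \<in> borel_measurable borel"
    unfolding H_def by measurable
  have intM: "integrable lpos (\<lambda>x. M_Wright \<nu> x *\<^sub>R G (t * x))" for t
  proof (rule integrable_lpos_bound)
    show "integrable lpos (\<lambda>x. \<bar>M_Wright \<nu> x\<bar>)" using integrable_M_Wright by simp
    show "norm (M_Wright \<nu> x *\<^sub>R G (t * x)) \<le> \<bar>M_Wright \<nu> x\<bar>" for x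
      using mult_left_mono[OF G1[of "t * x"], of "\<bar>M_Wright \<nu> x\<bar>"] by simp
  qed simp
  have intT: "has_bochner_integral lpos (\<lambda>\<tau>. M_Wright_time \<nu> \<tau> t *\<^sub>R G \<tau>) (\<integral>x. M_Wright \<nu> x *\<^sub>R G (t powr \<nu> * x) \<partial>lpos)"
    if "0 < t" for t
    by (rule has_bochner_integral_M_Wright_time_scale[OF that, THEN iffD1])
       (simp, rule has_bochner_integral_integrable, rule intM)
  \<comment> \<open>In this form the dependence on \<open>t\<close> has moved from the kernel into
    \<open>G\<close>. The majorant \<open>\<bar>M_Wright \<nu> x\<bar>\<close> serves all
    \<open>t\<close> at once and yields both the continuity and the bound of
    \<open>H\<close>.\<close>
  then have H_eq: "H t = (\<integral>x. M_Wright \<nu> x *\<^sub>R G (t powr \<nu> * x) \<partial>lpos)" if "0 < t" for t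
    unfolding H_def using that by (auto dest: has_bochner_integral_integral_eq)
  have bound: "norm (M_Wright \<nu> x *\<^sub>R G y) \<le> \<bar>M_Wright \<nu> x\<bar>" for x y
    using mult_left_mono[OF G1[of y], of "\<bar>M_Wright \<nu> x\<bar>"] by simp
  have Hc: "continuous_on {0<..} H"
  proof -
    have "continuous_on {0<..} (\<lambda>t. \<integral>x. M_Wright \<nu> x *\<^sub>R G (t powr \<nu> * x) \<partial>lpos)"
    proof (rule continuous_on_lpos_integral[OF _ _ bound])
      fix x :: real assume x: "0 < x"
      have "continuous_on {0<..} G"
        unfolding G_def by (rule continuous_char_powr[OF L])
      then have "continuous_on {0<..} (\<lambda>t. G (t powr \<nu> * x))"
        by (rule continuous_on_compose2) (use x in \<open>auto intro!: continuous_intros\<close>)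
      then show "continuous_on {0<..} (\<lambda>t. M_Wright \<nu> x *\<^sub>R G (t powr \<nu> * x))"
        by (intro continuous_intros)
    qed (use integrable_M_Wright in auto)
    then show ?thesis by (rule continuous_on_eq) (simp add: H_eq)
  qed
  have "char K (t powr q * \<kappa>) = H t"
  proof (rule laplace_unique[where A = 1 and B = "\<integral>x. \<bar>M_Wright \<nu> x\<bar> \<partial>lpos", OF continuous_char_powr[OF K] _ _ Hc Hm _ VK _ t])
    show "norm (H t) \<le> (\<integral>x. \<bar>M_Wright \<nu> x\<bar> \<partial>lpos)" if "0 < t" for t
      unfolding H_eq[OF that] using integrable_M_Wright bound by (intro integral_norm_bound_lpos) auto
    show "has_bochner_integral lpos (\<lambda>t. exp (- (s * t)) * H t) (of_real (s powr (\<nu> - 1)) * V (s powr \<nu>))" if "0 < s" for s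
      unfolding H_def using VL that G1 by (intro laplace_M_Wright_transform[where B = 1]) (auto simp: G_def)
  qed (simp_all add: K.cmod_char_le_1)
  then show ?thesis
    using intT[OF t] H_eq[OF t] by (simp add: char_dilate L.finite_borel_measure_axioms K.finite_borel_measure_axioms G_def)
qed

lemma measure_M_Wright_mixture:
  assumes L: "real_distribution L" and K: "real_distribution K"
    and VL: "\<And>\<kappa> r. 0 < r \<Longrightarrow> has_bochner_integral lpos (\<lambda>\<tau>. exp (- (r * \<tau>)) * char L (\<tau> powr p * \<kappa>)) (V \<kappa> r)"
    and VK: "\<And>\<kappa> s. 0 < s \<Longrightarrow> has_bochner_integral lpos (\<lambda>t. exp (- (s * t)) * char K (t powr q * \<kappa>)) (of_real (s powr (\<nu> - 1)) * V \<kappa> (s powr \<nu>))"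
    and t: "0 < t" and A: "A \<in> sets borel"
  shows "has_bochner_integral lpos (\<lambda>\<tau>. M_Wright_time \<nu> \<tau> t * measure (dilate (\<tau> powr p) L) A) (measure (dilate (t powr q) K) A)"
  using char_M_Wright_mixture[OF L K VL VK t] integrable_M_Wright_time(1)[OF t] A
  by (intro mixture_char_unique[OF L real_distribution_dilate[OF K]]) auto

end

section \<open>Uniqueness, dilation and mixture of densities\<close>

lemma continuous_density_unique:
  fixes f :: "real \<Rightarrow> real"
  assumes cont: "continuous_on {0<..} f"
    and zero: "\<And>A. A \<in> sets borel \<Longrightarrow> A \<subseteq> {0<..} \<Longrightarrow> has_bochner_integral lborel (\<lambda>x. indicator A x *\<^sub>R f x) 0"
    and x: "0 < x"
  shows "f x = 0"
proof -
  define g where "g = (\<lambda>x. indicator {0<..} x *\<^sub>R f x)"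
  have "integrable lborel g"
    using zero[of "{0<..}"] by (auto simp: has_bochner_integral_iff g_def)
  then have [measurable]: "g \<in> borel_measurable borel"
    by (auto dest: borel_measurable_integrable)
  \<comment> \<open>Integration over the set where \<open>s * g\<close> is positive shows that this
    set is null. The cases \<open>s = 1\<close> and \<open>s = -1\<close> then bound
    \<open>g\<close> from both sides.\<close>
  have AE: "AE x in lborel. s * g x \<le> 0" for s
  proof -
    define A where "A = {x \<in> space borel. 0 < s * g x}"
    have A: "A \<in> sets borel" "A \<subseteq> {0<..}"
      unfolding A_def by measurable (auto simp: g_def indicator_def split: if_splits)
    have "indicator A x *\<^sub>R f x = indicator A x * g x" for x
      using A(2) by (auto simp: g_def indicator_def)
    then have "has_bochner_integral lborel (\<lambda>x. indicator A x * g x) 0"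
      using zero[OF A] by (simp only:)
    then have "has_bochner_integral lborel (\<lambda>x. s * (indicator A x * g x)) (s * 0)"
      by (rule has_bochner_integral_mult_right)
    then have "AE x in lborel. s * (indicator A x * g x) = 0"
      by (subst integral_nonneg_eq_0_iff_AE[symmetric])
         (auto simp: has_bochner_integral_iff A_def indicator_def)
    then show ?thesis
      by eventually_elim (auto simp: A_def indicator_def split: if_splits)
  qed
  have "AE x in lpos. f x = 0"
    using AE[of 1] AE[of "-1"] unfolding AE_lpos by eventually_elim (auto simp: g_def)
  then show ?thesis by (rule continuous_AE_lpos_zero[OF cont _ x])
qed

lemma pos_density_unique:
  assumes "pos_density M f" "pos_density M g" "0 < x"
  shows "f x = g x"
proof -
  have "f x - g x = 0"
  proof (rule continuous_density_unique[where f = "\<lambda>x. f x - g x", OF _ _ assms(3)])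
    show "continuous_on {0<..} (\<lambda>x. f x - g x)"
      using assms by (intro continuous_intros) (auto simp: pos_density_def)
    fix A :: "real set" assume "A \<in> sets borel" "A \<subseteq> {0<..}"
    then have "has_bochner_integral lborel (\<lambda>x. indicator A x *\<^sub>R f x) (measure M A)"
      "has_bochner_integral lborel (\<lambda>x. indicator A x *\<^sub>R g x) (measure M A)"
      using assms by (auto simp: pos_density_def)
    then have "has_bochner_integral lborel (\<lambda>x. indicator A x *\<^sub>R f x - indicator A x *\<^sub>R g x) (measure M A - measure M A)"
      by (rule has_bochner_integral_diff)
    then show "has_bochner_integral lborel (\<lambda>x. indicator A x *\<^sub>R (f x - g x)) 0"
      by (simp add: scaleR_right_diff_distrib del: real_scaleR_def)
  qed
  then show ?thesis by simp
qed

lemma pos_density_dilate: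
  assumes M: "finite_borel_measure M" and f: "pos_density M f" and c: "0 < c"
  shows "pos_density (dilate c M) (dilate_fun c f)"
  unfolding pos_density_def
proof (intro conjI ballI impI)
  have "continuous_on {0<..} f" using f by (simp add: pos_density_def)
  then have "continuous_on {0<..} (\<lambda>x. f (x / c))"
    by (rule continuous_on_compose2) (use c in \<open>auto intro!: continuous_intros\<close>)
  then show "continuous_on {0<..} (dilate_fun c f)"
    unfolding dilate_fun_def[abs_def] using c by (intro continuous_intros) auto
  fix A :: "real set" assume A: "A \<in> sets borel" "A \<subseteq> {0<..}"
  define B where "B = (\<lambda>x. c * x) -` A"
  have "(\<lambda>x. c * x) \<in> measurable borel borel" by simp
  from measurable_sets[OF this A(1)] have "B \<in> sets borel" by (simp add: B_def)
  moreover have "B \<subseteq> {0<..}" using A(2) c by (auto simp: B_def zero_less_mult_iff)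
  ultimately have "has_bochner_integral lborel (\<lambda>x. indicator B x *\<^sub>R f x) (measure M B)"
    using f by (simp add: pos_density_def)
  then have "has_bochner_integral lborel (\<lambda>x. indicator B (0 + (1 / c) * x) *\<^sub>R f (0 + (1 / c) * x)) (measure M B /\<^sub>R \<bar>1 / c\<bar>)"
    using c by (intro lborel_has_bochner_integral_real_affine_iff[THEN iffD1]) auto
  then have "has_bochner_integral lborel (\<lambda>x. (1 / c) *\<^sub>R (indicator B (0 + (1 / c) * x) *\<^sub>R f (0 + (1 / c) * x))) ((1 / c) *\<^sub>R (measure M B /\<^sub>R \<bar>1 / c\<bar>))"
    by (rule has_bochner_integral_scaleR_right)
  moreover have "(1 / c) *\<^sub>R (indicator B (0 + (1 / c) * x) *\<^sub>R f (0 + (1 / c) * x)) = indicator A x *\<^sub>R dilate_fun c f x" for x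
    using c by (auto simp: dilate_fun_def B_def indicator_def)
  ultimately show "has_bochner_integral lborel (\<lambda>x. indicator A x *\<^sub>R dilate_fun c f x) (measure (dilate c M) A)"
    using c measure_dilate[OF M A(1), of c] by (simp add: B_def)
qed

context wright_order
begin

text \<open>The product \<open>\<tau> * M_Wright_time \<nu> \<tau> t\<close> is what multiplies the
  density after the substitution in \<open>density_M_Wright_mixture\<close>. It equals
  \<open>z * M_Wright \<nu> z\<close> at the rescaled argument, so quadratic decay more than
  suffices.\<close>

lemma M_Wright_time_linear_bound:
  assumes t: "0 < t"
  obtains D where "\<And>\<tau>. 0 < \<tau> \<Longrightarrow> \<bar>\<tau> * M_Wright_time \<nu> \<tau> t\<bar> \<le> D"
proof -
  obtain C where C: "\<And>z. 0 \<le> z \<Longrightarrow> \<bar>M_Wright \<nu> z\<bar> \<le> C / (1 + z\<^sup>2)"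
    using M_Wright_bound by blast
  show ?thesis
  proof
    fix \<tau> :: real assume \<tau>: "0 < \<tau>"
    define z where "z = \<tau> / t powr \<nu>"
    have z: "0 \<le> z" using \<tau> t by (simp add: z_def)
    have C0: "0 \<le> C" using order.trans[OF abs_ge_zero C[of 0]] by simp
    have pos: "0 < 1 + z\<^sup>2" by (simp add: add_pos_nonneg)
    have "z \<le> 1 + z\<^sup>2"
      using sum_squares_bound[of z 1] z by simp
    have "\<tau> * M_Wright_time \<nu> \<tau> t = z * M_Wright \<nu> z"
      using t by (simp add: M_Wright_time_def z_def powr_minus field_simps)
    then have "\<bar>\<tau> * M_Wright_time \<nu> \<tau> t\<bar> = z * \<bar>M_Wright \<nu> z\<bar>"
      using z by (simp add: abs_mult)
    also have "\<dots> \<le> (1 + z\<^sup>2) * (C / (1 + z\<^sup>2))"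
      using \<open>z \<le> 1 + z\<^sup>2\<close> C[OF z] pos by (intro mult_mono) auto
    also have "\<dots> = C" using pos by simp
    finally show "\<bar>\<tau> * M_Wright_time \<nu> \<tau> t\<bar> \<le> C" .
  qed
qed

lemma continuous_on_M_Wright_time:
  assumes t: "0 < t"
  shows "continuous_on {0<..} (\<lambda>\<tau>. M_Wright_time \<nu> \<tau> t)"
proof -
  have "continuous_on {0<..} (\<lambda>\<tau>. M_Wright \<nu> (\<tau> / t powr \<nu>))"
    by (rule continuous_on_compose2[OF continuous_on_M_Wright]) (use t in \<open>auto intro!: continuous_intros\<close>)
  then show ?thesis
    unfolding M_Wright_time_def by (intro continuous_intros)
qed

text \<open>The mixed density \<open>\<phi>\<close> is shown to be a continuous density of
  \<open>Q\<close> on the positive half-line: Fubini gives its integral over each \<open>A\<close>,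
  and uniqueness of continuous densities gives \<open>\<phi> = k\<close>. The difficulty is
  continuity, and even existence, at every single \<open>x\<close>, since \<open>l\<close> is merely
  continuous and integrable and may blow up near 0.\<close>

lemma density_M_Wright_mixture:
  assumes L: "finite_borel_measure L" and t: "0 < t" and p: "0 < p"
    and l: "pos_density L l" and k: "pos_density Q k"
    and meas: "\<And>A. A \<in> sets borel \<Longrightarrow> has_bochner_integral lpos (\<lambda>\<tau>. M_Wright_time \<nu> \<tau> t * measure (dilate (\<tau> powr p) L) A) (measure Q A)"
    and x: "0 < x"
  shows "has_bochner_integral lborel (\<lambda>\<tau>. indicator {0<..} \<tau> *\<^sub>R (dilate_fun (\<tau> powr p) l x * M_Wright_time \<nu> \<tau> t)) (k x)"
proof -
  define m where "m = (\<lambda>\<tau>. M_Wright_time \<nu> \<tau> t)"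
  have [measurable]: "m \<in> borel_measurable borel" by (simp add: m_def)
  have im: "integrable lpos m" unfolding m_def by (rule integrable_M_Wright_time(1)[OF t])
  \<comment> \<open>\<open>l\<close> is unconstrained off the positive half-line; cut to 0 there, it
    becomes Borel measurable on the line.\<close>
  define l0 where "l0 = (\<lambda>x. indicator {0<..} x *\<^sub>R l x)"
  have il0: "integrable lborel l0"
    using l by (auto simp: pos_density_def l0_def has_bochner_integral_iff)
  then have [measurable]: "l0 \<in> borel_measurable borel"
    by (auto dest: borel_measurable_integrable)
  have "has_bochner_integral lborel (\<lambda>x. indicator {0<..} x *\<^sub>R l0 x) (\<integral>x. l0 x \<partial>lborel)"
  proof -
    have "indicator {0<..} x *\<^sub>R l0 x = l0 x" for x
      by (simp add: l0_def indicator_def)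
    then show ?thesis
      using has_bochner_integral_integrable[OF il0] by (simp only:)
  qed
  then have il: "integrable lpos l0"
    by (subst (asm) has_bochner_integral_lpos_iff[symmetric]) (auto simp: has_bochner_integral_iff)
  define F where "F = (\<lambda>x \<tau>. m \<tau> * dilate_fun (\<tau> powr p) l0 x)"
  have Fm: "(\<lambda>(\<tau>, x). F x \<tau>) \<in> borel_measurable (lpos \<Otimes>\<^sub>M lpos)"
    unfolding F_def dilate_fun_def by measurable
  have Fm1 [measurable]: "F x \<in> borel_measurable borel" for x
    unfolding F_def dilate_fun_def by measurable
  obtain D where D: "\<And>\<tau>. 0 < \<tau> \<Longrightarrow> \<bar>\<tau> * m \<tau>\<bar> \<le> D"
    using M_Wright_time_linear_bound[OF t] unfolding m_def by blast
  \<comment> \<open>\<open>T x y\<close> is \<open>\<tau> * m \<tau>\<close> at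
    \<open>\<tau> = (x / y) powr (1 / p)\<close>. Now \<open>x\<close> occurs in a bounded
    continuous factor and no longer in the density, so \<open>D * \<bar>l0 y\<bar>\<close> is a
    majorant independent of \<open>x\<close>.\<close>
  define T where "T = (\<lambda>x y. (x powr (1 / p) * y powr (- (1 / p))) * m (x powr (1 / p) * y powr (- (1 / p))))"
  have Tb: "\<bar>T x y\<bar> \<le> D" if "0 < x" "0 < y" for x y
    unfolding T_def by (rule D) (use that in simp)
  \<comment> \<open>substitution \<open>\<tau> = (x / y) powr (1 / p)\<close>\<close>
  have subst: "has_bochner_integral lpos (F x) I \<longleftrightarrow> has_bochner_integral lpos (\<lambda>y. (1 / (p * x)) * (T x y * l0 y)) I"
    if x: "0 < x" for x I
  proof -
    define c where "c = x powr (1 / p)"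
    have c: "0 < c" using x by (simp add: c_def)
    have "(c * \<bar>- (1 / p)\<bar> * y powr (- (1 / p) - 1)) *\<^sub>R F x (c * y powr (- (1 / p))) = (1 / (p * x)) * (T x y * l0 y)"
      if y: "0 < y" for y
    proof -
      have "(c * y powr (- (1 / p))) powr p = x / y"
        using x y p c by (simp add: powr_mult powr_divide powr_powr c_def powr_minus_divide)
      then have "dilate_fun ((c * y powr (- (1 / p))) powr p) l0 x = l0 y * y / x"
        using x y by (simp add: dilate_fun_def)
      moreover have "y powr (- (1 / p) - 1) * y = y powr (- (1 / p))"
        using y by (simp add: powr_diff)
      ultimately show ?thesis
        using x y p by (simp add: F_def T_def c_def[symmetric])
    qed
    then have "has_bochner_integral lpos (\<lambda>y. (c * \<bar>- (1 / p)\<bar> * y powr (- (1 / p) - 1)) *\<^sub>R F x (c * y powr (- (1 / p)))) I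
       \<longleftrightarrow> has_bochner_integral lpos (\<lambda>y. (1 / (p * x)) * (T x y * l0 y)) I"
      by (intro has_bochner_integral_cong_AE) (auto intro!: AE_lposI simp: T_def)
    then show ?thesis
      using has_bochner_integral_lpos_powr_subst[OF Fm1 c, of "- (1 / p)" x I] p by simp
  qed
  have Tl: "norm (T x y * l0 y) \<le> D * \<bar>l0 y\<bar>" if "0 < x" "0 < y" for x y
    using mult_right_mono[OF Tb[OF that], of "\<bar>l0 y\<bar>"] by (simp add: abs_mult)
  have iT: "integrable lpos (\<lambda>y. T x y * l0 y)" if "0 < x" for x
    by (rule integrable_lpos_bound[where g = "\<lambda>y. D * \<bar>l0 y\<bar>"]) (use il Tl[OF that] in \<open>auto simp: T_def\<close>)
  define \<phi> where "\<phi> = (\<lambda>x. \<integral>\<tau>. F x \<tau> \<partial>lpos)"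
  have F\<phi>: "has_bochner_integral lpos (F x) (\<phi> x)" and \<phi>_eq: "\<phi> x = (1 / (p * x)) * (\<integral>y. T x y * l0 y \<partial>lpos)" if "0 < x" for x
  proof -
    have "has_bochner_integral lpos (\<lambda>y. (1 / (p * x)) * (T x y * l0 y)) ((1 / (p * x)) * (\<integral>y. T x y * l0 y \<partial>lpos))"
      using iT[OF that] by (intro has_bochner_integral_mult_right has_bochner_integral_integrable)
    then have *: "has_bochner_integral lpos (F x) ((1 / (p * x)) * (\<integral>y. T x y * l0 y \<partial>lpos))"
      by (subst subst[OF that])
    then show "\<phi> x = (1 / (p * x)) * (\<integral>y. T x y * l0 y \<partial>lpos)"
      unfolding \<phi>_def by (rule has_bochner_integral_integral_eq)
    with * show "has_bochner_integral lpos (F x) (\<phi> x)" by simp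
  qed
  have cont\<phi>: "continuous_on {0<..} \<phi>"
  proof -
    have "continuous_on {0<..} (\<lambda>x. \<integral>y. T x y * l0 y \<partial>lpos)"
    proof (rule continuous_on_lpos_integral[where g = "\<lambda>y. D * \<bar>l0 y\<bar>"])
      fix y :: real assume y: "0 < y"
      have "continuous_on {0<..} m"
        unfolding m_def by (rule continuous_on_M_Wright_time[OF t])
      then have "continuous_on {0<..} (\<lambda>x. m (x powr (1 / p) * y powr (- (1 / p))))"
        by (rule continuous_on_compose2) (use y in \<open>auto intro!: continuous_intros\<close>)
      then show "continuous_on {0<..} (\<lambda>x. T x y * l0 y)"
        unfolding T_def by (intro continuous_intros) auto
    qed (use il Tl in \<open>auto simp: T_def\<close>)
    then have "continuous_on {0<..} (\<lambda>x. (1 / (p * x)) * (\<integral>y. T x y * l0 y \<partial>lpos))"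
      using p by (intro continuous_intros) auto
    then show ?thesis by (rule continuous_on_eq) (simp add: \<phi>_eq)
  qed
  have dl0: "has_bochner_integral lpos (dilate_fun r (\<lambda>x. f (l0 x))) (\<integral>x. f (l0 x) \<partial>lpos)"
    if r: "0 < r" and f [measurable]: "f \<in> borel_measurable borel" and fi: "integrable lpos (\<lambda>x. f (l0 x))" for r and f :: "real \<Rightarrow> real"
  proof -
    have "has_bochner_integral lpos (\<lambda>x. (1 / r) *\<^sub>R f (l0 ((1 / r) * x))) (\<integral>x. f (l0 x) \<partial>lpos)"
      using has_bochner_integral_integrable[OF fi] r by (subst has_bochner_integral_lpos_scale) auto
    then show ?thesis by (simp add: dilate_fun_def[abs_def])
  qed
  have iF: "integrable (lpos \<Otimes>\<^sub>M lpos) (\<lambda>(\<tau>, x). indicator A x * F x \<tau>)" if A [measurable]: "A \<in> sets borel" for A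
  proof (rule lpos_pair_integrable[where g = "\<lambda>\<tau>. \<bar>m \<tau>\<bar>" and h = "\<lambda>\<tau>. dilate_fun (\<tau> powr p) (\<lambda>x. \<bar>l0 x\<bar>)"])
    show "(\<lambda>(\<tau>, x). indicator A x * F x \<tau>) \<in> borel_measurable (lpos \<Otimes>\<^sub>M lpos)"
      unfolding F_def dilate_fun_def by measurable
    show "norm (case (\<tau>, x) of (\<tau>, x) \<Rightarrow> indicator A x * F x \<tau>) \<le> \<bar>m \<tau>\<bar> * dilate_fun (\<tau> powr p) (\<lambda>x. \<bar>l0 x\<bar>) x" for \<tau> x
      by (auto simp: F_def dilate_fun_def abs_mult indicator_def)
    fix \<tau> :: real assume "0 < \<tau>"
    then have "has_bochner_integral lpos (dilate_fun (\<tau> powr p) (\<lambda>x. \<bar>l0 x\<bar>)) (\<integral>x. \<bar>l0 x\<bar> \<partial>lpos)"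
      using il by (intro dl0) auto
    then show "integrable lpos (dilate_fun (\<tau> powr p) (\<lambda>x. \<bar>l0 x\<bar>))"
      "integral\<^sup>L lpos (dilate_fun (\<tau> powr p) (\<lambda>x. \<bar>l0 x\<bar>)) \<le> (\<integral>x. \<bar>l0 x\<bar> \<partial>lpos)"
      by (auto simp: has_bochner_integral_iff)
  qed (use im in auto)
  have "pos_density Q \<phi>"
    unfolding pos_density_def
  proof (intro conjI cont\<phi> ballI impI)
    fix A :: "real set" assume A: "A \<in> sets borel" "A \<subseteq> {0<..}"
    note [measurable] = A(1)
    have inner: "(\<integral>x. indicator A x * F x \<tau> \<partial>lpos) = m \<tau> * measure (dilate (\<tau> powr p) L) A" if \<tau>: "0 < \<tau>" for \<tau>
    proof -
      have "pos_density (dilate (\<tau> powr p) L) (dilate_fun (\<tau> powr p) l)"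
        by (rule pos_density_dilate[OF L l]) (use \<tau> in simp)
      then have "has_bochner_integral lborel (\<lambda>x. indicator A x *\<^sub>R dilate_fun (\<tau> powr p) l x) (measure (dilate (\<tau> powr p) L) A)"
        using A by (simp add: pos_density_def)
      moreover have "indicator A x *\<^sub>R dilate_fun (\<tau> powr p) l x = indicator {0<..} x *\<^sub>R (indicator A x * dilate_fun (\<tau> powr p) l0 x)" for x
        using A(2) \<tau> by (auto simp: indicator_def dilate_fun_def l0_def)
      ultimately have "has_bochner_integral lborel (\<lambda>x. indicator {0<..} x *\<^sub>R (indicator A x * dilate_fun (\<tau> powr p) l0 x)) (measure (dilate (\<tau> powr p) L) A)"
        by (simp only:)
      then have "has_bochner_integral lpos (\<lambda>x. indicator A x * dilate_fun (\<tau> powr p) l0 x) (measure (dilate (\<tau> powr p) L) A)"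
        by (subst has_bochner_integral_lpos_iff) (simp_all add: dilate_fun_def)
      then have "has_bochner_integral lpos (\<lambda>x. m \<tau> * (indicator A x * dilate_fun (\<tau> powr p) l0 x)) (m \<tau> * measure (dilate (\<tau> powr p) L) A)"
        by (rule has_bochner_integral_mult_right)
      then show ?thesis
        by (auto simp: F_def mult.left_commute dest: has_bochner_integral_integral_eq)
    qed
    have mA: "has_bochner_integral lpos (\<lambda>\<tau>. m \<tau> * measure (dilate (\<tau> powr p) L) A) (measure Q A)"
      using meas[OF A(1)] by (simp add: m_def)
    have "(\<integral>x. (\<integral>\<tau>. indicator A x * F x \<tau> \<partial>lpos) \<partial>lpos) = (\<integral>\<tau>. (\<integral>x. indicator A x * F x \<tau> \<partial>lpos) \<partial>lpos)"
      by (rule lpos_pair.Fubini_integral) (rule iF[OF A(1)])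
    also have "\<dots> = (\<integral>\<tau>. m \<tau> * measure (dilate (\<tau> powr p) L) A \<partial>lpos)"
    proof (rule integral_cong_AE)
      show "(\<lambda>\<tau>. \<integral>x. indicator A x * F x \<tau> \<partial>lpos) \<in> borel_measurable lpos"
        using lpos_pair.integrable_fst[OF iF[OF A(1)]] by (rule borel_measurable_integrable)
    qed (use inner mA in \<open>auto intro!: AE_lposI dest: borel_measurable_has_bochner_integral\<close>)
    also have "\<dots> = measure Q A"
      using mA by (rule has_bochner_integral_integral_eq)
    finally have "has_bochner_integral lpos (\<lambda>x. indicator A x * \<phi> x) (measure Q A)"
      using lpos_pair.integrable_snd[OF iF[OF A(1)]] by (simp add: has_bochner_integral_iff \<phi>_def)
    moreover have "\<phi> \<in> borel_measurable borel"
    proof -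
      have "\<phi> \<in> borel_measurable lpos"
        unfolding \<phi>_def by (rule lpos.borel_measurable_lebesgue_integral) (simp add: F_def dilate_fun_def case_prod_beta')
      then show ?thesis by simp
    qed
    ultimately have "has_bochner_integral lborel (\<lambda>x. indicator {0<..} x *\<^sub>R (indicator A x * \<phi> x)) (measure Q A)"
      by (subst (asm) has_bochner_integral_lpos_iff) auto
    moreover have "indicator {0<..} x *\<^sub>R (indicator A x * \<phi> x) = indicator A x *\<^sub>R \<phi> x" for x
      using A(2) by (auto simp: indicator_def)
    ultimately show "has_bochner_integral lborel (\<lambda>x. indicator A x *\<^sub>R \<phi> x) (measure Q A)"
      by (simp only:)
  qed
  \<comment> \<open>Two continuous densities of \<open>Q\<close> agree at every positive point, not
    just almost everywhere.\<close>
  then have "\<phi> x = k x"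
    using k x by (rule pos_density_unique)
  then have "has_bochner_integral lborel (\<lambda>\<tau>. indicator {0<..} \<tau> *\<^sub>R F x \<tau>) (k x)"
    using F\<phi>[OF x] has_bochner_integral_lpos_iff[OF Fm1] by metis
  moreover have "indicator {0<..} \<tau> *\<^sub>R F x \<tau> = indicator {0<..} \<tau> *\<^sub>R (dilate_fun (\<tau> powr p) l x * M_Wright_time \<nu> \<tau> t)" for \<tau>
    using x by (auto simp: indicator_def F_def m_def dilate_fun_def l0_def)
  ultimately show ?thesis by (simp only:)
qed

end

lemma has_M_integral_cong:
  assumes "0 < t" "\<And>\<tau>. 0 < \<tau> \<Longrightarrow> f \<tau> = g \<tau>"
  shows "has_M_integral \<nu> t f I \<longleftrightarrow> has_M_integral \<nu> t g I"
proof -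
  have "indicator {0<..} \<tau> *\<^sub>R (f \<tau> * M_Wright_time \<nu> \<tau> t) = indicator {0<..} \<tau> *\<^sub>R (g \<tau> * M_Wright_time \<nu> \<tau> t)" for \<tau>
    using assms by (cases "0 < \<tau>") auto
  then show ?thesis
    using assms unfolding has_M_integral_def by (simp only:)
qed

text \<open>Common form of both parts: \<open>p = 1 / \<alpha>\<close>,
  \<open>\<nu> = \<beta>\<close> for the stable law, and \<open>p = 1\<close>,
  \<open>\<nu> = \<beta> / \<alpha>\<close> for the neutral one. In either case
  \<open>p * \<nu>\<close> is the exponent \<open>\<beta> / \<alpha>\<close> of the Green
  function.\<close>

lemma M_Wright_subordination:
  assumes L: "real_distribution L" and K: "real_distribution K"
    and nu: "0 < \<nu>" "\<nu> \<le> 1" and p: "0 < p"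
    and VL: "\<And>\<kappa> r. 0 < r \<Longrightarrow> has_bochner_integral lpos (\<lambda>\<tau>. exp (- (r * \<tau>)) * char L (\<tau> powr p * \<kappa>)) (V \<kappa> r)"
    and VK: "\<And>\<kappa> s. 0 < s \<Longrightarrow> has_bochner_integral lpos (\<lambda>t. exp (- (s * t)) * char K (t powr (p * \<nu>) * \<kappa>)) (of_real (s powr (\<nu> - 1)) * V \<kappa> (s powr \<nu>))"
    and t: "0 < t"
  shows "A \<in> sets borel \<Longrightarrow>
      has_M_integral \<nu> t (\<lambda>\<tau>. measure (dilate (\<tau> powr p) L) A) (measure (dilate (t powr (p * \<nu>)) K) A)"
    and "pos_density K k \<Longrightarrow> pos_density L l \<Longrightarrow> 0 < x \<Longrightarrow>
      has_M_integral \<nu> t (\<lambda>\<tau>. dilate_fun (\<tau> powr p) l x) (dilate_fun (t powr (p * \<nu>)) k x)"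
proof -
  have fin: "finite_borel_measure L" "finite_borel_measure K"
    using L K by (auto intro: real_distribution.finite_borel_measure_M)
  have dens: "pos_density (dilate (t powr (p * \<nu>)) K) (dilate_fun (t powr (p * \<nu>)) k)" if "pos_density K k"
    by (rule pos_density_dilate[OF fin(2) that]) (use t in simp)
  have "(A \<in> sets borel \<longrightarrow>
      has_M_integral \<nu> t (\<lambda>\<tau>. measure (dilate (\<tau> powr p) L) A) (measure (dilate (t powr (p * \<nu>)) K) A)) \<and>
    (pos_density K k \<longrightarrow> pos_density L l \<longrightarrow> 0 < x \<longrightarrow>
      has_M_integral \<nu> t (\<lambda>\<tau>. dilate_fun (\<tau> powr p) l x) (dilate_fun (t powr (p * \<nu>)) k x))"
  proof (cases "\<nu> = 1")
    case True
    have "L = K"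
    proof (rule char_eq_of_laplace[OF L K VL])
      show "has_bochner_integral lpos (\<lambda>t. exp (- (s * t)) * char K (t powr p * \<kappa>)) (V \<kappa> s)" if "0 < s" for \<kappa> s
        using VK[OF that, of \<kappa>] that by (simp add: True)
    qed
    then show ?thesis
      using pos_density_unique[of K k l "x / t powr p"] t by (auto simp: has_M_integral_def True dilate_fun_def)
  next
    case False
    interpret wright_order \<nu> by unfold_locales (use nu False in auto)
    have meas: "has_bochner_integral lpos (\<lambda>\<tau>. M_Wright_time \<nu> \<tau> t * measure (dilate (\<tau> powr p) L) A) (measure (dilate (t powr (p * \<nu>)) K) A)"
      if "A \<in> sets borel" for A
      by (rule measure_M_Wright_mixture[OF L K VL VK t that])
    have "has_bochner_integral lborel (\<lambda>\<tau>. indicator {0<..} \<tau> *\<^sub>R (measure (dilate (\<tau> powr p) L) A * M_Wright_time \<nu> \<tau> t)) (measure (dilate (t powr (p * \<nu>)) K) A)"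
      if "A \<in> sets borel"
    proof -
      have "(\<lambda>\<tau>. M_Wright_time \<nu> \<tau> t * measure (dilate (\<tau> powr p) L) A) \<in> borel_measurable lpos"
        using meas[OF that] by (rule borel_measurable_has_bochner_integral)
      then have m: "(\<lambda>\<tau>. M_Wright_time \<nu> \<tau> t * measure (dilate (\<tau> powr p) L) A) \<in> borel_measurable borel"
        by simp
      show ?thesis
        using meas[OF that] unfolding has_bochner_integral_lpos_iff[OF m] by (simp only: mult.commute)
    qed
    then show ?thesis
      using density_M_Wright_mixture[OF fin(1) t p _ dens meas, of l x] False
      unfolding has_M_integral_def by simp
  qed
  then show "A \<in> sets borel \<Longrightarrow>
      has_M_integral \<nu> t (\<lambda>\<tau>. measure (dilate (\<tau> powr p) L) A) (measure (dilate (t powr (p * \<nu>)) K) A)"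
    "pos_density K k \<Longrightarrow> pos_density L l \<Longrightarrow> 0 < x \<Longrightarrow>
      has_M_integral \<nu> t (\<lambda>\<tau>. dilate_fun (\<tau> powr p) l x) (dilate_fun (t powr (p * \<nu>)) k x)"
    by blast+
qed

theorem mainTheorem3:
  fixes \<alpha> \<beta> \<theta> :: real and K L N :: "real measure"
  assumes "0 < \<alpha>" "\<alpha> \<le> 2" "\<bar>\<theta>\<bar> \<le> min \<alpha> (2 - \<alpha>)"
    and "(0 < \<beta> \<and> \<beta> \<le> 1) \<or> (1 < \<beta> \<and> \<beta> \<le> \<alpha> \<and> \<alpha> \<le> 2)"
    and "reduced_green \<alpha> \<beta> \<theta> K"
    and "stable_law \<alpha> \<theta> L"
    and "reduced_green \<alpha> \<alpha> \<theta> N"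
  shows "(0 < \<beta> \<and> \<beta> \<le> 1 \<longrightarrow>
      (\<forall>t>0.
        (\<forall>A \<in> sets borel. A \<subseteq> {0<..} \<longrightarrow>
          has_M_integral \<beta> t
            (\<lambda>\<tau>. measure (dilate (\<tau> powr (1 / \<alpha>)) L) A)
            (measure (dilate (t powr (\<beta> / \<alpha>)) K) A)) \<and>
        (\<forall>k l. pos_density K k \<longrightarrow> pos_density L l \<longrightarrow>
          (\<forall>x>0. has_M_integral \<beta> t
            (\<lambda>\<tau>. dilate_fun (\<tau> powr (1 / \<alpha>)) l x)
            (dilate_fun (t powr (\<beta> / \<alpha>)) k x))))) \<and>
    (0 < \<beta> / \<alpha> \<and> \<beta> / \<alpha> \<le> 1 \<longrightarrow>
      (\<forall>t>0.
        (\<forall>A \<in> sets borel. A \<subseteq> {0<..} \<longrightarrow>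
          has_M_integral (\<beta> / \<alpha>) t
            (\<lambda>\<tau>. measure (dilate \<tau> N) A)
            (measure (dilate (t powr (\<beta> / \<alpha>)) K) A)) \<and>
        (\<forall>k n. pos_density K k \<longrightarrow> pos_density N n \<longrightarrow>
          (\<forall>x>0. has_M_integral (\<beta> / \<alpha>) t
            (\<lambda>\<tau>. dilate_fun \<tau> n x)
            (dilate_fun (t powr (\<beta> / \<alpha>)) k x)))))"
proof -
  have \<theta>1: "\<bar>\<theta>\<bar> \<le> 1"
    using assms(3) by linarith
  have L: "real_distribution L"
    using assms(6) by (simp add: stable_law_def)
  have K: "real_distribution K" and N: "real_distribution N"
    using assms(5,7) by (auto intro: reduced_green_real_distribution)
  note Kt = reduced_green_laplace[OF assms(5) K]
  show ?thesis
  proof (intro conjI impI allI ballI)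
    fix t :: real assume "0 < \<beta> \<and> \<beta> \<le> 1" and t: "0 < t"
    then have \<beta>: "0 < \<beta>" "\<beta> \<le> 1" by auto
    define V where "V = (\<lambda>\<kappa> r. 1 / (of_real r + feller_symbol \<alpha> \<theta> \<kappa>))"
    have VL: "has_bochner_integral lpos (\<lambda>\<tau>. exp (- (r * \<tau>)) * char L (\<tau> powr (1 / \<alpha>) * \<kappa>)) (V \<kappa> r)"
      if "0 < r" for \<kappa> r
      unfolding V_def by (rule stable_law_laplace[OF assms(6,1) \<theta>1 that])
    have VK: "has_bochner_integral lpos (\<lambda>t. exp (- (s * t)) * char K (t powr (1 / \<alpha> * \<beta>) * \<kappa>))
        (of_real (s powr (\<beta> - 1)) * V \<kappa> (s powr \<beta>))" if "0 < s" for \<kappa> s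
      using Kt[OF that, of \<kappa>] by (simp add: V_def)
    have p: "0 < 1 / \<alpha>" using assms(1) by simp
    note sub = M_Wright_subordination[OF L K \<beta> p VL VK t]
    show "has_M_integral \<beta> t (\<lambda>\<tau>. measure (dilate (\<tau> powr (1 / \<alpha>)) L) A) (measure (dilate (t powr (\<beta> / \<alpha>)) K) A)"
      if "A \<in> sets borel" "A \<subseteq> {0<..}" for A
      using sub(1)[OF _ _ that(1)] by simp
    show "has_M_integral \<beta> t (\<lambda>\<tau>. dilate_fun (\<tau> powr (1 / \<alpha>)) l x) (dilate_fun (t powr (\<beta> / \<alpha>)) k x)"
      if "pos_density K k" "pos_density L l" "0 < x" for k l x
      using sub(2)[OF _ _ that] by simp
  next
    fix t :: real assume "0 < \<beta> / \<alpha> \<and> \<beta> / \<alpha> \<le> 1" and t: "0 < t"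
    then have \<nu>: "0 < \<beta> / \<alpha>" "\<beta> / \<alpha> \<le> 1" by auto
    define V where "V = (\<lambda>\<kappa> r. of_real (r powr (\<alpha> - 1)) / (of_real (r powr \<alpha>) + feller_symbol \<alpha> \<theta> \<kappa>))"
    have VN: "has_bochner_integral lpos (\<lambda>\<tau>. exp (- (r * \<tau>)) * char N (\<tau> powr 1 * \<kappa>)) (V \<kappa> r)"
      if "0 < r" for \<kappa> r
      using reduced_green_laplace[OF assms(7) N that, of \<kappa>] assms(1) by (simp add: V_def)
    have VK: "has_bochner_integral lpos (\<lambda>t. exp (- (s * t)) * char K (t powr (1 * (\<beta> / \<alpha>)) * \<kappa>))
        (of_real (s powr (\<beta> / \<alpha> - 1)) * V \<kappa> (s powr (\<beta> / \<alpha>)))" if s: "0 < s" for \<kappa> s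
    proof -
      have "s powr (\<beta> / \<alpha> - 1) * (s powr (\<beta> / \<alpha>)) powr (\<alpha> - 1) = s powr (\<beta> - 1)"
      proof -
        have "\<beta> / \<alpha> - 1 + \<beta> / \<alpha> * (\<alpha> - 1) = \<beta> - 1"
          using assms(1) by (simp add: right_diff_distrib)
        then show ?thesis
          unfolding powr_powr powr_add[symmetric] by (simp only:)
      qed
      moreover have "(s powr (\<beta> / \<alpha>)) powr \<alpha> = s powr \<beta>"
        unfolding powr_powr using assms(1) by simp
      ultimately have "of_real (s powr (\<beta> / \<alpha> - 1)) * V \<kappa> (s powr (\<beta> / \<alpha>)) =
          of_real (s powr (\<beta> - 1)) / (of_real (s powr \<beta>) + feller_symbol \<alpha> \<theta> \<kappa>)"
        unfolding V_def by (simp only: times_divide_eq_right of_real_mult[symmetric])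
      then show ?thesis
        using Kt[OF s, of \<kappa>] by simp
    qed
    have p: "0 < (1 :: real)" by simp
    note sub = M_Wright_subordination[OF N K \<nu> p VN VK t]
    \<comment> \<open>Here and below, \<open>\<tau> powr 1\<close> is replaced by
      \<open>\<tau>\<close> through \<open>has_M_integral_cong\<close>, which compares integrands at
      positive \<open>\<tau>\<close>, where the two agree.\<close>
    show "has_M_integral (\<beta> / \<alpha>) t (\<lambda>\<tau>. measure (dilate \<tau> N) A) (measure (dilate (t powr (\<beta> / \<alpha>)) K) A)"
      if "A \<in> sets borel" "A \<subseteq> {0<..}" for A
      using sub(1)[OF _ _ that(1)] by (subst has_M_integral_cong[OF t, where g = "\<lambda>\<tau>. measure (dilate (\<tau> powr 1) N) A"]) auto
    show "has_M_integral (\<beta> / \<alpha>) t (\<lambda>\<tau>. dilate_fun \<tau> n x) (dilate_fun (t powr (\<beta> / \<alpha>)) k x)"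
      if "pos_density K k" "pos_density N n" "0 < x" for k n x
      using sub(2)[OF _ _ that] by (subst has_M_integral_cong[OF t, where g = "\<lambda>\<tau>. dilate_fun (\<tau> powr 1) n x"]) auto
  qed
qed

end
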